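(* Let $\hat\theta:=\hat\theta_{C/\pi(X)}+\hat\omega\big(\hat\theta^f-\hat\theta^f_{C/\pi(X)}\big)$, with the components and influence functions $\phi,\phi^f$ defined in the context. Assume the data $(X_i,C_i,Y_i)_{i=1}^{n+N}$ are i.i.d. from $\mathbb Q^*$, that $C$ is conditionally independent of $Y$ given $X$, that $\epsilon<\pi(X)<1-\epsilon$ for some $\epsilon>0$, and that $\hat\omega\xrightarrow{p}\omega$, where $$\omega:=\frac{\operatorname{Cov}\left(\frac{C_i}{\pi(X_i)}\phi(X_i,Y_i),\ \Big(\frac{C_i}{\pi(X_i)}-1\Big)\phi^f(X_i)\right)}{\operatorname{Var}\left(\Big(1-\frac{C_i}{\pi(X_i)}\Big)\phi^f(X_i)\right)}.$$ Then, as $n+N\to\infty$, $\sqrt{n+N}\,(\hat\theta-\theta_0)\xrightarrow{d}N(0,\sigma^2)$, where $$\sigma^2=\operatorname{Var}\left(\frac{C_i}{\pi(X_i)}\phi(X_i,Y_i)\right)-\frac{\operatorname{Cov}\left(\frac{C_i}{\pi(X_i)}\phi(X_i,Y_i),\ \Big(1-\frac{C_i}{\pi(X_i)}\Big)\phi^f(X_i)\right)^2}{\operatorname{Var}\left(\Big(1-\frac{C_i}{\pi(X_i)}\Big)\phi^f(X_i)\right)}.$$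
   Context: Setting: $(X,C,Y)\sim\mathbb Q^*$ with $X$ a real vector, $Y$ real, $C\in\{0,1\}$ the indicator that $Y$ is observed; observed data are $(X_i,C_i,C_iY_i)_{i=1}^{n+N}$. $\pi(X)=\Pr(C=1\mid X)$ is known, and $f$ is a fixed deterministic real-valued function of $X$. Inequalities between vectors are componentwise. $\Phi$ is a real-valued functional on cumulative distribution functions (CDFs), Hadamard differentiable with respect to the supremum norm (at the CDFs $F_0$ and $F_0^f$ below), with Gateaux derivative $\dot\Phi(F;h)$ at $F$ in direction $h$, linear in $h$. Let $F_0(x,y)=\mathbb Q^*(X\le x,Y\le y)$ and $F_0^f(x,y)=\mathbb Q^*(X\le x,f(X)\le y)$. The target is $\theta_0:=\Phi(F_0)$ (full data distribution). With $\delta_{x,y}(u_1,u_2)=I(x\le u_1,y\le u_2)$, set $$\phi(x,y):=\dot\Phi(F_0;\delta_{x,y}-F_0),\qquad \phi^f(x):=\dot\Phi(F_0^f;\delta_{x,f(x)}-F_0^f)$$ ($\phi^f(x)$ is written $\phi(x,f(x))$ in the paper). The estimators are $$\hat\theta_{C/\pi(X)}:=\Phi(F_{C/\pi(X)}),\quad F_{C/\pi(X)}(x,y):=\frac{\sum_{i=1}^{n+N}\frac{C_i}{\pi(X_i)}I(X_i\le x,Y_i\le y)}{\sum_{i=1}^{n+N}\frac{C_i}{\pi(X_i)}},$$ $$\hat\theta^f_{C/\pi(X)}:=\Phi(F^f_{C/\pi(X)}),\quad F^f_{C/\pi(X)}(x,y):=\frac{\sum_{i=1}^{n+N}\frac{C_i}{\pi(X_i)}I(X_i\le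 x,f(X_i)\le y)}{\sum_{i=1}^{n+N}\frac{C_i}{\pi(X_i)}},$$ $$\hat\theta^f:=\Phi(F^f),\quad F^f(x,y):=\frac1{n+N}\sum_{i=1}^{n+N}I(X_i\le x,f(X_i)\le y).$$ The variance in the denominator of $\omega$ is assumed positive. *)

theory Defs
  imports "HOL-Probability.Probability"
begin

text \<open>
  The order on \<^typ>\<open>real ^ 'd\<close> is componentwise (\<open>less_eq_vec_def\<close>). Functions of \<open>(x, y)\<close>, in
  particular CDFs and the directions of differentiation, have type
  \<open>(real ^ 'd) \<times> real \<Rightarrow> real\<close>. An observation is a triple \<open>(x, c, y)\<close>, and its law
  is a measure on \<open>(real ^ 'd) \<times> real \<times> real\<close>.
\<close>

definition cdfs :: "((real ^ 'd::finite) \<times> real \<Rightarrow> real) set" where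
  "cdfs = {F. \<exists>\<mu>. prob_space \<mu> \<and> sets \<mu> = sets borel \<and>
                  (\<forall>x y. F (x, y) = measure \<mu> {(x', y'). x' \<le> x \<and> y' \<le> y})}"

definition full_cdf ::
  "((real ^ 'd::finite) \<times> real \<times> real) measure \<Rightarrow> (real ^ 'd) \<times> real \<Rightarrow> real" where
  "full_cdf Q = (\<lambda>(x, y). measure Q {(x', c', y'). x' \<le> x \<and> y' \<le> y})"

definition pred_cdf ::
  "((real ^ 'd::finite) \<times> real \<times> real) measure \<Rightarrow> (real ^ 'd \<Rightarrow> real) \<Rightarrow> (real ^ 'd) \<times> real \<Rightarrow> real" where
  "pred_cdf Q f = (\<lambda>(x, y). measure Q {(x', c', y'). x' \<le> x \<and> f x' \<le> y})"

definition point_cdf :: "(real ^ 'd::finite) \<times> real \<Rightarrow> (real ^ 'd) \<times> real \<Rightarrow> real" where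
  "point_cdf = (\<lambda>(x, y) (u1, u2). of_bool (x \<le> u1 \<and> y \<le> u2))"

text \<open>
  If the weights sum to zero, the weighted version below is the zero function (division by zero)
  and hence not a CDF.
\<close>

definition weighted_ecdf ::
  "nat \<Rightarrow> (nat \<Rightarrow> real) \<Rightarrow> (nat \<Rightarrow> (real ^ 'd::finite) \<times> real) \<Rightarrow> (real ^ 'd) \<times> real \<Rightarrow> real" where
  "weighted_ecdf m w z = (\<lambda>u. (\<Sum>i<m. w i * point_cdf (z i) u) / (\<Sum>i<m. w i))"

definition ecdf :: "nat \<Rightarrow> (nat \<Rightarrow> (real ^ 'd::finite) \<times> real) \<Rightarrow> (real ^ 'd) \<times> real \<Rightarrow> real" where
  "ecdf m z = (\<lambda>u. 1 / real m * (\<Sum>i<m. point_cdf (z i) u))"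

text \<open>
  Hadamard differentiability at \<open>F\<close> of a functional with domain \<open>D\<close> in the space of bounded
  functions with the supremum norm, not restricted to a tangential subspace: the perturbed points
  must lie in \<open>D\<close>, and the derivative \<open>L\<close> is a continuous linear functional of bounded functions.
  Values of \<open>\<Phi>\<close> off \<open>D\<close> and of \<open>L\<close> at unbounded functions play no role.
\<close>

definition has_hadamard_derivative_on ::
  "(('b \<Rightarrow> real) \<Rightarrow> real) \<Rightarrow> (('b \<Rightarrow> real) \<Rightarrow> real) \<Rightarrow> ('b \<Rightarrow> real) \<Rightarrow> ('b \<Rightarrow> real) set \<Rightarrow> bool" where
  "has_hadamard_derivative_on \<Phi> L F D \<longleftrightarrow>
     F \<in> D \<and>
     (\<forall>g h. bounded (range g) \<longrightarrow> bounded (range h) \<longrightarrow> L (\<lambda>u. g u + h u) = L g + L h) \<and>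
     (\<forall>a h. bounded (range h) \<longrightarrow> L (\<lambda>u. a * h u) = a * L h) \<and>
     (\<exists>K. \<forall>h. bounded (range h) \<longrightarrow> \<bar>L h\<bar> \<le> K * (SUP u. \<bar>h u\<bar>)) \<and>
     (\<forall>t hs h. (\<forall>k. 0 < t k) \<longrightarrow> t \<longlonglongrightarrow> 0 \<longrightarrow>
        bounded (range h) \<longrightarrow> (\<forall>k. bounded (range (hs k))) \<longrightarrow>
        uniform_limit UNIV hs h sequentially \<longrightarrow>
        (\<forall>k. (\<lambda>u. F u + t k * hs k u) \<in> D) \<longrightarrow>
        (\<lambda>k. (\<Phi> (\<lambda>u. F u + t k * hs k u) - \<Phi> F) / t k) \<longlonglongrightarrow> L h)"

lemma has_hadamard_derivative_onD:
  assumes "has_hadamard_derivative_on \<Phi> L F D" "\<forall>k. 0 < t k" "t \<longlonglongrightarrow> 0"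
    "bounded (range h)" "\<forall>k. bounded (range (hs k))" "uniform_limit UNIV hs h sequentially"
    "\<forall>k. (\<lambda>u. F u + t k * hs k u) \<in> D"
  shows "(\<lambda>k. (\<Phi> (\<lambda>u. F u + t k * hs k u) - \<Phi> F) / t k) \<longlonglongrightarrow> L h"
  using assms(1)[unfolded has_hadamard_derivative_on_def, THEN conjunct2, THEN conjunct2,
      THEN conjunct2, THEN conjunct2, rule_format, of t h hs] assms(2-) by simp

text \<open>The Hadamard derivative is the Gateaux derivative in every admissible direction.\<close>

lemma has_hadamard_derivative_on_imp_gateaux:
  assumes "has_hadamard_derivative_on \<Phi> L F D" "bounded (range h)"
    and D: "\<And>t. 0 < t \<Longrightarrow> t < 1 \<Longrightarrow> (\<lambda>u. F u + t * h u) \<in> D"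
  shows "((\<lambda>t. (\<Phi> (\<lambda>u. F u + t * h u) - \<Phi> F) / t) \<longlongrightarrow> L h) (at_right 0)"
proof (rule tendsto_at_right_sequentially[where b = 1])
  fix S :: "nat \<Rightarrow> real"
  assume S: "\<And>n. 0 < S n" "\<And>n. S n < 1" "S \<longlonglongrightarrow> 0"
  have "uniform_limit UNIV (\<lambda>_::nat. h) h sequentially"
    by (auto simp: uniform_limit_iff)
  then show "(\<lambda>n. (\<Phi> (\<lambda>u. F u + S n * h u) - \<Phi> F) / S n) \<longlonglongrightarrow> L h"
    using has_hadamard_derivative_onD[OF assms(1), where t = S and h = h and hs = "\<lambda>_. h"] S assms(2) D
    by simp
qed simp

definition influence ::
  "(((real ^ 'd::finite) \<times> real \<Rightarrow> real) \<Rightarrow> ((real ^ 'd) \<times> real \<Rightarrow> real) \<Rightarrow> real) \<Rightarrow>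
   ((real ^ 'd) \<times> real \<Rightarrow> real) \<Rightarrow> (real ^ 'd) \<times> real \<Rightarrow> real" where
  "influence d\<Phi> F z = d\<Phi> F (\<lambda>u. point_cdf z u - F u)"

text \<open>\<open>\<pi>\<close> is a version of \<open>Pr (C = 1 | X)\<close> under the law \<open>Q\<close> of \<open>(X, C, Y)\<close>.\<close>

definition is_propensity ::
  "((real ^ 'd::finite) \<times> real \<times> real) measure \<Rightarrow> (real ^ 'd \<Rightarrow> real) \<Rightarrow> bool" where
  "is_propensity Q \<pi> \<longleftrightarrow>
     \<pi> \<in> borel_measurable borel \<and>
     (AE z in Q. real_cond_exp Q (vimage_algebra (space Q) fst borel)
                   (indicator {(x, c, y). c = 1}) z = \<pi> (fst z))"

text \<open>Conditional independence of the random variables \<open>A\<close> and \<open>B\<close> given the sub-\<open>\<sigma>\<close>-algebra \<open>G\<close>.\<close>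

definition cond_indep_vars ::
  "'a measure \<Rightarrow> 'a measure \<Rightarrow> ('a \<Rightarrow> real) \<Rightarrow> ('a \<Rightarrow> real) \<Rightarrow> bool" where
  "cond_indep_vars M G A B \<longleftrightarrow>
     (\<forall>S\<in>sets borel. \<forall>T\<in>sets borel. AE w in M.
        real_cond_exp M G (indicator {w \<in> space M. A w \<in> S \<and> B w \<in> T}) w =
        real_cond_exp M G (indicator {w \<in> space M. A w \<in> S}) w *
        real_cond_exp M G (indicator {w \<in> space M. B w \<in> T}) w)"

definition covariance :: "'a measure \<Rightarrow> ('a \<Rightarrow> real) \<Rightarrow> ('a \<Rightarrow> real) \<Rightarrow> real" where
  "covariance M A B =
     integral\<^sup>L M (\<lambda>w. (A w - integral\<^sup>L M A) * (B w - integral\<^sup>L M B))"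

definition conv_in_prob :: "'a measure \<Rightarrow> (nat \<Rightarrow> 'a \<Rightarrow> real) \<Rightarrow> real \<Rightarrow> bool" where
  "conv_in_prob M A a \<longleftrightarrow>
     (\<forall>e>0. (\<lambda>k. measure M {w \<in> space M. \<bar>A k w - a\<bar> > e}) \<longlonglongrightarrow> 0)"

text \<open>
  The normal law with mean \<open>a\<close> and variance \<open>v \<ge> 0\<close>. For \<open>v = 0\<close> it is the point mass;
  \<^const>\<open>normal_density\<close> is the zero function there.
\<close>

definition normal_law :: "real \<Rightarrow> real \<Rightarrow> real measure" where
  "normal_law a v =
     (if v = 0 then return borel a else density lborel (normal_density a (sqrt v)))"

end

theory Submission
  imports Defs "HOL-Complex_Analysis.Great_Picard"
begin

text \<open>
  The weighted empirical process \<open>\<surd>m (F\<^sub>m - F)\<close> is shown to be asymptotically tight in the supremum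
  norm: Bernstein-type exponential moments and chaining over nested quantile cells of lower orthants
  give events of probability close to 1 on which the paths have a uniformly small oscillation over
  finite partitions of the index space. Any choice of paths on such events has uniformly convergent
  subsequences, so Hadamard differentiability yields a linear expansion that is uniform over the
  events; this avoids measurability questions about \<open>\<Phi>\<close>. A bounded linear functional of bounded
  functions has an influence function of bounded variation, which is Borel measurable and bounded.
  The three estimators are thereby linearised with centred i.i.d. summands, \<open>\<omega>\<close> replaces its
  estimate because the linear terms are stochastically bounded, and the central limit theorem
  applies; \<open>\<sigma>\<^sup>2\<close> is the variance left after regressing on the control variate.
\<close>

section \<open>Hadamard differentiability along asymptotically totally bounded sets\<close>

text \<open>The obstacle is that \<open>L\<close> is only a continuous functional of bounded
  functions, in effect integration against a finitely additive signed measure: measurability of the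
  influence functions is not automatic, and \<open>L\<close> cannot simply be exchanged with an
  expectation. Differentiability supplies limits along deterministic sequences only, so random paths
  have to be treated event by event, with bounds valid at every sample point of the event. The
  chaining rests on three rates: cell masses of order 4^-k give standard deviations of order 2^-k,
  the entropy of level k contributes a factor of order k + 1, and weights (3/2)^k still leave the
  summable (k + 1) (3/4)^k. Chaining has to stop when 2^k reaches the order of sqrt m, where the
  bound on the summands overtakes their variance; monotonicity of the weighted sums in the set
  absorbs what is left. The process is studied for nonnegative bounded weights of mean one, so that
  inverse probability weights and unit weights are two instances of one result.\<close>

lemma uniform_subsequence_of_finite_covers:
  fixes g :: "nat \<Rightarrow> 'u \<Rightarrow> real"
  assumes bd: "\<And>n u. \<bar>g n u\<bar> \<le> R"
    and osc: "\<And>\<kappa>. 0 < \<kappa> \<Longrightarrow> \<exists>P. finite P \<and> \<Union>P = UNIV \<and>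
      (\<forall>\<^sub>F n in sequentially. \<forall>S\<in>P. \<forall>u\<in>S. \<forall>v\<in>S. \<bar>g n u - g n v\<bar> \<le> \<kappa>)"
  obtains r h where "strict_mono (r :: nat \<Rightarrow> nat)" "bounded (range h)"
    "uniform_limit UNIV (\<lambda>k. g (r k)) h sequentially"
proof -
  have "\<exists>P. finite P \<and> \<Union>P = UNIV \<and>
      (\<forall>\<^sub>F n in sequentially. \<forall>S\<in>P. \<forall>u\<in>S. \<forall>v\<in>S. \<bar>g n u - g n v\<bar> \<le> 1 / real (Suc j))" for j
    by (rule osc) simp
  then have "\<forall>j. \<exists>P. finite P \<and> \<Union>P = UNIV \<and>
      (\<forall>\<^sub>F n in sequentially. \<forall>S\<in>P. \<forall>u\<in>S. \<forall>v\<in>S. \<bar>g n u - g n v\<bar> \<le> 1 / real (Suc j))" by blast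
  from choice[OF this] obtain P where P: "finite (P j)" "\<Union>(P j) = UNIV"
    "\<forall>\<^sub>F n in sequentially. \<forall>S\<in>P j. \<forall>u\<in>S. \<forall>v\<in>S. \<bar>g n u - g n v\<bar> \<le> 1 / real (Suc j)" for j
    by blast
  define rep where "rep S = (SOME u. u \<in> S)" for S :: "'u set"
  have rep: "rep S \<in> S" if "u \<in> S" for S u
    unfolding rep_def using that by (rule someI)
  \<comment> \<open>One representative per cell of every cover gives a countable set. A diagonal
    subsequence that converges on it is uniformly Cauchy, because each point shares a cell with a
    representative: the Arzela-Ascoli argument with finite covers in place of a topology on the
    index set.\<close>
  define E where "E = (\<Union>j. rep ` P j)"
  have "countable E"
    unfolding E_def using P(1) by (auto intro: countable_finite)
  then obtain r :: "nat \<Rightarrow> nat" where r: "strict_mono r"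
    and lim: "\<And>u. u \<in> E \<Longrightarrow> \<exists>l. (\<lambda>n. g (r n) u) \<longlonglongrightarrow> l"
    using function_convergent_subsequence[of E g R] bd by (auto simp: real_norm_def)
  have "uniformly_Cauchy_on UNIV (\<lambda>k. g (r k))"
  proof (rule uniformly_Cauchy_onI)
    fix e :: real assume "0 < e"
    then obtain j where j: "1 / real (Suc j) < e / 3"
      using nat_approx_posE[of "e / 3"] by (metis divide_pos_pos zero_less_numeral)
    obtain N1 where "\<forall>n\<ge>N1. \<forall>S\<in>P j. \<forall>u\<in>S. \<forall>v\<in>S. \<bar>g n u - g n v\<bar> \<le> 1 / real (Suc j)"
      using P(3)[of j] by (auto simp only: eventually_sequentially)
    then have N1: "\<bar>g n u - g n v\<bar> \<le> 1 / real (Suc j)"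
      if "n \<ge> N1" "S \<in> P j" "u \<in> S" "v \<in> S" for n S u v
      using that by simp
    have "\<exists>N. \<forall>m\<ge>N. \<forall>n\<ge>N. \<bar>g (r m) (rep S) - g (r n) (rep S)\<bar> < e / 3" if "S \<in> P j" for S
    proof -
      have "rep S \<in> E" using that by (auto simp: E_def)
      from lim[OF this] have "Cauchy (\<lambda>n. g (r n) (rep S))"
        using LIMSEQ_imp_Cauchy by blast
      from CauchyD[OF this, of "e / 3"] \<open>0 < e\<close> show ?thesis by (auto simp: real_norm_def)
    qed
    then obtain N2 where N2: "\<And>S m n. S \<in> P j \<Longrightarrow> m \<ge> N2 S \<Longrightarrow> n \<ge> N2 S \<Longrightarrow>
        \<bar>g (r m) (rep S) - g (r n) (rep S)\<bar> < e / 3" by metis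
    define N where "N = Max (insert N1 (N2 ` P j))"
    have N: "N1 \<le> N" "\<And>S. S \<in> P j \<Longrightarrow> N2 S \<le> N"
      using P(1)[of j] by (auto simp: N_def)
    show "\<exists>M. \<forall>x\<in>UNIV. \<forall>m\<ge>M. \<forall>n\<ge>M. dist (g (r m) x) (g (r n) x) < e"
    proof (intro exI ballI allI impI)
      fix x :: 'u and m n assume mn: "m \<ge> N" "n \<ge> N"
      obtain S where S: "S \<in> P j" "x \<in> S" using P(2)[of j] by blast
      have r_ge: "r m \<ge> N1" "r n \<ge> N1"
        using mn N(1) seq_suble[OF r, of m] seq_suble[OF r, of n] by linarith+
      have "\<bar>g (r m) x - g (r m) (rep S)\<bar> \<le> 1 / real (Suc j)"
        "\<bar>g (r n) x - g (r n) (rep S)\<bar> \<le> 1 / real (Suc j)"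
        using N1[OF r_ge(1) S(1,2) rep[OF S(2)]] N1[OF r_ge(2) S(1,2) rep[OF S(2)]] by simp_all
      moreover have "\<bar>g (r m) (rep S) - g (r n) (rep S)\<bar> < e / 3"
        using N2[OF S(1)] N(2)[OF S(1)] mn by force
      ultimately show "dist (g (r m) x) (g (r n) x) < e"
        using j unfolding dist_real_def by linarith
    qed
  qed
  then obtain h where h: "uniform_limit UNIV (\<lambda>k. g (r k)) h sequentially"
    using Cauchy_uniformly_convergent uniformly_convergent_uniform_limit_iff by blast
  have "\<bar>h u\<bar> \<le> R" for u
  proof (rule LIMSEQ_le_const2)
    show "(\<lambda>k. \<bar>g (r k) u\<bar>) \<longlonglongrightarrow> \<bar>h u\<bar>"
      using tendsto_uniform_limitI[OF h, of u] by (intro tendsto_rabs) auto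
    show "\<exists>N. \<forall>n\<ge>N. \<bar>g (r n) u\<bar> \<le> R" using bd by blast
  qed
  then have "bounded (range h)" by (auto simp: bounded_iff)
  then show thesis using that r h by blast
qed

text \<open>Deterministic form of asymptotic tightness in the sup norm; in the application
  \<open>H m\<close> is the set of paths taken on an event. For each \<open>\<kappa>\<close> one
  finite cover serves all paths and all large \<open>m\<close>, so every selection of paths has
  uniformly convergent subsequences.\<close>

definition asymp_totally_bounded :: "(nat \<Rightarrow> ('u \<Rightarrow> real) set) \<Rightarrow> bool" where
  "asymp_totally_bounded H \<longleftrightarrow>
     (\<exists>R. \<forall>\<^sub>F m in sequentially. \<forall>h\<in>H m. \<forall>u. \<bar>h u\<bar> \<le> R) \<and>
     (\<forall>\<kappa>>0. \<exists>P. finite P \<and> \<Union>P = UNIV \<and>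
        (\<forall>\<^sub>F m in sequentially. \<forall>h\<in>H m. \<forall>S\<in>P. \<forall>u\<in>S. \<forall>v\<in>S. \<bar>h u - h v\<bar> \<le> \<kappa>))"

text \<open>A failure of uniformity would produce, along a subsequence, paths with error above
  \<open>\<delta>\<close>. A further subsequence converges uniformly to some \<open>h\<close>; there
  the difference quotient tends to \<open>L h\<close> by differentiability and \<open>L\<close> of
  the paths tends to \<open>L h\<close> by continuity, so the error vanishes.\<close>

lemma hadamard_uniform_expansion:
  assumes had: "has_hadamard_derivative_on \<Phi> L F D"
    and H: "asymp_totally_bounded H"
    and t: "\<forall>\<^sub>F m in sequentially. 0 < t m" "t \<longlonglongrightarrow> 0"
    and D: "\<forall>\<^sub>F m in sequentially. \<forall>h\<in>H m. (\<lambda>u. F u + t m * h u) \<in> D"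
    and \<delta>: "0 < \<delta>"
  shows "\<forall>\<^sub>F m in sequentially. \<forall>h\<in>H m. \<bar>(\<Phi> (\<lambda>u. F u + t m * h u) - \<Phi> F) / t m - L h\<bar> \<le> \<delta>"
proof (rule ccontr)
  define bad where "bad m h \<longleftrightarrow> h \<in> H m \<and> \<not> \<bar>(\<Phi> (\<lambda>u. F u + t m * h u) - \<Phi> F) / t m - L h\<bar> \<le> \<delta>"
    for m h
  assume "\<not> ?thesis"
  then have freq: "\<exists>\<^sub>F m in sequentially. \<exists>h. bad m h"
    unfolding bad_def not_eventually by (elim frequently_elim1) blast
  obtain R where R: "\<forall>\<^sub>F m in sequentially. \<forall>h\<in>H m. \<forall>u. \<bar>h u\<bar> \<le> R"
    using H unfolding asymp_totally_bounded_def by blast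
  have "\<forall>\<^sub>F m in sequentially. (\<exists>h. bad m h) \<longrightarrow> (\<exists>h. bad m h) \<and> 0 < t m \<and>
      (\<forall>h\<in>H m. (\<lambda>u. F u + t m * h u) \<in> D) \<and> (\<forall>h\<in>H m. \<forall>u. \<bar>h u\<bar> \<le> R)"
    using t(1) D R by eventually_elim simp
  from frequently_rev_mp[OF freq this]
  have "\<exists>\<^sub>F m in sequentially. (\<exists>h. bad m h) \<and> 0 < t m \<and>
      (\<forall>h\<in>H m. (\<lambda>u. F u + t m * h u) \<in> D) \<and> (\<forall>h\<in>H m. \<forall>u. \<bar>h u\<bar> \<le> R)" .
  \<comment> \<open>The eventual side conditions have been merged with the frequent failure, because
    the definition of the derivative asks for them at every index of the sequence and not only
    eventually.\<close>
  then have "infinite {m. (\<exists>h. bad m h) \<and> 0 < t m \<and>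
      (\<forall>h\<in>H m. (\<lambda>u. F u + t m * h u) \<in> D) \<and> (\<forall>h\<in>H m. \<forall>u. \<bar>h u\<bar> \<le> R)}"
    by (simp add: frequently_cofinite[symmetric] cofinite_eq_sequentially)
  from infinite_enumerate[OF this] obtain s :: "nat \<Rightarrow> nat" where s: "strict_mono s"
    and "\<forall>k. s k \<in> {m. (\<exists>h. bad m h) \<and> 0 < t m \<and>
      (\<forall>h\<in>H m. (\<lambda>u. F u + t m * h u) \<in> D) \<and> (\<forall>h\<in>H m. \<forall>u. \<bar>h u\<bar> \<le> R)}"
    by auto
  then have s_in: "\<exists>h. bad (s k) h" "0 < t (s k)"
    "\<forall>h\<in>H (s k). (\<lambda>u. F u + t (s k) * h u) \<in> D" "\<forall>h\<in>H (s k). \<forall>u. \<bar>h u\<bar> \<le> R" for k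
    by simp_all
  define g where "g k = (SOME h. bad (s k) h)" for k
  have g: "bad (s k) (g k)" for k unfolding g_def using s_in(1) by (rule someI_ex)
  have gH: "g k \<in> H (s k)" for k using g by (simp add: bad_def)
  have osc: "\<exists>P. finite P \<and> \<Union>P = UNIV \<and>
      (\<forall>\<^sub>F n in sequentially. \<forall>S\<in>P. \<forall>u\<in>S. \<forall>v\<in>S. \<bar>g n u - g n v\<bar> \<le> \<kappa>)" if "0 < \<kappa>" for \<kappa>
  proof -
    from H that obtain P where P: "finite P" "\<Union>P = UNIV"
      "\<forall>\<^sub>F m in sequentially. \<forall>h\<in>H m. \<forall>S\<in>P. \<forall>u\<in>S. \<forall>v\<in>S. \<bar>h u - h v\<bar> \<le> \<kappa>"
      unfolding asymp_totally_bounded_def by blast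
    have "\<forall>\<^sub>F k in sequentially. \<forall>h\<in>H (s k). \<forall>S\<in>P. \<forall>u\<in>S. \<forall>v\<in>S. \<bar>h u - h v\<bar> \<le> \<kappa>"
      using P(3) filterlim_subseq[OF s] by (rule eventually_compose_filterlim)
    then have "\<forall>\<^sub>F k in sequentially. \<forall>S\<in>P. \<forall>u\<in>S. \<forall>v\<in>S. \<bar>g k u - g k v\<bar> \<le> \<kappa>"
      by eventually_elim (use gH in blast)
    with P show ?thesis by blast
  qed
  have g_bd: "\<bar>g k u\<bar> \<le> R" for k u using s_in(4)[of k] gH[of k] by blast
  obtain r h where r: "strict_mono r" and h: "bounded (range h)"
    "uniform_limit UNIV (\<lambda>k. g (r k)) h sequentially"
    using uniform_subsequence_of_finite_covers[of g R, OF g_bd osc] by blast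
  have t0: "(\<lambda>k. t (s (r k))) \<longlonglongrightarrow> 0"
    using LIMSEQ_subseq_LIMSEQ[OF t(2) strict_mono_o[OF s r]] by (simp add: o_def)
  have "(\<lambda>k. (\<Phi> (\<lambda>u. F u + t (s (r k)) * g (r k) u) - \<Phi> F) / t (s (r k))) \<longlonglongrightarrow> L h"
  proof (rule has_hadamard_derivative_onD[OF had _ t0 h(1) _ h(2)])
    show "\<forall>k. 0 < t (s (r k))" "\<forall>k. (\<lambda>u. F u + t (s (r k)) * g (r k) u) \<in> D"
      using s_in(2) s_in(3)[rule_format, OF gH] by simp_all
    show "\<forall>k. bounded (range (g (r k)))" using g_bd by (auto simp: bounded_iff)
  qed
  moreover have "(\<lambda>k. L (g (r k))) \<longlonglongrightarrow> L h"
  proof -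
    obtain K where K: "\<And>h. bounded (range h) \<Longrightarrow> \<bar>L h\<bar> \<le> K * (SUP u. \<bar>h u\<bar>)"
      using had[unfolded has_hadamard_derivative_on_def, THEN conjunct2, THEN conjunct2,
          THEN conjunct2, THEN conjunct1] by auto
    have add: "L (\<lambda>u. a u + b u) = L a + L b" if "bounded (range a)" "bounded (range b)" for a b
      using had[unfolded has_hadamard_derivative_on_def, THEN conjunct2, THEN conjunct1] that by simp
    have bd_d: "bounded (range (\<lambda>u. g k u - h u))" for k
      using g_bd h(1) by (intro bounded_minus_comp) (auto simp: bounded_iff)
    have "\<bar>L (g k) - L h\<bar> \<le> K * (SUP u. \<bar>g k u - h u\<bar>)" for k
      using add[OF bd_d h(1), of k] K[OF bd_d, of k] by simp
    moreover have "(\<lambda>k. K * (SUP u. \<bar>g (r k) u - h u\<bar>)) \<longlonglongrightarrow> K * 0"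
    proof (intro tendsto_mult_left LIMSEQ_I)
      fix e :: real assume "0 < e"
      then obtain N where N: "\<And>n u. n \<ge> N \<Longrightarrow> dist (g (r n) u) (h u) < e / 2"
        using h(2) unfolding uniform_limit_sequentially_iff by (meson UNIV_I half_gt_zero)
      have "norm ((SUP u. \<bar>g (r n) u - h u\<bar>) - 0) < e" if "n \<ge> N" for n
      proof -
        have le: "\<bar>g (r n) u - h u\<bar> \<le> e / 2" for u
          using N[OF that, of u] by (simp add: dist_real_def)
        have "(SUP u. \<bar>g (r n) u - h u\<bar>) \<le> e / 2" by (rule cSUP_least) (use le in auto)
        moreover have "0 \<le> (SUP u. \<bar>g (r n) u - h u\<bar>)"
          by (rule cSUP_upper2[where x = undefined]) (use le in \<open>auto intro!: bdd_aboveI2[where M = "e / 2"]\<close>)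
        ultimately show ?thesis using \<open>0 < e\<close> by simp
      qed
      then show "\<exists>no. \<forall>n\<ge>no. norm ((SUP u. \<bar>g (r n) u - h u\<bar>) - 0) < e" by blast
    qed
    ultimately have "(\<lambda>k. L (g (r k)) - L h) \<longlonglongrightarrow> 0"
      by (auto intro!: always_eventually
          Lim_null_comparison[of _ "\<lambda>k. K * (SUP u. \<bar>g (r k) u - h u\<bar>)"])
    then show ?thesis by (simp add: LIM_zero_iff)
  qed
  ultimately have "(\<lambda>k. (\<Phi> (\<lambda>u. F u + t (s (r k)) * g (r k) u) - \<Phi> F) / t (s (r k)) - L (g (r k))) \<longlonglongrightarrow> L h - L h"
    by (rule tendsto_diff)
  from LIMSEQ_D[OF this \<delta>] obtain N where N:
    "\<And>k. k \<ge> N \<Longrightarrow> \<bar>(\<Phi> (\<lambda>u. F u + t (s (r k)) * g (r k) u) - \<Phi> F) / t (s (r k)) - L (g (r k))\<bar> < \<delta>"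
    by (auto simp: real_norm_def)
  from N[OF order_refl] g[of "r N"] show False
    unfolding bad_def by linarith
qed


section \<open>Bounded linear functionals and the variation of their finitely additive
  measures\<close>

lemma bounded_scaled:
  fixes h :: "'a \<Rightarrow> real"
  assumes "bounded (range h)"
  shows "bounded (range (\<lambda>u. a * h u))"
  using bounded_scaling[OF assms, of a] by (simp add: image_image)

lemma bounded_of_indicator:
  fixes h :: "'a \<Rightarrow> real"
  assumes "\<And>u. \<bar>h u\<bar> \<le> indicator A u"
  shows "bounded (range h)"
proof -
  have "\<bar>h u\<bar> \<le> 1" for u
    using order_trans[OF assms[of u] indicator_le_1] .
  then show ?thesis by (auto simp: bounded_iff)
qed

text \<open>Isolates the properties of a derivative \<open>L\<close> that do not mention
  \<open>\<Phi>\<close>. They speak of bounded functions only, hence the boundedness premises of the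
  rules below.\<close>

locale sup_norm_functional =
  fixes L :: "('b \<Rightarrow> real) \<Rightarrow> real"
  assumes additive: "bounded (range g) \<Longrightarrow> bounded (range h) \<Longrightarrow> L (\<lambda>u. g u + h u) = L g + L h"
    and homogeneous: "bounded (range h) \<Longrightarrow> L (\<lambda>u. a * h u) = a * L h"
    and ex_bound: "\<exists>K. \<forall>h. bounded (range h) \<longrightarrow> \<bar>L h\<bar> \<le> K * (SUP u. \<bar>h u\<bar>)"

lemma has_hadamard_derivative_on_functional:
  assumes "has_hadamard_derivative_on \<Phi> L F D"
  shows "sup_norm_functional L"
proof -
  note had = assms[unfolded has_hadamard_derivative_on_def, THEN conjunct2]
  show ?thesis
  proof
    show "\<exists>K. \<forall>h. bounded (range h) \<longrightarrow> \<bar>L h\<bar> \<le> K * (SUP u. \<bar>h u\<bar>)"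
      using had[THEN conjunct2, THEN conjunct2, THEN conjunct1] .
  qed (simp_all add: had[THEN conjunct1, rule_format]
      had[THEN conjunct2, THEN conjunct1, rule_format])
qed

context sup_norm_functional
begin

text \<open>A nonnegative bound on the operator norm, phrased with an arbitrary pointwise bound
  \<open>c\<close> so that applications do not have to handle a supremum.\<close>

definition op_bound :: real where
  "op_bound = (SOME K. 0 \<le> K \<and> (\<forall>h c. (\<forall>u. \<bar>h u\<bar> \<le> c) \<longrightarrow> \<bar>L h\<bar> \<le> K * c))"

lemma op_bound_ex: "0 \<le> op_bound \<and> (\<forall>h c. (\<forall>u. \<bar>h u\<bar> \<le> c) \<longrightarrow> \<bar>L h\<bar> \<le> op_bound * c)"
proof -
  obtain K where K: "\<forall>h. bounded (range h) \<longrightarrow> \<bar>L h\<bar> \<le> K * (SUP u. \<bar>h u\<bar>)"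
    using ex_bound by auto
  have "\<bar>L h\<bar> \<le> \<bar>K\<bar> * c" if h: "\<forall>u. \<bar>h u\<bar> \<le> c" for h c
  proof -
    have "bounded (range h)" using h by (auto simp: bounded_iff)
    then have "\<bar>L h\<bar> \<le> K * (SUP u. \<bar>h u\<bar>)" using K by simp
    also have "\<dots> \<le> \<bar>K\<bar> * c"
    proof (rule mult_mono)
      show "(SUP u. \<bar>h u\<bar>) \<le> c" by (rule cSUP_least) (use h in auto)
      show "0 \<le> (SUP u. \<bar>h u\<bar>)"
        by (rule cSUP_upper2[where x = undefined]) (use h in \<open>auto intro!: bdd_aboveI2[where M = c]\<close>)
    qed auto
    finally show ?thesis .
  qed
  then have "0 \<le> \<bar>K\<bar> \<and> (\<forall>h c. (\<forall>u. \<bar>h u\<bar> \<le> c) \<longrightarrow> \<bar>L h\<bar> \<le> \<bar>K\<bar> * c)" by simp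
  then show ?thesis unfolding op_bound_def by (rule someI)
qed

lemma op_bound_nonneg: "0 \<le> op_bound"
  using op_bound_ex by simp

lemma abs_le_op_bound: "(\<And>u. \<bar>h u\<bar> \<le> c) \<Longrightarrow> \<bar>L h\<bar> \<le> op_bound * c"
  using op_bound_ex by simp

lemma zero: "L (\<lambda>u. 0) = 0"
  using homogeneous[of "\<lambda>u. 0" 0] by simp

lemma diff:
  assumes "bounded (range g)" "bounded (range h)"
  shows "L (\<lambda>u. g u - h u) = L g - L h"
proof -
  have "bounded (range (\<lambda>u. - h u))"
    using assms(2) by (auto simp: bounded_iff)
  with assms homogeneous[OF assms(2), of "-1"] additive[of g "\<lambda>u. - h u"] show ?thesis
    by simp
qed

lemma sum:
  assumes "finite I" "\<And>i. i \<in> I \<Longrightarrow> bounded (range (h i))"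
  shows "L (\<lambda>u. \<Sum>i\<in>I. a i * h i u) = (\<Sum>i\<in>I. a i * L (h i))"
proof -
  have "bounded (range (\<lambda>u. \<Sum>i\<in>I. a i * h i u)) \<and> ?thesis"
    using assms
  proof (induction I)
    case empty
    then show ?case by (simp add: zero)
  next
    case (insert j I)
    then have bd: "bounded (range (\<lambda>u. \<Sum>i\<in>I. a i * h i u))" "bounded (range (\<lambda>u. a j * h j u))"
      by (auto intro!: bounded_scaled)
    then show ?case
      using insert bounded_plus_comp[OF bd(2,1)] additive[OF bd(2,1)] homogeneous[of "h j" "a j"]
      by simp
  qed
  then show ?thesis ..
qed

text \<open>Total variation on \<open>A\<close> of the finitely additive signed measure behind
  \<open>L\<close>. It is defined through \<open>L\<close> directly, with all functions dominated by
  the indicator of \<open>A\<close>, so it is available for every set.\<close>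

definition variation :: "'b set \<Rightarrow> real" where
  "variation A = Sup {L h |h. \<forall>u. \<bar>h u\<bar> \<le> indicator A u}"

lemma variation_upper: "(\<And>u. \<bar>h u\<bar> \<le> indicator A u) \<Longrightarrow> L h \<le> variation A"
  unfolding variation_def
proof (rule cSup_upper)
  show "bdd_above {L h |h. \<forall>u. \<bar>h u\<bar> \<le> indicator A u}"
  proof (rule bdd_aboveI, safe)
    fix h :: "'b \<Rightarrow> real" assume h: "\<forall>u. \<bar>h u\<bar> \<le> indicator A u"
    have "\<bar>h u\<bar> \<le> 1" for u
      using order_trans[OF h[rule_format, of u] indicator_le_1] .
    from abs_le_op_bound[of h, OF this] show "L h \<le> op_bound * 1" by linarith
  qed
qed auto

lemma variation_least:
  assumes "\<And>h. (\<And>u. \<bar>h u\<bar> \<le> indicator A u) \<Longrightarrow> L h \<le> c"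
  shows "variation A \<le> c"
  unfolding variation_def
proof (rule cSup_least)
  show "{L h |h. \<forall>u. \<bar>h u\<bar> \<le> indicator A u} \<noteq> {}"
    by (auto intro!: exI[of _ "\<lambda>u. 0"] simp: indicator_def)
qed (use assms in auto)

lemma abs_le_variation:
  assumes "\<And>u. \<bar>h u\<bar> \<le> indicator A u"
  shows "\<bar>L h\<bar> \<le> variation A"
proof -
  have "\<bar>h u\<bar> \<le> 1" for u
    using order_trans[OF assms[of u] indicator_le_1] .
  then have "bounded (range h)" by (auto simp: bounded_iff)
  from homogeneous[OF this, of "-1"] variation_upper[of "\<lambda>u. - h u" A] variation_upper[of h A] assms
  show ?thesis by auto
qed

text \<open>Functions dominated by disjoint sets add up to a function dominated by the union; the
  two suprema are taken one after the other.\<close>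

lemma variation_superadditive:
  assumes "A \<inter> B = {}"
  shows "variation A + variation B \<le> variation (A \<union> B)"
proof -
  have "variation A \<le> variation (A \<union> B) - variation B"
  proof (rule variation_least)
    fix h :: "'b \<Rightarrow> real" assume h: "\<And>u. \<bar>h u\<bar> \<le> indicator A u"
    have "variation B \<le> variation (A \<union> B) - L h"
    proof (rule variation_least)
      fix k :: "'b \<Rightarrow> real" assume k: "\<And>u. \<bar>k u\<bar> \<le> indicator B u"
      have "L (\<lambda>u. h u + k u) \<le> variation (A \<union> B)"
      proof (rule variation_upper)
        fix u show "\<bar>h u + k u\<bar> \<le> indicator (A \<union> B) u"
          using h[of u] k[of u] assms by (cases "u \<in> A"; cases "u \<in> B") auto
      qed
      with additive[OF bounded_of_indicator[OF h] bounded_of_indicator[OF k]]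
      show "L k \<le> variation (A \<union> B) - L h" by simp
    qed
    then show "L h \<le> variation (A \<union> B) - variation B" by simp
  qed
  then show ?thesis by simp
qed

lemma variation_subadditive: "variation (A \<union> B) \<le> variation A + variation B"
proof (rule variation_least)
  fix h :: "'b \<Rightarrow> real" assume h: "\<And>u. \<bar>h u\<bar> \<le> indicator (A \<union> B) u"
  define h1 where "h1 u = h u * indicator A u" for u
  define h2 where "h2 u = h u * indicator (- A) u" for u
  have h1: "\<bar>h1 u\<bar> \<le> indicator A u" and h2: "\<bar>h2 u\<bar> \<le> indicator B u" for u
    using h[of u] by (auto simp: h1_def h2_def indicator_def split: if_splits)
  have "h = (\<lambda>u. h1 u + h2 u)"
    by (auto simp: h1_def h2_def indicator_def fun_eq_iff)
  with additive[OF bounded_of_indicator[OF h1] bounded_of_indicator[OF h2]]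
    variation_upper[OF h1] variation_upper[OF h2]
  show "L h \<le> variation A + variation B" by simp
qed

lemma variation_nonneg: "0 \<le> variation A"
  using abs_le_variation[of "\<lambda>u. 0" A] by (simp add: zero indicator_def)

lemma variation_UN:
  assumes "finite I"
  shows "variation (\<Union>i\<in>I. A i) \<le> (\<Sum>i\<in>I. variation (A i))"
  using assms
proof (induction I)
  case empty
  have "variation {} \<le> 0"
  proof (rule variation_least)
    fix h :: "'b \<Rightarrow> real" assume "\<And>u. \<bar>h u\<bar> \<le> indicator {} u"
    then have "h = (\<lambda>u. 0)" by (simp add: fun_eq_iff)
    then show "L h \<le> 0" by (simp add: zero)
  qed
  then show ?case by simp
next
  case (insert j I)
  then show ?case using variation_subadditive[of "A j" "\<Union>i\<in>I. A i"] by simp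
qed

end

text \<open>No countable additivity is available, so measurability comes from variation. Moving
  \<open>z\<close> to \<open>z'\<close> changes the indicator only inside one strip per coordinate,
  and the variation of a strip is at most a difference of values of the monotone function
  \<open>\<mu> i\<close>. Thus \<open>z\<close> matters only through finitely many monotone, hence
  Borel, functions, and rounding these gives a uniform approximation.\<close>

lemma sup_norm_functional_orthant_measurable:
  fixes L :: "('b::ordered_euclidean_space \<Rightarrow> real) \<Rightarrow> real"
  assumes "sup_norm_functional L"
  shows "(\<lambda>z. L (\<lambda>u. of_bool (z \<le> u))) \<in> borel_measurable borel"
proof -
  interpret sup_norm_functional L by fact
  define g where "g z = L (\<lambda>u. of_bool (z \<le> u))" for z :: 'b
  define \<mu> where "\<mu> i t = variation {u. t \<le> u \<bullet> i}" for i :: 'b and t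
  have strip: "variation {u. s \<le> u \<bullet> i \<and> u \<bullet> i < t} \<le> \<mu> i s - \<mu> i t" if "s \<le> t" for s t and i :: 'b
  proof -
    have "{u. s \<le> u \<bullet> i \<and> u \<bullet> i < t} \<union> {u. t \<le> u \<bullet> i} = {u. s \<le> u \<bullet> i}" using that by auto
    with variation_superadditive[of "{u. s \<le> u \<bullet> i \<and> u \<bullet> i < t}" "{u. t \<le> u \<bullet> i}"]
    show ?thesis by (simp add: \<mu>_def disjoint_iff)
  qed
  have anti: "\<mu> i t \<le> \<mu> i s" if "s \<le> t" for s t i
    using strip[OF that, of i] variation_nonneg[of "{u. s \<le> u \<bullet> i \<and> u \<bullet> i < t}"] by simp
  have meas_\<mu> [measurable]: "\<mu> i \<in> borel_measurable borel" for i
  proof -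
    have "mono (\<lambda>t. - \<mu> i t)" using anti by (auto intro!: monoI)
    from borel_measurable_mono[OF this] have "(\<lambda>t. - (- \<mu> i t)) \<in> borel_measurable borel"
      by measurable
    then show ?thesis by simp
  qed
  have modulus: "\<bar>g z - g z'\<bar> \<le> (\<Sum>i\<in>Basis. \<bar>\<mu> i (z \<bullet> i) - \<mu> i (z' \<bullet> i)\<bar>)" for z z'
  proof -
    define S where "S i = {u. min (z \<bullet> i) (z' \<bullet> i) \<le> u \<bullet> i \<and> u \<bullet> i < max (z \<bullet> i) (z' \<bullet> i)}" for i
    have "\<bar>L (\<lambda>u. of_bool (z \<le> u) - of_bool (z' \<le> u))\<bar> \<le> variation (\<Union>i\<in>Basis. S i)"
    proof (rule abs_le_variation)
      fix u show "\<bar>of_bool (z \<le> u) - of_bool (z' \<le> u)\<bar> \<le> (indicator (\<Union>i\<in>Basis. S i) u :: real)"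
      proof (cases "(z \<le> u) = (z' \<le> u)")
        case False
        then obtain i where "i \<in> Basis" "(z \<bullet> i \<le> u \<bullet> i) \<noteq> (z' \<bullet> i \<le> u \<bullet> i)"
          unfolding eucl_le[where 'a = 'b] by blast
        then have "u \<in> (\<Union>i\<in>Basis. S i)" by (intro UN_I[of i]) (auto simp: S_def)
        then show ?thesis by simp
      qed simp
    qed
    also have "\<dots> \<le> (\<Sum>i\<in>Basis. variation (S i))" by (rule variation_UN) simp
    also have "\<dots> \<le> (\<Sum>i\<in>Basis. \<bar>\<mu> i (z \<bullet> i) - \<mu> i (z' \<bullet> i)\<bar>)"
    proof (rule sum_mono)
      fix i :: 'b
      show "variation (S i) \<le> \<bar>\<mu> i (z \<bullet> i) - \<mu> i (z' \<bullet> i)\<bar>"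
        using strip[of "min (z \<bullet> i) (z' \<bullet> i)" "max (z \<bullet> i) (z' \<bullet> i)" i]
        by (auto simp: S_def min_def max_def split: if_splits)
    qed
    finally show ?thesis unfolding g_def
      by (subst diff[symmetric]) (auto simp: bounded_iff intro!: exI[of _ 1])
  qed
  \<comment> \<open>Points with equal rounded values differ by at most \<open>1 / Suc n\<close> in
    every \<open>\<mu> i\<close>. \<open>rep\<close> picks an arbitrary point of each cell: the
    value of \<open>g\<close> there depends on the cell alone, and \<open>cell n\<close> has a
    countable range, so the composition is Borel before anything is known about
    \<open>g\<close>.\<close>
  define cell where "cell n z = (\<lambda>i\<in>Basis. \<lfloor>real (Suc n) * \<mu> i (z \<bullet> i)\<rfloor>)" for n and z :: 'b
  define rep where "rep n c = (SOME z. cell n z = c)" for n c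
  have rep: "cell n (rep n (cell n z)) = cell n z" for n z
    unfolding rep_def by (rule someI) simp
  have cell_meas: "cell n \<in> borel \<rightarrow>\<^sub>M count_space (Basis \<rightarrow>\<^sub>E UNIV)" for n
  proof (subst measurable_count_space_eq_countable)
    show "countable ((Basis :: 'b set) \<rightarrow>\<^sub>E (UNIV :: int set))" by (rule countable_PiE) auto
    have "cell n -` {a} \<inter> space borel \<in> sets borel" if "a \<in> Basis \<rightarrow>\<^sub>E UNIV" for a
    proof -
      have "cell n -` {a} \<inter> space borel = {z \<in> space borel. \<forall>i\<in>Basis. \<lfloor>real (Suc n) * \<mu> i (z \<bullet> i)\<rfloor> = a i}"
        using that by (auto simp: cell_def fun_eq_iff PiE_def extensional_def)
      also have "\<dots> \<in> sets borel" by measurable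
      finally show ?thesis .
    qed
    then show "cell n \<in> space borel \<rightarrow> (Basis \<rightarrow>\<^sub>E UNIV) \<and>
        (\<forall>a\<in>Basis \<rightarrow>\<^sub>E UNIV. cell n -` {a} \<inter> space borel \<in> sets borel)"
      by (auto simp: cell_def)
  qed
  have approx: "\<bar>g (rep n (cell n z)) - g z\<bar> \<le> real DIM('b) * (1 / real (Suc n))" for n z
  proof -
    have "\<bar>\<mu> i (rep n (cell n z) \<bullet> i) - \<mu> i (z \<bullet> i)\<bar> \<le> 1 / real (Suc n)" if "i \<in> Basis" for i
    proof -
      have "\<lfloor>real (Suc n) * \<mu> i (rep n (cell n z) \<bullet> i)\<rfloor> = \<lfloor>real (Suc n) * \<mu> i (z \<bullet> i)\<rfloor>"
        using fun_cong[OF rep[of n z], of i] that by (simp add: cell_def)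
      then have "\<bar>real (Suc n) * \<mu> i (rep n (cell n z) \<bullet> i) - real (Suc n) * \<mu> i (z \<bullet> i)\<bar> \<le> 1"
        by linarith
      then have "real (Suc n) * \<bar>\<mu> i (rep n (cell n z) \<bullet> i) - \<mu> i (z \<bullet> i)\<bar> \<le> 1"
        by (simp add: right_diff_distrib[symmetric] abs_mult)
      then show ?thesis by (simp add: field_simps)
    qed
    then have "(\<Sum>i\<in>Basis. \<bar>\<mu> i (rep n (cell n z) \<bullet> i) - \<mu> i (z \<bullet> i)\<bar>) \<le> real DIM('b) * (1 / real (Suc n))"
      by (rule sum_bounded_above)
    with modulus show ?thesis by (rule order_trans)
  qed
  have "g \<in> borel_measurable borel"
  proof (rule borel_measurable_LIMSEQ_real)
    show "(\<lambda>z. g (rep n (cell n z))) \<in> borel_measurable borel" for n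
      by (rule measurable_compose[OF cell_meas]) simp
    show "(\<lambda>n. g (rep n (cell n z))) \<longlonglongrightarrow> g z" for z
    proof -
      have "(\<lambda>n. real DIM('b) * (1 / real (Suc n))) \<longlonglongrightarrow> real DIM('b) * 0"
        by (intro tendsto_mult_left LIMSEQ_Suc[OF lim_1_over_n])
      then have lim0: "(\<lambda>n. real DIM('b) * (1 / real (Suc n))) \<longlonglongrightarrow> 0" by simp
      have "(\<lambda>n. g (rep n (cell n z)) - g z) \<longlonglongrightarrow> 0"
        by (rule Lim_null_comparison[OF always_eventually lim0])
          (use approx in \<open>simp only: real_norm_def, blast\<close>)
      then show ?thesis by (simp add: LIM_zero_iff)
    qed
  qed
  then show ?thesis by (simp add: g_def[abs_def])
qed

section \<open>Exponential moments of weighted empirical sums\<close>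

text \<open>For \<open>x = - y\<close> with \<open>0 \<le> y\<close> it suffices that
  \<open>(1 - y + y\<^sup>2) * exp y\<close> is at least 1. The second-order Taylor minorant of
  \<open>exp y\<close> already achieves this: the product becomes
  \<open>1 + (y\<^sup>2 + y ^ 3 + y ^ 4) / 2\<close>.\<close>

lemma exp_le_quadratic:
  fixes x :: real
  assumes "\<bar>x\<bar> \<le> 1"
  shows "exp x \<le> 1 + x + x\<^sup>2"
proof (cases "0 \<le> x")
  case True
  with assms show ?thesis by (intro exp_bound) auto
next
  case False
  define y where "y = - x"
  have y: "0 \<le> y" "y \<le> 1" using False assms by (auto simp: y_def)
  have "1 \<le> (1 - y + y\<^sup>2) * (1 + y + y\<^sup>2 / 2)"
  proof -
    have "(1 - y + y\<^sup>2) * (1 + y + y\<^sup>2 / 2) = 1 + (y\<^sup>2 + y ^ 3 + y ^ 4) / 2"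
      by (simp add: field_simps power2_eq_square power3_eq_cube power4_eq_xxxx)
    with y show ?thesis by simp
  qed
  also have "\<dots> \<le> (1 - y + y\<^sup>2) * exp y"
  proof (rule mult_left_mono[OF exp_lower_Taylor_quadratic[OF y(1)]])
    show "0 \<le> 1 - y + y\<^sup>2" using y by simp
  qed
  finally have "exp (- y) \<le> 1 - y + y\<^sup>2"
    by (simp add: exp_minus field_simps)
  then show ?thesis by (simp add: y_def)
qed

text \<open>Bernstein's argument: for \<open>\<bar>s\<bar> * b \<le> 1\<close> the quadratic bound
  on the exponential applies, the linear term integrates to zero, and
  \<open>1 + x \<le> exp x\<close> closes the estimate. This range of \<open>s\<close> is the origin
  of the depth limit \<open>2 ^ k * B \<le> sqrt m\<close> of the chaining.\<close>

lemma (in prob_space) exp_moment_le: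
  fixes X :: "'a \<Rightarrow> real"
  assumes [measurable]: "X \<in> borel_measurable M"
    and bd: "AE w in M. \<bar>X w\<bar> \<le> b"
    and mean: "expectation X = 0" and var: "expectation (\<lambda>w. (X w)\<^sup>2) \<le> v"
    and s: "\<bar>s\<bar> * b \<le> 1"
  shows "integrable M (\<lambda>w. exp (s * X w))" "expectation (\<lambda>w. exp (s * X w)) \<le> exp (s\<^sup>2 * v)"
proof -
  have bd1: "AE w in M. \<bar>s * X w\<bar> \<le> 1"
    using bd
  proof eventually_elim
    case (elim w)
    have "\<bar>s * X w\<bar> = \<bar>s\<bar> * \<bar>X w\<bar>" by (simp add: abs_mult)
    also have "\<dots> \<le> \<bar>s\<bar> * b" using elim by (intro mult_left_mono) auto
    finally show ?case using s by simp
  qed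
  show int: "integrable M (\<lambda>w. exp (s * X w))"
  proof (rule integrable_const_bound[where B = "exp 1"])
    show "AE w in M. norm (exp (s * X w)) \<le> exp 1"
      using bd1 by eventually_elim auto
  qed simp
  have intX: "integrable M X"
    using bd by (intro integrable_const_bound[where B = b]) auto
  have intX2: "integrable M (\<lambda>w. (X w)\<^sup>2)"
  proof (rule integrable_const_bound[where B = "b\<^sup>2"])
    show "AE w in M. norm ((X w)\<^sup>2) \<le> b\<^sup>2"
      using bd by eventually_elim (metis norm_power power2_abs power_mono real_norm_def abs_ge_zero)
  qed simp
  have "expectation (\<lambda>w. exp (s * X w)) \<le> expectation (\<lambda>w. 1 + s * X w + s\<^sup>2 * (X w)\<^sup>2)"
  proof (rule integral_mono_AE[OF int])
    show "AE w in M. exp (s * X w) \<le> 1 + s * X w + s\<^sup>2 * (X w)\<^sup>2"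
      using bd1
    proof eventually_elim
      case (elim w)
      then show ?case using exp_le_quadratic[of "s * X w"] by (simp add: power_mult_distrib)
    qed
  qed (use intX intX2 in auto)
  also have "\<dots> = 1 + s\<^sup>2 * expectation (\<lambda>w. (X w)\<^sup>2)"
    using intX intX2 mean by (simp add: prob_space)
  also have "\<dots> \<le> 1 + s\<^sup>2 * v" using var by (intro add_left_mono mult_left_mono) auto
  also have "\<dots> \<le> exp (s\<^sup>2 * v)" by (rule exp_ge_add_one_self)
  finally show "expectation (\<lambda>w. exp (s * X w)) \<le> exp (s\<^sup>2 * v)" .
qed

text \<open>Covers unit weights (\<open>B = 1\<close>) and inverse probability weights
  (\<open>B = 1 / \<epsilon>\<close>). Range and mean are required at index 0 and transfer to the
  others through \<open>ident\<close>. Mean one makes the weighted law of \<open>Z\<close> a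
  probability and forces \<open>1 \<le> B\<close>, so \<open>B\<close> also dominates the centring
  constants.\<close>

locale weighted_sample = prob_space M for M :: "'a measure" +
  fixes W :: "nat \<Rightarrow> 'a \<Rightarrow> real" and Z :: "nat \<Rightarrow> 'a \<Rightarrow> 'b::ordered_euclidean_space" and B :: real
  assumes indep: "indep_vars (\<lambda>_. borel) (\<lambda>i w. (W i w, Z i w)) UNIV"
    and ident: "distr M borel (\<lambda>w. (W i w, Z i w)) = distr M borel (\<lambda>w. (W 0 w, Z 0 w))"
    and W0_bounds: "AE w in M. 0 \<le> W 0 w \<and> W 0 w \<le> B"
    and W0_mean: "expectation (W 0) = 1"
begin

lemma pair_measurable [measurable]: "(\<lambda>w. (W i w, Z i w)) \<in> borel_measurable M"
  using indep unfolding indep_vars_def by auto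

lemma W_measurable [measurable]: "W i \<in> borel_measurable M"
  using measurable_compose[OF pair_measurable[of i] borel_measurable_continuous_onI[OF continuous_on_fst[OF continuous_on_id]]]
  by simp

lemma Z_measurable [measurable]: "Z i \<in> borel_measurable M"
  using measurable_compose[OF pair_measurable[of i] borel_measurable_continuous_onI[OF continuous_on_snd[OF continuous_on_id]]]
  by simp

lemma expectation_ident:
  fixes g :: "real \<times> 'b \<Rightarrow> real"
  assumes "g \<in> borel_measurable borel"
  shows "expectation (\<lambda>w. g (W i w, Z i w)) = expectation (\<lambda>w. g (W 0 w, Z 0 w))"
  using integral_distr[OF pair_measurable[of i] assms] integral_distr[OF pair_measurable[of 0] assms]
    ident[of i] by simp

lemma W_bounds: "AE w in M. 0 \<le> W i w \<and> W i w \<le> B"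
proof -
  have [measurable]: "Measurable.pred borel (\<lambda>p :: real \<times> 'b. 0 \<le> fst p \<and> fst p \<le> B)"
    unfolding borel_prod[symmetric] by measurable
  have "AE p in distr M borel (\<lambda>w. (W 0 w, Z 0 w)). 0 \<le> fst p \<and> fst p \<le> B"
    using W0_bounds by (subst AE_distr_iff) auto
  then have "AE p in distr M borel (\<lambda>w. (W i w, Z i w)). 0 \<le> fst p \<and> fst p \<le> B"
    by (simp only: ident[of i])
  then show ?thesis by (subst (asm) AE_distr_iff) auto
qed

lemma B_ge_1: "1 \<le> B"
proof -
  have "expectation (W 0) \<le> expectation (\<lambda>w. B)"
  proof (rule integral_mono_AE)
    show "integrable M (W 0)"
    proof (rule integrable_const_bound[where B = B])
      show "AE w in M. norm (W 0 w) \<le> B" using W0_bounds by eventually_elim simp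
    qed simp
  qed (use W0_bounds in simp_all)
  then show ?thesis by (simp add: W0_mean prob_space)
qed

definition mass :: "'b set \<Rightarrow> real" where
  "mass A = expectation (\<lambda>w. W 0 w * indicator A (Z 0 w))"

lemma weighted_indicator_integrable:
  assumes [measurable]: "A \<in> sets borel"
  shows "integrable M (\<lambda>w. W i w * indicator A (Z i w))"
proof (rule integrable_const_bound[where B = B])
  show "AE w in M. norm (W i w * indicator A (Z i w)) \<le> B"
    using W_bounds[of i] by eventually_elim (use B_ge_1 in \<open>auto simp: indicator_def\<close>)
qed measurable

lemma expectation_weighted_indicator:
  assumes [measurable]: "A \<in> sets borel"
  shows "expectation (\<lambda>w. W i w * indicator A (Z i w)) = mass A"
proof -
  have "(\<lambda>p :: real \<times> 'b. fst p * indicator A (snd p)) \<in> borel_measurable borel"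
    unfolding borel_prod[symmetric] by measurable
  from expectation_ident[OF this, of i] show ?thesis by (simp add: mass_def)
qed

lemma mass_bounds:
  assumes "A \<in> sets borel"
  shows "0 \<le> mass A" "mass A \<le> 1"
proof -
  show "0 \<le> mass A"
    unfolding mass_def using W0_bounds by (intro integral_nonneg_AE) (auto elim: eventually_mono)
  have "mass A \<le> expectation (W 0)"
    unfolding mass_def
  proof (rule integral_mono_AE[OF weighted_indicator_integrable[OF assms]])
    show "integrable M (W 0)"
      using weighted_indicator_integrable[of UNIV 0] by simp
    show "AE w in M. W 0 w * indicator A (Z 0 w) \<le> W 0 w"
      using W0_bounds by eventually_elim (auto simp: indicator_def)
  qed
  then show "mass A \<le> 1" by (simp add: W0_mean)
qed

definition emp :: "nat \<Rightarrow> 'b set \<Rightarrow> 'a \<Rightarrow> real" where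
  "emp m A w = (\<Sum>i<m. W i w * indicator A (Z i w) - mass A) / sqrt (real m)"

lemma emp_measurable [measurable]:
  assumes [measurable]: "A \<in> sets borel"
  shows "emp m A \<in> borel_measurable M"
  unfolding emp_def[abs_def] by measurable

text \<open>The weighted indicator \<open>U\<close> lies in \<open>[0, B]\<close>, so its square is
  at most \<open>B * U\<close> and a summand has variance at most \<open>B * mass A\<close>: small
  sets have small variance, which is what chaining exploits. The constraint on \<open>s\<close> is
  the Bernstein range for \<open>s / sqrt m\<close>.\<close>

lemma emp_exp_moment:
  assumes A [measurable]: "A \<in> sets borel" and v: "mass A \<le> v" and m: "0 < m"
    and s: "\<bar>s\<bar> * B \<le> sqrt (real m)"
  shows "integrable M (\<lambda>w. exp (s * emp m A w))"
    "expectation (\<lambda>w. exp (s * emp m A w)) \<le> exp (s\<^sup>2 * (B * v))"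
proof -
  define X where "X i w = W i w * indicator A (Z i w) - mass A" for i w
  have [measurable]: "X i \<in> borel_measurable M" for i unfolding X_def[abs_def] by measurable
  have X_bd: "AE w in M. \<bar>X i w\<bar> \<le> B" for i
    using W_bounds[of i]
    by eventually_elim (use B_ge_1 mass_bounds[OF A] in \<open>auto simp: X_def indicator_def\<close>)
  have X_mean: "expectation (X i) = 0" for i
    using weighted_indicator_integrable[OF A, of i] expectation_weighted_indicator[OF A, of i]
    by (simp add: X_def[abs_def] prob_space)
  have X_var: "expectation (\<lambda>w. (X i w)\<^sup>2) \<le> B * v" for i
  proof -
    define U where "U w = W i w * indicator A (Z i w)" for w
    have [measurable]: "U \<in> borel_measurable M" unfolding U_def[abs_def] by measurable
    have U_bd: "AE w in M. 0 \<le> U w \<and> U w \<le> B"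
      using W_bounds[of i] by eventually_elim (use B_ge_1 in \<open>auto simp: U_def indicator_def\<close>)
    have intU: "integrable M U" using weighted_indicator_integrable[OF A, of i] by (simp add: U_def[abs_def])
    have EU: "expectation U = mass A"
      using expectation_weighted_indicator[OF A, of i] by (simp add: U_def[abs_def])
    have U2: "AE w in M. (U w)\<^sup>2 \<le> B * U w"
      using U_bd by eventually_elim (auto simp: power2_eq_square intro!: mult_right_mono)
    have intU2: "integrable M (\<lambda>w. (U w)\<^sup>2)"
      by (rule Bochner_Integration.integrable_bound[of M "\<lambda>w. B * U w"])
        (use intU U2 in \<open>auto elim!: eventually_mono\<close>)
    have "expectation (\<lambda>w. (X i w)\<^sup>2) = expectation (\<lambda>w. (U w)\<^sup>2 - 2 * mass A * U w + (mass A)\<^sup>2)"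
      by (intro Bochner_Integration.integral_cong)
        (auto simp: X_def U_def power2_eq_square algebra_simps)
    also have "\<dots> = expectation (\<lambda>w. (U w)\<^sup>2) - (mass A)\<^sup>2"
      using intU intU2 EU by (simp add: prob_space power2_eq_square)
    also have "\<dots> \<le> expectation (\<lambda>w. (U w)\<^sup>2)" by simp
    also have "\<dots> \<le> expectation (\<lambda>w. B * U w)"
      using intU intU2 U2 by (intro integral_mono_AE) auto
    also have "\<dots> = B * mass A" using intU EU by simp
    also have "\<dots> \<le> B * v" using v B_ge_1 by (intro mult_left_mono) auto
    finally show ?thesis .
  qed
  define t where "t = s / sqrt (real m)"
  have t: "\<bar>t\<bar> * B \<le> 1" using s m by (simp add: t_def field_simps)
  note mom = exp_moment_le[OF _ X_bd X_mean X_var t]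
  have ind: "indep_vars (\<lambda>_. borel) (\<lambda>i w. exp (t * X i w)) {..<m}"
  proof -
    have "indep_vars (\<lambda>_. borel) (\<lambda>i w. (\<lambda>p. exp (t * (fst p * indicator A (snd p) - mass A))) (W i w, Z i w)) {..<m}"
      by (rule indep_vars_compose2[OF indep_vars_subset[OF indep]])
        (simp_all add: borel_prod[symmetric])
    then show ?thesis by (simp add: X_def)
  qed
  have eq: "exp (s * emp m A w) = (\<Prod>i<m. exp (t * X i w))" for w
  proof -
    have "s * emp m A w = (\<Sum>i<m. t * X i w)"
      by (simp add: emp_def X_def t_def sum_distrib_left sum_divide_distrib)
    then show ?thesis by (simp add: exp_sum)
  qed
  show "integrable M (\<lambda>w. exp (s * emp m A w))"
    unfolding eq using ind by (intro indep_vars_integrable) (auto intro: mom)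
  have "expectation (\<lambda>w. exp (s * emp m A w)) = (\<Prod>i<m. expectation (\<lambda>w. exp (t * X i w)))"
    unfolding eq using ind by (intro indep_vars_lebesgue_integral) (auto intro: mom)
  also have "\<dots> \<le> (\<Prod>i<m. exp (t\<^sup>2 * (B * v)))"
    by (intro prod_mono conjI mom integral_nonneg_AE) auto
  also have "\<dots> = exp (s\<^sup>2 * (B * v))"
    using m by (simp add: t_def power_divide exp_of_nat_mult[symmetric])
  finally show "expectation (\<lambda>w. exp (s * emp m A w)) \<le> exp (s\<^sup>2 * (B * v))" .
qed

definition emp_max :: "nat \<Rightarrow> 'b set set \<Rightarrow> 'a \<Rightarrow> real" where
  "emp_max m \<A> w = Max ((\<lambda>A. \<bar>emp m A w\<bar>) ` \<A>)"

lemma emp_le_emp_max: "finite \<A> \<Longrightarrow> A \<in> \<A> \<Longrightarrow> \<bar>emp m A w\<bar> \<le> emp_max m \<A> w"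
  unfolding emp_max_def by (rule Max_ge) auto

lemma emp_max_measurable [measurable]:
  "finite \<A> \<Longrightarrow> \<A> \<subseteq> sets borel \<Longrightarrow> emp_max m \<A> \<in> borel_measurable M"
  unfolding emp_max_def[abs_def] by (rule borel_measurable_Max) auto

lemma emp_max_nonneg:
  assumes "finite \<A>" "\<A> \<noteq> {}"
  shows "0 \<le> emp_max m \<A> w"
proof -
  obtain A where "A \<in> \<A>" using assms by auto
  from emp_le_emp_max[OF assms(1) this, of m w] show ?thesis by linarith
qed

text \<open>The exponential of a maximum is at most the sum of the exponentials, which brings in the
  logarithm of the cardinality; the factor 2 pays for both signs of \<open>emp\<close>.\<close>

lemma emp_max_expectation:
  assumes \<A>: "finite \<A>" "\<A> \<noteq> {}" "\<A> \<subseteq> sets borel"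
    and v: "\<And>A. A \<in> \<A> \<Longrightarrow> mass A \<le> v" and m: "0 < m"
    and s: "0 < s" "s * B \<le> sqrt (real m)"
  shows "integrable M (emp_max m \<A>)"
    "expectation (emp_max m \<A>) \<le> (ln (2 * real (card \<A>)) + s\<^sup>2 * (B * v)) / s"
proof -
  define a where "a = ln (2 * real (card \<A>)) + s\<^sup>2 * (B * v)"
  define E where "E w = (\<Sum>A\<in>\<A>. exp (s * emp m A w) + exp ((- s) * emp m A w))" for w
  have card: "0 < card \<A>" using \<A> by (simp add: card_gt_0_iff)
  have A_borel: "A \<in> sets borel" if "A \<in> \<A>" for A using \<A>(3) that by auto
  have mom: "integrable M (\<lambda>w. exp (s * emp m A w))" "integrable M (\<lambda>w. exp ((- s) * emp m A w))"
    "expectation (\<lambda>w. exp (s * emp m A w)) \<le> exp (s\<^sup>2 * (B * v))"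
    "expectation (\<lambda>w. exp ((- s) * emp m A w)) \<le> exp (s\<^sup>2 * (B * v))" if "A \<in> \<A>" for A
    using emp_exp_moment[OF A_borel[OF that] v[OF that] m, of s]
      emp_exp_moment[OF A_borel[OF that] v[OF that] m, of "- s"] s by simp_all
  have intE: "integrable M E" unfolding E_def[abs_def] using mom(1,2) by (intro Bochner_Integration.integrable_sum Bochner_Integration.integrable_add)
  have "expectation E = (\<Sum>A\<in>\<A>. expectation (\<lambda>w. exp (s * emp m A w)) + expectation (\<lambda>w. exp ((- s) * emp m A w)))"
    unfolding E_def[abs_def] using mom by (subst Bochner_Integration.integral_sum) (auto intro!: sum.cong)
  also have "\<dots> \<le> (\<Sum>A\<in>\<A>. 2 * exp (s\<^sup>2 * (B * v)))"
    using mom(3,4) by (intro sum_mono) force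
  also have "\<dots> = exp a"
    using card by (simp add: a_def exp_add)
  finally have EE: "expectation E \<le> exp a" .
  have bound: "emp_max m \<A> w \<le> (a + exp (- a) * E w - 1) / s" for w
  proof -
    have "emp_max m \<A> w \<in> (\<lambda>A. \<bar>emp m A w\<bar>) ` \<A>"
      unfolding emp_max_def using \<A> by (intro Max_in) auto
    then obtain A where A: "A \<in> \<A>" "emp_max m \<A> w = \<bar>emp m A w\<bar>" by auto
    have "exp (s * \<bar>emp m A w\<bar>) \<le> exp (s * emp m A w) + exp ((- s) * emp m A w)"
      by (cases "0 \<le> emp m A w") auto
    also have "\<dots> \<le> E w" unfolding E_def
      by (rule member_le_sum[OF A(1)]) (use \<A>(1) in \<open>auto intro: add_nonneg_nonneg\<close>)
    finally have "exp (s * emp_max m \<A> w) \<le> E w" by (simp add: A(2))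
    then have "exp (- a) * exp (s * emp_max m \<A> w) \<le> exp (- a) * E w"
      by (rule mult_left_mono) simp
    \<comment> \<open>The tangent of the exponential at \<open>a\<close> replaces Jensen's
      inequality: it bounds \<open>emp_max\<close> pointwise by an integrable function, which yields
      integrability and the estimate at once.\<close>
    moreover have "1 + (s * emp_max m \<A> w - a) \<le> exp (- a) * exp (s * emp_max m \<A> w)"
      using exp_ge_add_one_self[of "s * emp_max m \<A> w - a"] by (simp add: exp_diff exp_minus field_simps)
    ultimately have "s * emp_max m \<A> w \<le> a + exp (- a) * E w - 1" by linarith
    then show ?thesis using s by (simp add: field_simps)
  qed
  have int_bound: "integrable M (\<lambda>w. (a + exp (- a) * E w - 1) / s)" using intE by auto
  show int: "integrable M (emp_max m \<A>)"
  proof (rule Bochner_Integration.integrable_bound[OF int_bound])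
    have "norm (emp_max m \<A> w) \<le> norm ((a + exp (- a) * E w - 1) / s)" for w
      using bound[of w] emp_max_nonneg[OF \<A>(1,2), of m w] unfolding real_norm_def by linarith
    then show "AE w in M. norm (emp_max m \<A> w) \<le> norm ((a + exp (- a) * E w - 1) / s)" by simp
  qed (use \<A> in simp)
  have "expectation (emp_max m \<A>) \<le> expectation (\<lambda>w. (a + exp (- a) * E w - 1) / s)"
    by (intro integral_mono int int_bound bound)
  also have "\<dots> = (a + exp (- a) * expectation E - 1) / s"
    using intE by (simp add: prob_space)
  also have "\<dots> \<le> a / s"
  proof -
    have "exp (- a) * expectation E \<le> exp (- a) * exp a" using EE by (intro mult_left_mono) auto
    then show ?thesis using s by (intro divide_right_mono) (auto simp: exp_minus)
  qed
  finally show "expectation (emp_max m \<A>) \<le> (ln (2 * real (card \<A>)) + s\<^sup>2 * (B * v)) / s"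
    by (simp add: a_def)
qed

end

section \<open>Chaining over quantile cells\<close>

text \<open>A level set of the rounded distribution function may start with an atom of large mass.
  Without a least point the mass is at most \<open>1 / c\<close>: for \<open>s < t\<close> in the
  level, the interval from \<open>s\<close> (excluded) to \<open>t\<close> has mass
  \<open>F t - F s\<close>, and both values round alike. The ends of \<open>T\<close> need not be
  attained, so the estimate is made on compact subsets and carried over by inner regularity.\<close>

lemma floor_level_gap:
  fixes \<mu> :: "real measure" and c :: real and a :: int
  assumes "finite_measure \<mu>" and sets_\<mu>: "sets \<mu> = sets borel" and c: "0 < c"
  defines "F \<equiv> \<lambda>t. measure \<mu> {..t}"
  defines "T \<equiv> {t. \<lfloor>c * F t\<rfloor> = a \<and> (\<exists>s<t. \<lfloor>c * F s\<rfloor> = a)}"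
  shows "T \<in> sets borel" "measure \<mu> T \<le> 1 / c"
proof -
  interpret finite_measure \<mu> by fact
  have F_mono: "F s \<le> F t" if "s \<le> t" for s t
    unfolding F_def using that by (intro finite_measure_mono) (auto simp: sets_\<mu>)
  have [measurable]: "F \<in> borel_measurable borel"
    by (rule borel_measurable_mono) (use F_mono in \<open>auto intro!: monoI\<close>)
  define C where "C = {t. \<lfloor>c * F t\<rfloor> = a}"
  have "t \<in> (\<Inter>s\<in>C. {..s}) \<longleftrightarrow> \<not> (\<exists>s<t. s \<in> C)" for t
  proof -
    have "t \<in> (\<Inter>s\<in>C. {..s}) \<longleftrightarrow> (\<forall>s\<in>C. t \<le> s)" by auto
    then show ?thesis by (meson not_le)
  qed
  \<comment> \<open>Removing the lower bounds of \<open>C\<close> removes at most its minimum. The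
    set of lower bounds is closed, which makes \<open>T\<close> Borel.\<close>
  then have "T = C - (\<Inter>s\<in>C. {..s})" by (auto simp: T_def C_def)
  moreover have "C \<in> sets borel"
  proof -
    have "{t \<in> space borel. \<lfloor>c * F t\<rfloor> = a} \<in> sets borel" by measurable
    then show ?thesis by (simp add: C_def)
  qed
  moreover have "(\<Inter>s\<in>C. {..s}) \<in> sets borel"
    by (rule borel_closed) auto
  ultimately show T: "T \<in> sets borel" by auto
  have "emeasure \<mu> T = (SUP K \<in> {K. K \<subseteq> T \<and> compact K}. emeasure \<mu> K)"
    by (rule inner_regular[OF sets_\<mu> _ T]) simp
  also have "\<dots> \<le> ennreal (1 / c)"
  proof (rule SUP_least, safe)
    fix K assume K: "K \<subseteq> T" "compact K"
    show "emeasure \<mu> K \<le> ennreal (1 / c)"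
    proof (cases "K = {}")
      case False
      obtain x where x: "x \<in> K" "\<And>t. t \<in> K \<Longrightarrow> t \<le> x"
        using compact_attains_sup[OF K(2) False] by auto
      obtain y where y: "y \<in> K" "\<And>t. t \<in> K \<Longrightarrow> y \<le> t"
        using compact_attains_inf[OF K(2) False] by auto
      obtain s where s: "s < y" "\<lfloor>c * F s\<rfloor> = a" using y(1) K(1) by (auto simp: T_def)
      have sx: "s \<le> x" using s(1) y(2)[OF x(1)] by simp
      have K_sub: "K \<subseteq> {..x} - {..s}"
      proof
        fix t assume "t \<in> K"
        then show "t \<in> {..x} - {..s}" using x(2)[of t] y(2)[of t] s(1) by simp
      qed
      have "measure \<mu> K \<le> measure \<mu> ({..x} - {..s})"
        by (rule finite_measure_mono[OF K_sub]) (simp add: sets_\<mu>)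
      also have "\<dots> = F x - F s"
        unfolding F_def using sx by (intro finite_measure_Diff) (auto simp: sets_\<mu>)
      also have "\<dots> \<le> 1 / c"
      proof -
        have "\<lfloor>c * F x\<rfloor> = a" using x(1) K(1) by (auto simp: T_def)
        then have "c * F x - c * F s \<le> 1" using s(2) by linarith
        then show ?thesis using c by (simp add: field_simps)
      qed
      finally show ?thesis by (simp add: emeasure_eq_measure ennreal_leI)
    qed simp
  qed
  finally show "measure \<mu> T \<le> 1 / c"
    using c by (simp add: emeasure_eq_measure)
qed

lemma card_range_le_of_factor:
  assumes "\<And>u v. c u = c v \<Longrightarrow> g u = g v" "finite (range c)"
  shows "finite (range g)" "card (range g) \<le> card (range c)"
proof -
  have "c (inv c (c u)) = c u" for u by (simp add: f_inv_into_f)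
  then have "g (inv c (c u)) = g u" for u by (rule assms(1))
  then have "range g = (\<lambda>x. g (inv c x)) ` range c"
    by (simp add: image_image)
  with assms(2) show "finite (range g)" "card (range g) \<le> card (range c)"
    by (auto intro: card_image_le)
qed

text \<open>The full series of \<open>(k + 1) x^k\<close> is \<open>1 / (1 - x)^2\<close>, which is
  16 at \<open>x = 3/4\<close>; the induction carries the exact remainder.\<close>

lemma sum_Suc_mult_power_le: "(\<Sum>k<n. real (Suc k) * (3 / 4) ^ k) \<le> 16"
proof -
  have "(\<Sum>k<n. real (Suc k) * (3 / 4) ^ k) = 16 - (3 / 4) ^ n * (4 * real n + 16)"
  proof (induction n)
    case (Suc n)
    have "(\<Sum>k<Suc n. real (Suc k) * (3 / 4) ^ k) =
        16 - (3 / 4) ^ n * (4 * real n + 16) + real (Suc n) * (3 / 4) ^ n"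
      by (simp only: sum.lessThan_Suc Suc.IH)
    also have "\<dots> = 16 - (3 / 4) ^ Suc n * (4 * real (Suc n) + 16)"
      by (simp only: power_Suc of_nat_Suc) (simp only: ring_distribs, simp)
    finally show ?case .
  qed simp
  then show ?thesis by simp
qed

lemma atMost_borel [measurable, simp]: "{..u :: 'b::ordered_euclidean_space} \<in> sets borel"
  by (rule borel_closed) simp

lemma halfspace_borel [measurable, simp]: "{z :: 'b::euclidean_space. z \<bullet> i \<le> t} \<in> sets borel"
  by measurable

section \<open>The weighted law and its quantile cells\<close>

context weighted_sample
begin

definition law :: "'b measure" where
  "law = distr (density M (\<lambda>w. ennreal (W 0 w))) borel (Z 0)"

lemma sets_law [simp, measurable_cong]: "sets law = sets borel"
  by (simp add: law_def)

lemma space_law [simp]: "space law = UNIV"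
  by (simp add: law_def)

lemma emeasure_law:
  assumes [measurable]: "A \<in> sets borel"
  shows "emeasure law A = ennreal (mass A)"
proof -
  have "emeasure law A = emeasure (density M (\<lambda>w. ennreal (W 0 w))) (Z 0 -` A \<inter> space M)"
    unfolding law_def by (subst emeasure_distr) auto
  also have "\<dots> = (\<integral>\<^sup>+w. ennreal (W 0 w) * indicator (Z 0 -` A \<inter> space M) w \<partial>M)"
    by (rule emeasure_density) measurable
  also have "\<dots> = (\<integral>\<^sup>+w. ennreal (W 0 w * indicator A (Z 0 w)) \<partial>M)"
    by (rule nn_integral_cong) (auto simp: indicator_def)
  also have "\<dots> = ennreal (mass A)"
    unfolding mass_def using W0_bounds
    by (intro nn_integral_eq_integral weighted_indicator_integrable)
      (auto elim!: eventually_mono)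
  finally show ?thesis .
qed

lemma finite_measure_law: "finite_measure law"
  by (rule finite_measureI) (simp add: emeasure_law)

lemma measure_law: "A \<in> sets borel \<Longrightarrow> measure law A = mass A"
  by (simp add: measure_def emeasure_law mass_bounds)

lemma mass_mono: "A \<subseteq> A' \<Longrightarrow> A \<in> sets borel \<Longrightarrow> A' \<in> sets borel \<Longrightarrow> mass A \<le> mass A'"
  using finite_measure.finite_measure_mono[OF finite_measure_law, of A A'] by (simp add: measure_law)

lemma mass_Diff: "A' \<subseteq> A \<Longrightarrow> A \<in> sets borel \<Longrightarrow> A' \<in> sets borel \<Longrightarrow> mass (A - A') = mass A - mass A'"
  using finite_measure.finite_measure_Diff[OF finite_measure_law, of A A'] by (simp add: measure_law)

lemma mass_UN_le:
  assumes "finite I" "\<And>i. i \<in> I \<Longrightarrow> A i \<in> sets borel"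
  shows "mass (\<Union>i\<in>I. A i) \<le> (\<Sum>i\<in>I. mass (A i))"
proof -
  have "measure law (\<Union>i\<in>I. A i) \<le> (\<Sum>i\<in>I. measure law (A i))"
    using assms by (intro finite_measure.finite_measure_subadditive_finite[OF finite_measure_law]) auto
  with assms show ?thesis by (simp add: measure_law sets.finite_UN)
qed

definition marginal :: "'b \<Rightarrow> real \<Rightarrow> real" where
  "marginal i t = mass {z. z \<bullet> i \<le> t}"

lemma marginal_bounds: "0 \<le> marginal i t" "marginal i t \<le> 1"
  by (auto simp: marginal_def mass_bounds)

lemma marginal_mono: "s \<le> t \<Longrightarrow> marginal i s \<le> marginal i t"
  unfolding marginal_def by (intro mass_mono) auto

lemma marginal_measurable [measurable]: "marginal i \<in> borel_measurable borel"
  by (rule borel_measurable_mono) (auto intro!: monoI marginal_mono)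

text \<open>
  Quantile cells of the index space, of mass about \<open>4\<^sup>-\<^sup>k\<close> in every coordinate. Atoms need no special
  treatment, because the cells partition the range of the marginal distribution functions. The
  factor \<open>1/2\<close> makes level 0 trivial, so that the chain starts at the empty set.
\<close>

definition cell :: "nat \<Rightarrow> 'b \<Rightarrow> 'b \<Rightarrow> int" where
  "cell k u = (\<lambda>i\<in>Basis. \<lfloor>4 ^ k / 2 * marginal i (u \<bullet> i)\<rfloor>)"

text \<open>The largest set contained in every orthant whose corner lies in the cell of
  \<open>u\<close>. The intersection is uncountable, but its members are closed, hence it is Borel.
  Together with \<open>upper\<close> it brackets all these orthants at once.\<close>

definition lower :: "nat \<Rightarrow> 'b \<Rightarrow> 'b set" where
  "lower k u = (\<Inter>v\<in>{v. cell k v = cell k u}. {..v})"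

definition upper :: "nat \<Rightarrow> 'b \<Rightarrow> 'b set" where
  "upper k u = {z. \<forall>i\<in>Basis. cell k z i \<le> cell k u i}"

lemma cell_in_PiE: "cell k u \<in> Basis \<rightarrow>\<^sub>E {0..<4 ^ k}"
proof -
  have "0 \<le> \<lfloor>4 ^ k / 2 * marginal i t\<rfloor>" "\<lfloor>4 ^ k / 2 * marginal i t\<rfloor> < 4 ^ k" for i t
  proof -
    have "4 ^ k / 2 * marginal i t \<le> 4 ^ k / 2 * 1"
      using marginal_bounds by (intro mult_left_mono) auto
    also have "\<dots> < 4 ^ k" by simp
    finally show "\<lfloor>4 ^ k / 2 * marginal i t\<rfloor> < 4 ^ k" by (simp add: floor_less_iff)
    show "0 \<le> \<lfloor>4 ^ k / 2 * marginal i t\<rfloor>" using marginal_bounds[of i t] by simp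
  qed
  then show ?thesis by (auto simp: cell_def)
qed

lemma finite_range_cell: "finite (range (cell k))"
  by (rule finite_subset[of _ "Basis \<rightarrow>\<^sub>E {0..<4 ^ k}"]) (use cell_in_PiE in \<open>auto intro: finite_PiE\<close>)

lemma card_range_cell: "card (range (cell k)) \<le> 4 ^ (k * DIM('b))"
proof -
  have "card (range (cell k)) \<le> card ((Basis :: 'b set) \<rightarrow>\<^sub>E {0..<4 ^ k :: int})"
    by (rule card_mono) (use cell_in_PiE in \<open>auto intro: finite_PiE\<close>)
  also have "\<dots> = 4 ^ (k * DIM('b))"
    by (simp add: card_PiE power_mult nat_power_eq)
  finally show ?thesis .
qed

text \<open>The ratio of consecutive levels is the integer 4, so coarse rounding is fine rounding
  followed by integer division; this nests the cells.\<close>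

lemma cell_Suc:
  assumes "cell (Suc k) u = cell (Suc k) v"
  shows "cell k u = cell k v"
proof -
  have "cell k x = (\<lambda>i\<in>Basis. cell (Suc k) x i div 4)" for x
  proof -
    have "\<lfloor>4 ^ k / 2 * marginal i t\<rfloor> = \<lfloor>4 ^ Suc k / 2 * marginal i t\<rfloor> div 4" for i t
      using floor_divide_real_eq_div[of 4 "4 ^ Suc k / 2 * marginal i t"] by simp
    then show ?thesis by (auto simp: cell_def fun_eq_iff)
  qed
  with assms show ?thesis by simp
qed

lemma cell_0: "cell 0 u = cell 0 v"
proof
  have "cell 0 x i = 0" if "i \<in> Basis" for x i
    using PiE_mem[OF cell_in_PiE[of 0 x] that] by simp
  then show "cell 0 u i = cell 0 v i" for i
    by (cases "i \<in> Basis") (simp_all add: cell_def)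
qed

lemma lower_cong: "cell k u = cell k v \<Longrightarrow> lower k u = lower k v"
  by (simp add: lower_def)

lemma upper_cong: "cell k u = cell k v \<Longrightarrow> upper k u = upper k v"
  by (simp add: upper_def)

lemma lower_borel [measurable, simp]: "lower k u \<in> sets borel"
  unfolding lower_def by (rule borel_closed) (auto intro: closed_eucl_atMost)

lemma upper_borel [measurable, simp]: "upper k u \<in> sets borel"
proof -
  have "{z \<in> space borel. \<forall>i\<in>Basis. \<lfloor>4 ^ k / 2 * marginal i (z \<bullet> i)\<rfloor> \<le> cell k u i} \<in> sets borel"
    by measurable
  also have "{z \<in> space borel. \<forall>i\<in>Basis. \<lfloor>4 ^ k / 2 * marginal i (z \<bullet> i)\<rfloor> \<le> cell k u i} = upper k u"
    by (auto simp: upper_def cell_def)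
  finally show ?thesis .
qed

lemma lower_subset_atMost: "lower k u \<subseteq> {..u}"
  by (auto simp: lower_def)

lemma atMost_subset_upper: "{..u} \<subseteq> upper k u"
proof
  fix z assume "z \<in> {..u}"
  then have "z \<bullet> i \<le> u \<bullet> i" if "i \<in> Basis" for i using that by (auto simp: eucl_le[where 'a = 'b])
  then show "z \<in> upper k u"
    by (auto simp: upper_def cell_def intro!: floor_mono mult_left_mono marginal_mono)
qed

lemma lower_subset_Suc: "lower k u \<subseteq> lower (Suc k) u"
  unfolding lower_def by (intro INF_superset_mono) (auto dest: cell_Suc)

text \<open>All corners share one cell, among them \<open>z - One\<close>, which is not above
  \<open>z\<close>; so no \<open>z\<close> belongs to every orthant.\<close>

lemma lower_0: "lower 0 u = {}"
proof -
  have "z \<notin> lower 0 u" for z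
  proof
    assume "z \<in> lower 0 u"
    then have "z \<in> {..z - One}" using cell_0 by (auto simp: lower_def)
    moreover obtain i :: 'b where "i \<in> Basis" by fastforce
    ultimately show False by (auto simp: eucl_le[where 'a = 'b] inner_diff_left)
  qed
  then show ?thesis by auto
qed

text \<open>A point of \<open>upper\<close> outside \<open>lower\<close> exceeds some corner
  \<open>v\<close> of the same cell in a coordinate \<open>i\<close>. Its rounded value is at most
  that of the cell and, by monotonicity, at least that of \<open>v\<close>, so it is a non-minimal
  point of the level set. \<open>floor_level_gap\<close> with \<open>c = 4 ^ k / 2\<close> bounds
  each coordinate.\<close>

lemma mass_upper_lower: "mass (upper k u - lower k u) \<le> 2 * real DIM('b) / 4 ^ k"
proof -
  define T where "T i = {t. \<lfloor>4 ^ k / 2 * marginal i t\<rfloor> = cell k u i \<and>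
    (\<exists>s<t. \<lfloor>4 ^ k / 2 * marginal i s\<rfloor> = cell k u i)}" for i :: 'b
  have T: "T i \<in> sets borel" "mass {z. z \<bullet> i \<in> T i} \<le> 2 / 4 ^ k" for i :: 'b
  proof -
    define \<mu> where "\<mu> = distr law borel (\<lambda>z. z \<bullet> i)"
    have m [measurable]: "(\<lambda>z. z \<bullet> i) \<in> law \<rightarrow>\<^sub>M borel" by measurable
    have \<mu>_eq: "measure \<mu> S = mass {z. z \<bullet> i \<in> S}" if [measurable]: "S \<in> sets borel" for S
    proof -
      have "{z. z \<bullet> i \<in> S} = (\<lambda>z. z \<bullet> i) -` S \<inter> space borel" by auto
      also have "\<dots> \<in> sets borel" by measurable
      finally show ?thesis
        using measure_law[of "{z. z \<bullet> i \<in> S}"] by (simp add: \<mu>_def measure_distr vimage_def)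
    qed
    have marg: "measure \<mu> {..t} = marginal i t" for t by (simp add: \<mu>_eq marginal_def)
    have fin: "finite_measure \<mu>"
      unfolding \<mu>_def by (rule finite_measure.finite_measure_distr[OF finite_measure_law m])
    note gap = floor_level_gap[OF fin _ , of "4 ^ k / 2" "cell k u i", unfolded marg, folded T_def]
    show "T i \<in> sets borel" using gap(1) by (simp add: \<mu>_def)
    then show "mass {z. z \<bullet> i \<in> T i} \<le> 2 / 4 ^ k"
      using gap(2) \<mu>_eq[of "T i"] by (simp add: \<mu>_def)
  qed
  have T_borel: "{z. z \<bullet> i \<in> T i} \<in> sets borel" for i :: 'b
  proof -
    note [measurable] = T(1)
    have "{z \<in> space borel. z \<bullet> i \<in> T i} \<in> sets borel" by measurable
    then show ?thesis by simp
  qed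
  have "upper k u - lower k u \<subseteq> (\<Union>i\<in>Basis. {z. z \<bullet> i \<in> T i})"
  proof
    fix z assume z: "z \<in> upper k u - lower k u"
    then obtain v where v: "cell k v = cell k u" "z \<notin> {..v}" by (auto simp: lower_def)
    then obtain i where i: "i \<in> Basis" "v \<bullet> i < z \<bullet> i" by (auto simp: eucl_le[where 'a = 'b] not_le)
    have eq: "\<lfloor>4 ^ k / 2 * marginal i (v \<bullet> i)\<rfloor> = cell k u i"
      using fun_cong[OF v(1), of i] i(1) by (simp add: cell_def)
    moreover have "\<lfloor>4 ^ k / 2 * marginal i (z \<bullet> i)\<rfloor> \<le> cell k u i"
      using z i(1) by (auto simp: upper_def cell_def)
    moreover have "\<lfloor>4 ^ k / 2 * marginal i (v \<bullet> i)\<rfloor> \<le> \<lfloor>4 ^ k / 2 * marginal i (z \<bullet> i)\<rfloor>"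
      using i(2) by (intro floor_mono mult_left_mono marginal_mono) auto
    ultimately have "z \<bullet> i \<in> T i" using i(2) by (auto simp: T_def)
    with i(1) show "z \<in> (\<Union>i\<in>Basis. {z. z \<bullet> i \<in> T i})" by auto
  qed
  then have "mass (upper k u - lower k u) \<le> mass (\<Union>i\<in>Basis. {z. z \<bullet> i \<in> T i})"
    using T_borel by (intro mass_mono) auto
  also have "\<dots> \<le> (\<Sum>i\<in>(Basis :: 'b set). mass {z. z \<bullet> i \<in> T i})"
    using T_borel by (intro mass_UN_le) auto
  also have "\<dots> \<le> (\<Sum>i\<in>(Basis :: 'b set). 2 / 4 ^ k)" by (intro sum_mono T(2))
  finally show ?thesis by (simp add: mult.commute)
qed

lemma mass_orthant_cell:
  assumes "cell k u = cell k v"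
  shows "\<bar>mass {..u} - mass {..v}\<bar> \<le> 2 * real DIM('b) / 4 ^ k"
proof -
  have "mass (lower k u) \<le> mass {..x} \<and> mass {..x} \<le> mass (upper k u)"
    if "cell k x = cell k u" for x
    using lower_subset_atMost[of k x] atMost_subset_upper[of x k] lower_cong[OF that] upper_cong[OF that]
    by (auto intro!: mass_mono)
  moreover have "mass (upper k u - lower k u) = mass (upper k u) - mass (lower k u)"
    using lower_subset_atMost[of k u] atMost_subset_upper[of u k] by (intro mass_Diff) auto
  ultimately show ?thesis using mass_upper_lower[of k u] assms by (smt (verit))
qed

section \<open>Chaining along the nested cells\<close>

definition links :: "nat \<Rightarrow> 'b set set" where
  "links k = range (\<lambda>u. lower (Suc k) u - lower k u)"

text \<open>\<open>links\<close> carry the chain from one level to the next; a gap contains the part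
  of an orthant that is left over when the chain stops. They are determined by cells of level
  \<open>Suc k\<close> and \<open>k\<close> respectively, which makes both families finite.\<close>

definition gaps :: "nat \<Rightarrow> 'b set set" where
  "gaps k = range (\<lambda>u. upper k u - lower k u)"

text \<open>Collects \<open>ln (2 * 4 ^ (Suc k * DIM('b)))\<close> and
  \<open>s\<^sup>2 * (B * v)\<close> for \<open>s = 2 ^ k\<close> and
  \<open>v = 2 * DIM('b) / 4 ^ k\<close>: the entropy grows linearly in \<open>Suc k\<close>, the
  variance term is constant.\<close>

definition chain_const :: real where
  "chain_const = ln 2 + real DIM('b) * ln 4 + 2 * B * real DIM('b)"

lemma chain_const_pos: "0 < chain_const"
proof -
  have "0 \<le> real DIM('b) * ln 4" "0 \<le> 2 * B * real DIM('b)" "0 < ln (2 :: real)"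
    using B_ge_1 by auto
  then show ?thesis unfolding chain_const_def by linarith
qed

lemma finite_links: "finite (links k)" and card_links: "card (links k) \<le> 4 ^ (Suc k * DIM('b))"
proof -
  have "lower (Suc k) u - lower k u = lower (Suc k) v - lower k v" if "cell (Suc k) u = cell (Suc k) v" for u v
    using lower_cong[OF that] lower_cong[OF cell_Suc[OF that]] by simp
  note fac = card_range_le_of_factor[of "cell (Suc k)" "\<lambda>u. lower (Suc k) u - lower k u",
      OF this finite_range_cell, folded links_def]
  show "finite (links k)" by (rule fac(1))
  show "card (links k) \<le> 4 ^ (Suc k * DIM('b))" by (rule order_trans[OF fac(2) card_range_cell])
qed

lemma finite_gaps: "finite (gaps k)" and card_gaps: "card (gaps k) \<le> 4 ^ (k * DIM('b))"
proof -
  have "upper k u - lower k u = upper k v - lower k v" if "cell k u = cell k v" for u v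
    using lower_cong[OF that] upper_cong[OF that] by simp
  note fac = card_range_le_of_factor[of "cell k" "\<lambda>u. upper k u - lower k u",
      OF this finite_range_cell, folded gaps_def]
  show "finite (gaps k)" by (rule fac(1))
  show "card (gaps k) \<le> 4 ^ (k * DIM('b))" by (rule order_trans[OF fac(2) card_range_cell])
qed

lemma links_borel: "links k \<subseteq> sets borel" and gaps_borel: "gaps k \<subseteq> sets borel"
  by (auto simp: links_def gaps_def)

lemma links_nonempty: "links k \<noteq> {}" and gaps_nonempty: "gaps k \<noteq> {}"
  by (auto simp: links_def gaps_def)

lemma mass_links: "A \<in> links k \<Longrightarrow> mass A \<le> 2 * real DIM('b) / 4 ^ k"
proof -
  assume "A \<in> links k"
  then obtain u where A: "A = lower (Suc k) u - lower k u" by (auto simp: links_def)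
  have "mass A \<le> mass (upper k u - lower k u)"
    unfolding A using lower_subset_atMost[of "Suc k" u] atMost_subset_upper[of u k]
    by (intro mass_mono) auto
  with mass_upper_lower[of k u] show ?thesis by simp
qed

lemma mass_gaps: "A \<in> gaps k \<Longrightarrow> mass A \<le> 2 * real DIM('b) / 4 ^ k"
  using mass_upper_lower by (auto simp: gaps_def)

text \<open>The choice \<open>s = 2 ^ k\<close> makes the variance term independent of
  \<open>k\<close>, and division by \<open>s\<close> yields the decay
  \<open>Suc k / 2 ^ k\<close>.\<close>

lemma level_bound:
  assumes \<A>: "finite \<A>" "\<A> \<noteq> {}" "\<A> \<subseteq> sets borel" "card \<A> \<le> 4 ^ (Suc k * DIM('b))"
    and mass: "\<And>A. A \<in> \<A> \<Longrightarrow> mass A \<le> 2 * real DIM('b) / 4 ^ k"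
    and m: "0 < m" "2 ^ k * B \<le> sqrt (real m)"
  shows "integrable M (emp_max m \<A>)" "expectation (emp_max m \<A>) \<le> chain_const * real (Suc k) / 2 ^ k"
proof -
  note E = emp_max_expectation[OF \<A>(1-3) mass m(1) _ m(2)]
  show "integrable M (emp_max m \<A>)" by (rule E) auto
  have card: "0 < card \<A>" using \<A> by (simp add: card_gt_0_iff)
  have "ln (2 * real (card \<A>)) \<le> ln (2 * 4 ^ (Suc k * DIM('b)))"
  proof (rule ln_mono)
    have "real (card \<A>) \<le> real (4 ^ (Suc k * DIM('b)))" using \<A>(4) by (simp only: of_nat_le_iff)
    then show "2 * real (card \<A>) \<le> 2 * 4 ^ (Suc k * DIM('b))" by simp
  qed (use card in auto)
  also have "\<dots> = ln 2 + real (Suc k * DIM('b)) * ln 4"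
  proof -
    have "ln (2 * 4 ^ n) = ln 2 + real n * ln (4 :: real)" for n
      by (subst ln_mult) (auto simp: ln_realpow)
    then show ?thesis .
  qed
  also have "\<dots> = ln 2 + real (Suc k) * (real DIM('b) * ln 4)"
    by (simp only: of_nat_mult mult.assoc)
  finally have 1: "ln (2 * real (card \<A>)) \<le> ln 2 + real (Suc k) * (real DIM('b) * ln 4)" .
  have "(2 ^ k)\<^sup>2 = (4 :: real) ^ k" by (simp add: power2_eq_square flip: power_mult_distrib)
  then have 2: "(2 ^ k)\<^sup>2 * (B * (2 * real DIM('b) / 4 ^ k)) = 2 * B * real DIM('b)" by simp
  have "ln 2 + real (Suc k) * (real DIM('b) * ln 4) + 2 * B * real DIM('b) \<le> chain_const * real (Suc k)"
  proof -
    have "ln 2 * 1 + 2 * B * real DIM('b) * 1 \<le> ln 2 * real (Suc k) + 2 * B * real DIM('b) * real (Suc k)"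
      using B_ge_1 by (intro add_mono mult_left_mono) auto
    then show ?thesis by (simp add: chain_const_def algebra_simps)
  qed
  with 1 2 have "ln (2 * real (card \<A>)) + (2 ^ k)\<^sup>2 * (B * (2 * real DIM('b) / 4 ^ k)) \<le> chain_const * real (Suc k)"
    by linarith
  then have "(ln (2 * real (card \<A>)) + (2 ^ k)\<^sup>2 * (B * (2 * real DIM('b) / 4 ^ k))) / 2 ^ k
      \<le> chain_const * real (Suc k) / 2 ^ k"
    by (intro divide_right_mono) auto
  moreover have "expectation (emp_max m \<A>) \<le>
      (ln (2 * real (card \<A>)) + (2 ^ k)\<^sup>2 * (B * (2 * real DIM('b) / 4 ^ k))) / 2 ^ k"
    by (rule E) auto
  ultimately show "expectation (emp_max m \<A>) \<le> chain_const * real (Suc k) / 2 ^ k" by simp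
qed

text \<open>
  The weights \<open>(3/2)\<^sup>k\<close> grow, but the weighted sum still has bounded expectation, so a bound on it
  controls the oscillation over the cells of all levels simultaneously.
\<close>

definition chain_sum :: "nat \<Rightarrow> nat \<Rightarrow> 'a \<Rightarrow> real" where
  "chain_sum m K w = (\<Sum>k<K. (3 / 2) ^ k * emp_max m (links k) w) + (3 / 2) ^ K * emp_max m (gaps K) w"

text \<open>Weighted, level \<open>k\<close> contributes
  \<open>chain_const * Suc k * (3/4)^k\<close>, and the final gap is the term of index
  \<open>K\<close>. So the series bound 16 covers everything, independently of \<open>K\<close> and
  \<open>m\<close>.\<close>

lemma chain_sum_expectation:
  assumes m: "0 < m" "2 ^ K * B \<le> sqrt (real m)"
  shows "integrable M (chain_sum m K)" "expectation (chain_sum m K) \<le> 16 * chain_const"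
proof -
  have lev: "2 ^ k * B \<le> sqrt (real m)" if "k \<le> K" for k
  proof -
    have "(2 :: real) ^ k * B \<le> 2 ^ K * B"
      using that B_ge_1 by (intro mult_right_mono power_increasing) auto
    with m(2) show ?thesis by simp
  qed
  have link: "integrable M (emp_max m (links k))"
    "expectation (emp_max m (links k)) \<le> chain_const * real (Suc k) / 2 ^ k" if "k < K" for k
    using level_bound[OF finite_links links_nonempty links_borel card_links mass_links m(1) lev] that by auto
  have "card (gaps K) \<le> 4 ^ (Suc K * DIM('b))"
    using card_gaps[of K] by (rule order_trans) (auto intro: power_increasing)
  note gap = level_bound[OF finite_gaps gaps_nonempty gaps_borel this mass_gaps m]
  show "integrable M (chain_sum m K)"
    unfolding chain_sum_def[abs_def]
    by (intro Bochner_Integration.integrable_add Bochner_Integration.integrable_sum integrable_mult_right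
        link(1) gap(1)) simp
  have summand: "(3 / 2) ^ k * (chain_const * real (Suc k) / 2 ^ k) = chain_const * (real (Suc k) * (3 / 4) ^ k)" for k
  proof -
    have "(3 / 2 :: real) ^ k / 2 ^ k = (3 / 4) ^ k" by (simp flip: power_divide)
    moreover have "(3 / 2) ^ k * (chain_const * real (Suc k) / 2 ^ k) =
        chain_const * (real (Suc k) * ((3 / 2) ^ k / 2 ^ k))"
      by (simp only: times_divide_eq_right times_divide_eq_left mult_ac)
    ultimately show ?thesis by (simp only:)
  qed
  have "expectation (chain_sum m K) =
      (\<Sum>k<K. (3 / 2) ^ k * expectation (emp_max m (links k))) + (3 / 2) ^ K * expectation (emp_max m (gaps K))"
    unfolding chain_sum_def[abs_def] using link(1) gap(1)
    by (subst Bochner_Integration.integral_add) (auto simp: Bochner_Integration.integral_sum)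
  also have "\<dots> \<le> (\<Sum>k<K. (3 / 2) ^ k * (chain_const * real (Suc k) / 2 ^ k)) +
      (3 / 2) ^ K * (chain_const * real (Suc K) / 2 ^ K)"
    using link(2) gap(2) by (intro add_mono sum_mono mult_left_mono) auto
  also have "\<dots> = chain_const * (\<Sum>k<Suc K. real (Suc k) * (3 / 4) ^ k)"
    unfolding summand by (simp add: sum_distrib_left distrib_left)
  also have "\<dots> \<le> chain_const * 16"
    using chain_const_pos by (intro mult_left_mono sum_Suc_mult_power_le) auto
  finally show "expectation (chain_sum m K) \<le> 16 * chain_const" by simp
qed

lemma emp_Diff:
  assumes "A' \<subseteq> A" "A \<in> sets borel" "A' \<in> sets borel"
  shows "emp m (A - A') w = emp m A w - emp m A' w"
proof -
  have "(\<Sum>i<m. W i w * indicator (A - A') (Z i w) - mass (A - A')) =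
      (\<Sum>i<m. W i w * indicator A (Z i w) - mass A) - (\<Sum>i<m. W i w * indicator A' (Z i w) - mass A')"
    unfolding sum_subtractf[symmetric] mass_Diff[OF assms]
  proof (rule sum.cong)
    fix i
    show "W i w * indicator (A - A') (Z i w) - (mass A - mass A') =
        W i w * indicator A (Z i w) - mass A - (W i w * indicator A' (Z i w) - mass A')"
      by (cases "Z i w \<in> A"; cases "Z i w \<in> A'") (use assms(1) in auto)
  qed simp
  then show ?thesis by (simp only: emp_def diff_divide_distrib)
qed

text \<open>Nonnegative weights make the uncentred sum monotone in the set, so only the centring is
  lost. This controls the uncountably many leftovers of orthants by finitely many gaps, at the price
  of the drift \<open>sqrt m * mass H\<close>.\<close>

lemma emp_subset_bound:
  assumes "A \<subseteq> H" "A \<in> sets borel" "H \<in> sets borel" "\<And>i. i < m \<Longrightarrow> 0 \<le> W i w"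
  shows "\<bar>emp m A w\<bar> \<le> \<bar>emp m H w\<bar> + sqrt (real m) * mass H"
proof -
  define S where "S A = (\<Sum>i<m. W i w * indicator A (Z i w)) / sqrt (real m)" for A
  have emp: "emp m A w = S A - sqrt (real m) * mass A" for A
  proof -
    have "real m / sqrt (real m) = sqrt (real m)" by (rule real_div_sqrt) simp
    then show ?thesis by (simp add: emp_def S_def sum_subtractf diff_divide_distrib flip: times_divide_eq_left)
  qed
  have "0 \<le> S A" unfolding S_def using assms(4) by (intro divide_nonneg_nonneg sum_nonneg) auto
  moreover have "S A \<le> S H" unfolding S_def
    using assms(1,4) by (intro divide_right_mono sum_mono) (auto simp: indicator_def)
  moreover have "0 \<le> sqrt (real m) * mass A" "sqrt (real m) * mass A \<le> sqrt (real m) * mass H"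
    using mass_bounds(1)[OF assms(2)] mass_mono[OF assms(1-3)] by (auto intro!: mult_left_mono)
  ultimately show ?thesis unfolding emp by linarith
qed

text \<open>Links telescope from level \<open>k\<close> to \<open>K\<close>, and a gap covers the
  remainder. All weights from level \<open>k\<close> on are at least \<open>(3/2)^k\<close>, so a
  bound \<open>R\<close> on \<open>chain_sum\<close> leaves at most \<open>R * (2/3)^k\<close> for
  the tail.\<close>

lemma emp_orthant_lower:
  assumes chain: "chain_sum m K w \<le> R" and k: "k \<le> K" and W: "\<And>i. i < m \<Longrightarrow> 0 \<le> W i w"
  shows "\<bar>emp m {..u} w - emp m (lower k u) w\<bar> \<le> R * (2 / 3) ^ k + 2 * real DIM('b) * sqrt (real m) / 4 ^ K"
proof -
  define S where "S = (\<Sum>j\<in>{k..<K}. emp_max m (links j) w)"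
  define T where "T = emp_max m (gaps K) w"
  have nn: "0 \<le> emp_max m (links j) w" "0 \<le> T" for j
    using emp_max_nonneg[OF finite_links links_nonempty] emp_max_nonneg[OF finite_gaps gaps_nonempty]
    by (auto simp: T_def)
  have tele: "\<bar>emp m (lower (k + n) u) w - emp m (lower k u) w\<bar> \<le> (\<Sum>j\<in>{k..<k + n}. emp_max m (links j) w)" for n
  proof (induction n)
    case (Suc n)
    have "\<bar>emp m (lower (Suc (k + n)) u - lower (k + n) u) w\<bar> \<le> emp_max m (links (k + n)) w"
      by (rule emp_le_emp_max[OF finite_links]) (auto simp: links_def)
    then have "\<bar>emp m (lower (Suc (k + n)) u) w - emp m (lower (k + n) u) w\<bar> \<le> emp_max m (links (k + n)) w"
      by (simp add: emp_Diff[OF lower_subset_Suc])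
    with Suc show ?case by simp
  qed simp
  have "\<bar>emp m (lower K u) w - emp m (lower k u) w\<bar> \<le> S"
    using tele[of "K - k"] k by (simp add: S_def)
  moreover have "\<bar>emp m {..u} w - emp m (lower K u) w\<bar> \<le> T + 2 * real DIM('b) * sqrt (real m) / 4 ^ K"
  proof -
    have "\<bar>emp m ({..u} - lower K u) w\<bar> \<le>
        \<bar>emp m (upper K u - lower K u) w\<bar> + sqrt (real m) * mass (upper K u - lower K u)"
      using atMost_subset_upper[of u K] W by (intro emp_subset_bound) auto
    moreover have "\<bar>emp m (upper K u - lower K u) w\<bar> \<le> T"
      unfolding T_def by (rule emp_le_emp_max[OF finite_gaps]) (auto simp: gaps_def)
    moreover have "sqrt (real m) * mass (upper K u - lower K u) \<le> sqrt (real m) * (2 * real DIM('b) / 4 ^ K)"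
      by (intro mult_left_mono mass_upper_lower) auto
    ultimately show ?thesis
      by (simp add: emp_Diff[OF lower_subset_atMost] mult_ac)
  qed
  moreover have "S + T \<le> R * (2 / 3) ^ k"
  proof -
    have "(3 / 2) ^ k * (S + T) = (\<Sum>j\<in>{k..<K}. (3 / 2) ^ k * emp_max m (links j) w) + (3 / 2) ^ k * T"
      by (simp add: S_def distrib_left sum_distrib_left)
    also have "\<dots> \<le> (\<Sum>j\<in>{k..<K}. (3 / 2) ^ j * emp_max m (links j) w) + (3 / 2) ^ K * T"
      using k nn by (intro add_mono sum_mono mult_right_mono power_increasing) auto
    also have "\<dots> \<le> (\<Sum>j<K. (3 / 2) ^ j * emp_max m (links j) w) + (3 / 2) ^ K * T"
      using nn by (intro add_right_mono sum_mono2) auto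
    also have "\<dots> \<le> R" using chain by (simp add: chain_sum_def T_def)
    finally have "(2 / 3) ^ k * ((3 / 2) ^ k * (S + T)) \<le> (2 / 3) ^ k * R"
      by (intro mult_left_mono) auto
    moreover have "(2 / 3 :: real) ^ k * (3 / 2) ^ k = 1" by (simp flip: power_mult_distrib)
    then have eq: "(2 / 3) ^ k * ((3 / 2) ^ k * (S + T)) = S + T" by (simp only: mult.assoc[symmetric]) simp
    ultimately have "S + T \<le> (2 / 3) ^ k * R" by (simp only: eq)
    then show ?thesis by (simp only: mult.commute)
  qed
  ultimately show ?thesis by linarith
qed

lemma emp_orthant_tight:
  assumes m: "0 < m" "B \<le> sqrt (real m)" and R: "0 < R"
  obtains A where "A \<in> events" "prob A \<ge> 1 - 16 * chain_const / R"
    "\<And>w i. w \<in> A \<Longrightarrow> i < m \<Longrightarrow> 0 \<le> W i w \<and> W i w \<le> B"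
    "\<And>w u. w \<in> A \<Longrightarrow> \<bar>emp m {..u} w\<bar> \<le> R + 8 * real DIM('b) * B\<^sup>2 / sqrt (real m)"
    "\<And>w k u v. w \<in> A \<Longrightarrow> 2 ^ k * B \<le> sqrt (real m) \<Longrightarrow> cell k u = cell k v \<Longrightarrow>
      \<bar>emp m {..u} w - emp m {..v} w\<bar> \<le>
        2 * (R * (2 / 3) ^ k + 8 * real DIM('b) * B\<^sup>2 / sqrt (real m))"
proof -
  define s where "s = sqrt (real m)"
  have s: "0 < s" using m by (simp add: s_def)
  have B: "1 \<le> B" by (rule B_ge_1)
  have "1 \<le> nat \<lfloor>s / B\<rfloor>"
  proof -
    have "1 \<le> s / B" using m(2) B by (simp add: s_def field_simps)
    then show ?thesis by linarith
  qed
  \<comment> \<open>\<open>K\<close> is the deepest level in the Bernstein range. Maximality gives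
    \<open>s < 2 ^ (K + 1) * B\<close>, so \<open>4 ^ K\<close> is of order
    \<open>m / B\<^sup>2\<close> and the drift \<open>s / 4 ^ K\<close> of the gaps is of order
    \<open>1 / sqrt m\<close>.\<close>
  from ex_power_ivl1[OF order_refl this]
  obtain K where K: "2 ^ K \<le> nat \<lfloor>s / B\<rfloor>" "nat \<lfloor>s / B\<rfloor> < 2 ^ (K + 1)" by auto
  have sB: "0 \<le> s / B" using s B by simp
  have K1: "2 ^ K * B \<le> s"
  proof -
    have "real (2 ^ K) \<le> real (nat \<lfloor>s / B\<rfloor>)" using K(1) by (simp only: of_nat_le_iff)
    also have "\<dots> \<le> s / B" using sB by simp
    finally show ?thesis using B by (simp add: field_simps)
  qed
  have K2: "s < 2 ^ (K + 1) * B"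
  proof -
    have "nat \<lfloor>s / B\<rfloor> + 1 \<le> 2 ^ (K + 1)" using K(2) by simp
    then have "real (nat \<lfloor>s / B\<rfloor> + 1) \<le> real (2 ^ (K + 1))" by (simp only: of_nat_le_iff)
    moreover have "s / B < real (nat \<lfloor>s / B\<rfloor> + 1)" using sB by (simp add: floor_less_iff) linarith
    ultimately have "s / B < 2 ^ (K + 1)" by simp
    then show ?thesis using B by (simp add: field_simps)
  qed
  have rem: "2 * real DIM('b) * s / 4 ^ K \<le> 8 * real DIM('b) * B\<^sup>2 / s"
  proof -
    have "s * s \<le> (2 ^ (K + 1) * B) * (2 ^ (K + 1) * B)" using K2 s B by (intro mult_mono) auto
    also have "\<dots> = 4 * 4 ^ K * B\<^sup>2"
      by (simp add: power2_eq_square mult_ac flip: power_mult_distrib)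
    finally have "s / 4 ^ K \<le> 4 * B\<^sup>2 / s" using s by (simp add: field_simps)
    then have "2 * real DIM('b) * (s / 4 ^ K) \<le> 2 * real DIM('b) * (4 * B\<^sup>2 / s)"
      by (intro mult_left_mono) auto
    then show ?thesis by simp
  qed
  note E = chain_sum_expectation[OF m(1) K1[unfolded s_def]]
  define A where "A = {w \<in> space M. chain_sum m K w < R \<and> (\<forall>i<m. 0 \<le> W i w \<and> W i w \<le> B)}"
  have [measurable]: "chain_sum m K \<in> borel_measurable M" using E(1) by auto
  have A_meas: "A \<in> events" unfolding A_def by measurable
  have chain_nonneg: "0 \<le> chain_sum m K w" for w
    unfolding chain_sum_def
    using emp_max_nonneg[OF finite_links links_nonempty] emp_max_nonneg[OF finite_gaps gaps_nonempty]
    by (intro add_nonneg_nonneg sum_nonneg mult_nonneg_nonneg) auto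
  have "prob {w \<in> space M. R \<le> chain_sum m K w} \<le> expectation (chain_sum m K) / R"
    using E(1) chain_nonneg R by (intro integral_Markov_inequality_measure[where A = "{}"]) auto
  also have "\<dots> \<le> 16 * chain_const / R" using E(2) R by (intro divide_right_mono) auto
  finally have markov: "prob {w \<in> space M. R \<le> chain_sum m K w} \<le> 16 * chain_const / R" .
  have "AE w in M. \<forall>i<m. 0 \<le> W i w \<and> W i w \<le> B"
    using W_bounds by (simp add: AE_all_countable)
  then have "prob A = prob {w \<in> space M. chain_sum m K w < R}"
    unfolding A_def by (intro finite_measure_eq_AE) (auto elim!: eventually_mono)
  also have "\<dots> = 1 - prob {w \<in> space M. R \<le> chain_sum m K w}"
    by (subst prob_neg[symmetric]) (auto simp: not_le)
  finally have prob: "prob A \<ge> 1 - 16 * chain_const / R" using markov by simp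
  have bound: "\<bar>emp m {..u} w - emp m (lower k u) w\<bar> \<le> R * (2 / 3) ^ k + 8 * real DIM('b) * B\<^sup>2 / s"
    if "w \<in> A" "k \<le> K" for w k u
  proof -
    have "chain_sum m K w \<le> R" "\<And>i. i < m \<Longrightarrow> 0 \<le> W i w" using that(1) by (simp_all add: A_def)
    from emp_orthant_lower[OF this(1) that(2) this(2), of u] rem show ?thesis by (simp add: s_def)
  qed
  show thesis
  proof (rule that[OF A_meas prob])
    show "0 \<le> W i w \<and> W i w \<le> B" if "w \<in> A" "i < m" for w i using that by (auto simp: A_def)
    show "\<bar>emp m {..u} w\<bar> \<le> R + 8 * real DIM('b) * B\<^sup>2 / sqrt (real m)" if "w \<in> A" for w u
    proof -
      have "emp m (lower 0 u) w = 0" by (simp add: lower_0 emp_def mass_def)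
      with bound[OF that, of 0 u] show ?thesis by (simp add: s_def)
    qed
    fix w k u v
    assume w: "w \<in> A" and k: "2 ^ k * B \<le> sqrt (real m)" and uv: "cell k u = cell k v"
    have "2 ^ k * B < 2 ^ (K + 1) * B" using k K2 by (simp add: s_def)
    then have "(2 :: real) ^ k < 2 ^ (K + 1)" using B by simp
    from power_less_imp_less_exp[OF _ this] have "k \<le> K" by simp
    from bound[OF w this, of u] bound[OF w this, of v] lower_cong[OF uv]
    show "\<bar>emp m {..u} w - emp m {..v} w\<bar> \<le>
        2 * (R * (2 / 3) ^ k + 8 * real DIM('b) * B\<^sup>2 / sqrt (real m))"
      by (simp add: s_def)
  qed
qed

end

section \<open>Linearisation of plug-in estimators\<close>

lemma eventually_sqrt_ge: "\<forall>\<^sub>F m in sequentially. c \<le> sqrt (real m)"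
  using filterlim_compose[OF sqrt_at_top filterlim_real_sequentially]
  by (auto simp: filterlim_at_top)

lemma const_over_sqrt_tendsto_0: "(\<lambda>m. c / sqrt (real m)) \<longlonglongrightarrow> 0"
  using filterlim_compose[OF sqrt_at_top filterlim_real_sequentially]
  by (intro tendsto_divide_0[OF tendsto_const]) (rule filterlim_at_top_imp_at_infinity)

lemma eventually_const_over_sqrt_le:
  assumes "0 < e"
  shows "\<forall>\<^sub>F m in sequentially. c / sqrt (real m) \<le> e"
  using order_tendstoD(2)[OF const_over_sqrt_tendsto_0 assms] by (rule eventually_mono) (rule less_imp_le)

section \<open>The self-normalised empirical distribution function\<close>

context weighted_sample
begin

abbreviation cdf_at :: "'b \<Rightarrow> real" where
  "cdf_at u \<equiv> mass {..u}"

definition wsum :: "nat \<Rightarrow> 'a \<Rightarrow> real" where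
  "wsum m w = (\<Sum>i<m. W i w)"

definition ncdf :: "nat \<Rightarrow> 'a \<Rightarrow> 'b \<Rightarrow> real" where
  "ncdf m w u = (\<Sum>i<m. W i w * of_bool (Z i w \<le> u)) / wsum m w"

definition sampling :: "nat \<Rightarrow> 'a \<Rightarrow> 'b \<Rightarrow> real" where
  "sampling m w u = sqrt (real m) * (ncdf m w u - cdf_at u)"

lemma mass_UNIV: "mass UNIV = 1"
  by (simp add: mass_def W0_mean)

lemma cdf_at_bounds: "0 \<le> cdf_at u" "cdf_at u \<le> 1"
  by (simp_all add: mass_bounds)

lemma wsum_eq: "0 < m \<Longrightarrow> wsum m w / real m = 1 + emp m UNIV w / sqrt (real m)"
  by (simp add: wsum_def emp_def mass_UNIV sum_subtractf field_simps)

text \<open>Dividing by the random total weight subtracts \<open>cdf_at u\<close> times the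
  fluctuation of that total. The identity is exact, so the quotient is never expanded.\<close>

lemma sampling_eq:
  assumes "0 < m" "0 < wsum m w"
  shows "sampling m w u = real m / wsum m w * (emp m {..u} w - cdf_at u * emp m UNIV w)"
proof -
  define s where "s = sqrt (real m)"
  have s: "0 < s" "real m = s * s" using assms(1) by (simp_all add: s_def)
  define N where "N = (\<Sum>i<m. W i w * of_bool (Z i w \<le> u))"
  have e1: "emp m {..u} w = (N - real m * cdf_at u) / s"
    by (simp add: emp_def N_def s_def sum_subtractf indicator_def)
  have e2: "emp m UNIV w = (wsum m w - real m) / s"
    by (simp add: emp_def s_def wsum_def sum_subtractf mass_UNIV)
  have "emp m {..u} w - cdf_at u * emp m UNIV w = (N - cdf_at u * wsum m w) / s"
    unfolding e1 e2 by (simp add: diff_divide_distrib[symmetric] algebra_simps)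
  then have "real m / wsum m w * (emp m {..u} w - cdf_at u * emp m UNIV w)
      = s * ((N - cdf_at u * wsum m w) / wsum m w)"
    using s assms(2) by simp
  also have "(N - cdf_at u * wsum m w) / wsum m w = N / wsum m w - cdf_at u"
    using assms(2) by (simp add: diff_divide_distrib)
  finally show ?thesis by (simp add: sampling_def ncdf_def N_def s_def)
qed

text \<open>The whole space is not an orthant, so the total weight gets its own bound: the maximal
  inequality for the single set \<open>UNIV\<close> with \<open>s = 1\<close> and
  \<open>v = 1\<close>.\<close>

lemma emp_UNIV_tail:
  assumes "0 < m" "B \<le> sqrt (real m)" "0 < R"
  shows "prob {w \<in> space M. R \<le> \<bar>emp m UNIV w\<bar>} \<le> (ln 2 + B) / R"
proof -
  have max: "emp_max m {UNIV} w = \<bar>emp m UNIV w\<bar>" for w by (simp add: emp_max_def)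
  note E = emp_max_expectation[of "{UNIV}" 1 m 1, unfolded max[abs_def]]
  have int: "integrable M (\<lambda>w. \<bar>emp m UNIV w\<bar>)" and le: "expectation (\<lambda>w. \<bar>emp m UNIV w\<bar>) \<le> ln 2 + B"
    using E assms(1,2) by (simp_all add: mass_UNIV)
  have "prob {w \<in> space M. R \<le> \<bar>emp m UNIV w\<bar>} \<le> expectation (\<lambda>w. \<bar>emp m UNIV w\<bar>) / R"
    using int assms(3) by (intro integral_Markov_inequality_measure[where A = "{}"]) auto
  also have "\<dots> \<le> (ln 2 + B) / R" using le assms(3) by (intro divide_right_mono) auto
  finally show ?thesis .
qed

lemma sampling_on_event:
  assumes m: "0 < m" and R: "\<bar>emp m UNIV w\<bar> \<le> R" "2 * R \<le> sqrt (real m)"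
  shows "0 < wsum m w" "real m / wsum m w \<le> 2" "\<bar>real m / wsum m w - 1\<bar> \<le> 2 * R / sqrt (real m)"
proof -
  define q where "q = wsum m w / real m"
  have s: "0 < sqrt (real m)" using m by simp
  have "\<bar>q - 1\<bar> = \<bar>emp m UNIV w\<bar> / sqrt (real m)"
    unfolding q_def wsum_eq[OF m] by simp
  also have "\<dots> \<le> R / sqrt (real m)" using R(1) s by (intro divide_right_mono) auto
  finally have q1: "\<bar>q - 1\<bar> \<le> R / sqrt (real m)" .
  moreover have "R / sqrt (real m) \<le> 1 / 2" using R(2) s by (simp add: field_simps)
  ultimately have q2: "1 / 2 \<le> q" by linarith
  show pos: "0 < wsum m w" using q2 m by (simp add: q_def field_simps)
  have inv: "real m / wsum m w = 1 / q" by (simp add: q_def)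
  show le2: "real m / wsum m w \<le> 2" unfolding inv using q2 by (simp add: field_simps)
  have "\<bar>1 / q - 1\<bar> = \<bar>q - 1\<bar> * (1 / q)" using q2 by (simp add: abs_if field_simps)
  also have "\<dots> \<le> R / sqrt (real m) * 2"
    using q1 q2 le2 inv by (intro mult_mono) auto
  finally show "\<bar>real m / wsum m w - 1\<bar> \<le> 2 * R / sqrt (real m)" unfolding inv by (simp add: mult.commute)
qed

text \<open>The probability bound adds two Markov estimates, for \<open>chain_sum\<close> and for
  the total weight. The other clauses concern single sample points, so later arguments on the event
  are deterministic.\<close>

definition tight_event :: "real \<Rightarrow> nat \<Rightarrow> 'a set \<Rightarrow> bool" where
  "tight_event R m A \<longleftrightarrow> A \<in> events \<and> prob A \<ge> 1 - (16 * chain_const + ln 2 + B) / R \<and>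
    (\<forall>w\<in>A. (\<forall>i<m. 0 \<le> W i w) \<and> \<bar>emp m UNIV w\<bar> \<le> R \<and>
      (\<forall>u. \<bar>emp m {..u} w\<bar> \<le> R + 8 * real DIM('b) * B\<^sup>2 / sqrt (real m)) \<and>
      (\<forall>k u v. 2 ^ k * B \<le> sqrt (real m) \<longrightarrow> cell k u = cell k v \<longrightarrow>
        \<bar>emp m {..u} w - emp m {..v} w\<bar> \<le>
          2 * (R * (2 / 3) ^ k + 8 * real DIM('b) * B\<^sup>2 / sqrt (real m))))"

lemma tight_event_exists:
  assumes "0 < m" "B \<le> sqrt (real m)" "0 < R"
  shows "\<exists>A. tight_event R m A"
proof -
  obtain A where A: "A \<in> events" "prob A \<ge> 1 - 16 * chain_const / R"
    "\<And>w i. w \<in> A \<Longrightarrow> i < m \<Longrightarrow> 0 \<le> W i w \<and> W i w \<le> B"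
    "\<And>w u. w \<in> A \<Longrightarrow> \<bar>emp m {..u} w\<bar> \<le> R + 8 * real DIM('b) * B\<^sup>2 / sqrt (real m)"
    "\<And>w k u v. w \<in> A \<Longrightarrow> 2 ^ k * B \<le> sqrt (real m) \<Longrightarrow> cell k u = cell k v \<Longrightarrow>
      \<bar>emp m {..u} w - emp m {..v} w\<bar> \<le>
        2 * (R * (2 / 3) ^ k + 8 * real DIM('b) * B\<^sup>2 / sqrt (real m))"
    by (rule emp_orthant_tight[OF assms]) (assumption | rule that)+
  define T where "T = {w \<in> space M. R \<le> \<bar>emp m UNIV w\<bar>}"
  have T: "T \<in> events" unfolding T_def by measurable
  have "prob A \<le> prob (A - T) + prob T"
  proof -
    have "prob A \<le> prob ((A - T) \<union> T)" using A(1) T by (intro finite_measure_mono) auto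
    also have "\<dots> \<le> prob (A - T) + prob T" using A(1) T by (intro measure_Un_le) auto
    finally show ?thesis .
  qed
  then have "1 - 16 * chain_const / R - (ln 2 + B) / R \<le> prob (A - T)"
    using A(2) emp_UNIV_tail[OF assms] by (simp add: T_def)
  then have "1 - (16 * chain_const + ln 2 + B) / R \<le> prob (A - T)"
    by (simp add: add_divide_distrib)
  moreover have "\<bar>emp m UNIV w\<bar> \<le> R" if "w \<in> A - T" for w
    using that sets.sets_into_space[OF A(1)] by (auto simp: T_def)
  ultimately have "tight_event R m (A - T)"
    unfolding tight_event_def using A T by simp
  then show ?thesis ..
qed

lemma sampling_tight:
  assumes \<delta>: "0 < \<delta>"
  obtains A R where "\<And>m. A m \<in> events" "\<forall>\<^sub>F m in sequentially. prob (A m) \<ge> 1 - \<delta>" "0 < R"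
    "asymp_totally_bounded (\<lambda>m. sampling m ` A m)"
    "\<forall>\<^sub>F m in sequentially. \<forall>w\<in>A m. (\<forall>i<m. 0 \<le> W i w) \<and> 0 < wsum m w \<and>
       \<bar>real m / wsum m w - 1\<bar> \<le> R / sqrt (real m)"
proof -
  have "0 < ln (2 :: real)" by simp
  then have c: "0 < 16 * chain_const + ln 2 + B" using chain_const_pos B_ge_1 by linarith
  define R where "R = (16 * chain_const + ln 2 + B) / \<delta>"
  have R: "0 < R" using c \<delta> by (simp add: R_def)
  have R\<delta>: "(16 * chain_const + ln 2 + B) / R = \<delta>" using c \<delta> by (simp add: R_def)
  \<comment> \<open>For small \<open>m\<close> the empty set is used, so that \<open>A m\<close> is
    an event for every \<open>m\<close>; the probability bound is claimed eventually only.\<close>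
  define A where "A m = (if 0 < m \<and> B \<le> sqrt (real m) then SOME A. tight_event R m A else {})" for m
  have A: "tight_event R m (A m)" if "0 < m" "B \<le> sqrt (real m)" for m
    using someI_ex[OF tight_event_exists[OF that R]] that by (simp add: A_def)
  have A_events: "A m \<in> events" for m
    using A[of m] by (cases "0 < m \<and> B \<le> sqrt (real m)") (auto simp: tight_event_def A_def)
  define r where "r m = 8 * real DIM('b) * B\<^sup>2 / sqrt (real m)" for m
  have ev_A: "\<forall>\<^sub>F m in sequentially. 0 < m \<and> 2 * R \<le> sqrt (real m) \<and> tight_event R m (A m)"
    using eventually_gt_at_top[of 0] eventually_sqrt_ge[of B] eventually_sqrt_ge[of "2 * R"]
    by eventually_elim (use A in auto)
  have osc: "\<bar>sampling m w u - sampling m w v\<bar> \<le>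
      2 * (2 * (R * (2 / 3) ^ k + r m) + 2 * real DIM('b) / 4 ^ k * R)"
    if m: "0 < m" "2 * R \<le> sqrt (real m)" and t: "tight_event R m (A m)" and w: "w \<in> A m"
      and k: "2 ^ k * B \<le> sqrt (real m)" "cell k u = cell k v" for m w k u v
  proof -
    have U: "\<bar>emp m UNIV w\<bar> \<le> R" using t w by (auto simp: tight_event_def)
    note on = sampling_on_event[OF m(1) U m(2)]
    have 1: "\<bar>emp m {..u} w - emp m {..v} w\<bar> \<le> 2 * (R * (2 / 3) ^ k + r m)"
      using t w k unfolding tight_event_def r_def by blast
    have 2: "\<bar>(cdf_at u - cdf_at v) * emp m UNIV w\<bar> \<le> 2 * real DIM('b) / 4 ^ k * R"
      unfolding abs_mult using U mass_orthant_cell[OF k(2)] by (intro mult_mono) auto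
    have "sampling m w u - sampling m w v = real m / wsum m w *
        ((emp m {..u} w - emp m {..v} w) - (cdf_at u - cdf_at v) * emp m UNIV w)"
      unfolding sampling_eq[OF m(1) on(1)] by (simp add: algebra_simps)
    then have "\<bar>sampling m w u - sampling m w v\<bar> = real m / wsum m w *
        \<bar>(emp m {..u} w - emp m {..v} w) - (cdf_at u - cdf_at v) * emp m UNIV w\<bar>"
      using on(1) by (simp add: abs_mult)
    also have "\<dots> \<le> 2 * (2 * (R * (2 / 3) ^ k + r m) + 2 * real DIM('b) / 4 ^ k * R)"
      using on(1,2) 1 2 by (intro mult_mono) linarith+
    finally show ?thesis .
  qed
  have bd: "\<bar>sampling m w u\<bar> \<le> 2 * (2 * R + r m)"
    if m: "0 < m" "2 * R \<le> sqrt (real m)" and t: "tight_event R m (A m)" and w: "w \<in> A m" for m w u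
  proof -
    have U: "\<bar>emp m UNIV w\<bar> \<le> R" using t w by (auto simp: tight_event_def)
    note on = sampling_on_event[OF m(1) U m(2)]
    have 1: "\<bar>emp m {..u} w\<bar> \<le> R + r m"
      using t w unfolding tight_event_def r_def by blast
    have 2: "\<bar>cdf_at u * emp m UNIV w\<bar> \<le> 1 * R"
      unfolding abs_mult using U cdf_at_bounds by (intro mult_mono) auto
    have "\<bar>sampling m w u\<bar> = real m / wsum m w * \<bar>emp m {..u} w - cdf_at u * emp m UNIV w\<bar>"
      unfolding sampling_eq[OF m(1) on(1)] using on(1) by (simp add: abs_mult)
    also have "\<dots> \<le> 2 * (2 * R + r m)"
      using on(1,2) 1 2 by (intro mult_mono) linarith+
    finally show ?thesis .
  qed
  show thesis
  proof (rule that[of A "2 * R"])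
    show "A m \<in> events" for m by (rule A_events)
    show "\<forall>\<^sub>F m in sequentially. prob (A m) \<ge> 1 - \<delta>"
      using ev_A by eventually_elim (simp add: tight_event_def R\<delta>)
    show "0 < 2 * R" using R by simp
    show "\<forall>\<^sub>F m in sequentially. \<forall>w\<in>A m. (\<forall>i<m. 0 \<le> W i w) \<and> 0 < wsum m w \<and>
       \<bar>real m / wsum m w - 1\<bar> \<le> 2 * R / sqrt (real m)"
      using ev_A
    proof eventually_elim
      case (elim m)
      show ?case
      proof
        fix w assume w: "w \<in> A m"
        then have U: "\<bar>emp m UNIV w\<bar> \<le> R" and pos: "\<forall>i<m. 0 \<le> W i w" using elim by (auto simp: tight_event_def)
        from sampling_on_event[OF _ U] elim pos
        show "(\<forall>i<m. 0 \<le> W i w) \<and> 0 < wsum m w \<and> \<bar>real m / wsum m w - 1\<bar> \<le> 2 * R / sqrt (real m)"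
          by simp
      qed
    qed
    show "asymp_totally_bounded (\<lambda>m. sampling m ` A m)"
      unfolding asymp_totally_bounded_def
    proof (intro conjI allI impI)
      have "\<forall>\<^sub>F m in sequentially. r m \<le> 1"
        unfolding r_def by (rule eventually_const_over_sqrt_le) simp
      with ev_A have "\<forall>\<^sub>F m in sequentially. \<forall>h\<in>sampling m ` A m. \<forall>u. \<bar>h u\<bar> \<le> 2 * (2 * R + 1)"
      proof eventually_elim
        case (elim m)
        show ?case
        proof safe
          fix w u assume "w \<in> A m"
          then have "\<bar>sampling m w u\<bar> \<le> 2 * (2 * R + r m)" using bd elim by simp
          with elim show "\<bar>sampling m w u\<bar> \<le> 2 * (2 * R + 1)" by simp
        qed
      qed
      then show "\<exists>R'. \<forall>\<^sub>F m in sequentially. \<forall>h\<in>sampling m ` A m. \<forall>u. \<bar>h u\<bar> \<le> R'" ..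
    next
      fix \<kappa> :: real assume \<kappa>: "0 < \<kappa>"
      \<comment> \<open>\<open>k\<close> is fixed with the remainder \<open>r m\<close> replaced by
        0, and only then is \<open>m\<close> taken so large that
        \<open>r m \<le> \<kappa> / 8\<close>; the remainder enters four times and uses the other
        half of \<open>\<kappa>\<close>.\<close>
      have "(\<lambda>k. 2 * (2 * (R * (2 / 3) ^ k + 0) + 2 * real DIM('b) * (1 / 4) ^ k * R)) \<longlonglongrightarrow>
          2 * (2 * (R * 0 + 0) + 2 * real DIM('b) * 0 * R)"
        by (intro tendsto_intros LIMSEQ_power_zero) auto
      then have "\<forall>\<^sub>F k in sequentially. 2 * (2 * (R * (2 / 3) ^ k + 0) + 2 * real DIM('b) * (1 / 4) ^ k * R) < \<kappa> / 2"
        by (rule order_tendstoD(2)) (use \<kappa> in auto)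
      then obtain k where k: "2 * (2 * (R * (2 / 3) ^ k + 0) + 2 * real DIM('b) * (1 / 4) ^ k * R) < \<kappa> / 2"
        by (auto simp: eventually_sequentially)
      define P where "P = (\<lambda>c. {u. cell k u = c}) ` range (cell k)"
      have "\<forall>\<^sub>F m in sequentially. r m \<le> \<kappa> / 8"
        unfolding r_def by (rule eventually_const_over_sqrt_le) (use \<kappa> in simp)
      with ev_A eventually_sqrt_ge[of "2 ^ k * B"]
      have "\<forall>\<^sub>F m in sequentially. \<forall>h\<in>sampling m ` A m. \<forall>S\<in>P. \<forall>u\<in>S. \<forall>v\<in>S. \<bar>h u - h v\<bar> \<le> \<kappa>"
      proof eventually_elim
        case (elim m)
        have "\<bar>sampling m w u - sampling m w v\<bar> \<le> \<kappa>" if "w \<in> A m" "cell k u = cell k v" for w u v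
        proof -
          have "\<bar>sampling m w u - sampling m w v\<bar> \<le>
              2 * (2 * (R * (2 / 3) ^ k + r m) + 2 * real DIM('b) / 4 ^ k * R)"
            using osc[of m w k u v] elim that by simp
          with k elim show ?thesis by (simp add: power_one_over)
        qed
        then show ?case by (auto simp: P_def)
      qed
      moreover have "finite P" by (simp add: P_def finite_range_cell)
      moreover have "\<Union>P = UNIV" by (auto simp: P_def)
      ultimately show "\<exists>P. finite P \<and> \<Union>P = UNIV \<and>
          (\<forall>\<^sub>F m in sequentially. \<forall>h\<in>sampling m ` A m. \<forall>S\<in>P. \<forall>u\<in>S. \<forall>v\<in>S. \<bar>h u - h v\<bar> \<le> \<kappa>)"
        by (intro exI[of _ P]) simp
    qed
  qed
qed

end

text \<open>Strengthens \<open>T - S = o_p(1)\<close> with \<open>S = O_p(1)\<close>: the events are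
  chosen before \<open>\<kappa>\<close>, and the bounds hold at each of their points, so the notion
  makes sense for \<open>T\<close> that is not measurable.\<close>

definition tight_expansion :: "'a measure \<Rightarrow> (nat \<Rightarrow> 'a \<Rightarrow> real) \<Rightarrow> (nat \<Rightarrow> 'a \<Rightarrow> real) \<Rightarrow> bool" where
  "tight_expansion M T S \<longleftrightarrow> (\<forall>\<delta>>0. \<exists>A R. (\<forall>m. A m \<in> sets M) \<and>
     (\<forall>\<^sub>F m in sequentially. measure M (A m) \<ge> 1 - \<delta>) \<and>
     (\<forall>\<kappa>>0. \<forall>\<^sub>F m in sequentially. \<forall>w\<in>A m. \<bar>T m w - S m w\<bar> \<le> \<kappa>) \<and>
     (\<forall>\<^sub>F m in sequentially. \<forall>w\<in>A m. \<bar>S m w\<bar> \<le> R))"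

text \<open>Membership in \<open>D\<close> is asked for when the weights are nonnegative with
  positive sum, since otherwise the weighted distribution function may fail to be a CDF; the tight
  events secure both conditions.\<close>

locale plug_in = weighted_sample M W Z B
  for M :: "'a measure" and W :: "nat \<Rightarrow> 'a \<Rightarrow> real" and Z :: "nat \<Rightarrow> 'a \<Rightarrow> 'b::ordered_euclidean_space" and B +
  fixes \<Phi> :: "('b \<Rightarrow> real) \<Rightarrow> real" and L :: "('b \<Rightarrow> real) \<Rightarrow> real" and D :: "('b \<Rightarrow> real) set"
  assumes hadamard: "has_hadamard_derivative_on \<Phi> L cdf_at D"
    and ncdf_in_D: "(\<And>i. i < m \<Longrightarrow> 0 \<le> W i w) \<Longrightarrow> 0 < wsum m w \<Longrightarrow> ncdf m w \<in> D"
begin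

sublocale sup_norm_functional L
  by (rule has_hadamard_derivative_on_functional[OF hadamard])

definition infl :: "'b \<Rightarrow> real" where
  "infl z = L (\<lambda>u. of_bool (z \<le> u) - cdf_at u)"

definition lin :: "nat \<Rightarrow> 'a \<Rightarrow> real" where
  "lin m w = (\<Sum>i<m. W i w * infl (Z i w)) / sqrt (real m)"

lemma bounded_centered: "bounded (range (\<lambda>u. of_bool (z \<le> u) - cdf_at u))"
  using cdf_at_bounds by (auto simp: bounded_iff intro!: exI[of _ 1])

lemma infl_bound: "\<bar>infl z\<bar> \<le> op_bound"
proof -
  have "\<bar>of_bool (z \<le> u) - cdf_at u\<bar> \<le> 1" for u using cdf_at_bounds[of u] by auto
  from abs_le_op_bound[of "\<lambda>u. of_bool (z \<le> u) - cdf_at u", OF this] show ?thesis by (simp add: infl_def)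
qed

lemma infl_measurable [measurable]: "infl \<in> borel_measurable borel"
proof -
  have "infl z = L (\<lambda>u. of_bool (z \<le> u)) - L cdf_at" for z
    unfolding infl_def using cdf_at_bounds
    by (intro diff) (auto simp: bounded_iff intro!: exI[of _ 1])
  then have "infl = (\<lambda>z. L (\<lambda>u. of_bool (z \<le> u)) - L cdf_at)" by (rule ext)
  with borel_measurable_diff[OF sup_norm_functional_orthant_measurable[OF sup_norm_functional_axioms]
      borel_measurable_const]
  show ?thesis by simp
qed

text \<open>\<open>sampling\<close> is a finite combination of centred orthant indicators, so
  linearity evaluates \<open>L\<close> exactly. Self-normalisation leaves only the factor
  \<open>m / wsum\<close>, which is close to one on the tight events.\<close>

lemma L_sampling:
  assumes "0 < m" "0 < wsum m w"
  shows "L (sampling m w) = real m / wsum m w * lin m w"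
proof -
  define s where "s = sqrt (real m)"
  have s: "0 < s" "real m = s * s" using assms(1) by (simp_all add: s_def)
  have "sampling m w = (\<lambda>u. \<Sum>i<m. s * W i w / wsum m w * (of_bool (Z i w \<le> u) - cdf_at u))"
  proof
    fix u
    have "(\<Sum>i<m. s * W i w / wsum m w * (of_bool (Z i w \<le> u) - cdf_at u)) =
        s / wsum m w * (\<Sum>i<m. W i w * (of_bool (Z i w \<le> u) - cdf_at u))"
      by (simp only: sum_distrib_left) (simp add: mult_ac)
    also have "(\<Sum>i<m. W i w * (of_bool (Z i w \<le> u) - cdf_at u)) =
        (\<Sum>i<m. W i w * of_bool (Z i w \<le> u)) - cdf_at u * wsum m w"
      by (simp only: right_diff_distrib sum_subtractf wsum_def sum_distrib_left mult.commute[of _ "cdf_at u"])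
    also have "s / wsum m w * ((\<Sum>i<m. W i w * of_bool (Z i w \<le> u)) - cdf_at u * wsum m w) = sampling m w u"
      using assms(2) by (simp only: sampling_def ncdf_def s_def) (simp add: diff_divide_distrib right_diff_distrib)
    finally show "sampling m w u = (\<Sum>i<m. s * W i w / wsum m w * (of_bool (Z i w \<le> u) - cdf_at u))" ..
  qed
  moreover have "L (\<lambda>u. \<Sum>i<m. s * W i w / wsum m w * (of_bool (Z i w \<le> u) - cdf_at u)) =
      (\<Sum>i<m. s * W i w / wsum m w * infl (Z i w))"
    unfolding infl_def by (rule sum) (auto intro: bounded_centered)
  ultimately have "L (sampling m w) = (\<Sum>i<m. s * W i w / wsum m w * infl (Z i w))"
    by (simp only:)
  also have "\<dots> = s / wsum m w * (\<Sum>i<m. W i w * infl (Z i w))"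
    by (simp only: sum_distrib_left) (simp add: mult_ac)
  also have "\<dots> = real m / wsum m w * lin m w" unfolding lin_def s_def[symmetric] s(2) using s(1) by simp
  finally show ?thesis .
qed

lemma asymptotically_linear:
  "tight_expansion M (\<lambda>m w. sqrt (real m) * (\<Phi> (ncdf m w) - \<Phi> cdf_at)) lin"
  unfolding tight_expansion_def
proof (intro allI impI)
  fix \<delta> :: real assume \<delta>: "0 < \<delta>"
  obtain A R where A: "\<And>m. A m \<in> events" "\<forall>\<^sub>F m in sequentially. prob (A m) \<ge> 1 - \<delta>" and R: "0 < R"
    and tb: "asymp_totally_bounded (\<lambda>m. sampling m ` A m)"
    and ws: "\<forall>\<^sub>F m in sequentially. \<forall>w\<in>A m. (\<forall>i<m. 0 \<le> W i w) \<and> 0 < wsum m w \<and>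
       \<bar>real m / wsum m w - 1\<bar> \<le> R / sqrt (real m)"
    by (rule sampling_tight[OF \<delta>]) (assumption | rule that)+
  have F_plus: "(\<lambda>u. cdf_at u + 1 / sqrt (real m) * sampling m w u) = ncdf m w" if "0 < m" for m w
    using that by (simp add: sampling_def fun_eq_iff)
  have exp: "\<forall>\<^sub>F m in sequentially. \<forall>h\<in>sampling m ` A m.
      \<bar>(\<Phi> (\<lambda>u. cdf_at u + 1 / sqrt (real m) * h u) - \<Phi> cdf_at) / (1 / sqrt (real m)) - L h\<bar> \<le> \<kappa>"
    if "0 < \<kappa>" for \<kappa>
  proof (rule hadamard_uniform_expansion[OF hadamard tb _ _ _ that])
    show "\<forall>\<^sub>F m in sequentially. 0 < 1 / sqrt (real m)"
      using eventually_gt_at_top[of 0] by eventually_elim simp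
    show "(\<lambda>m. 1 / sqrt (real m)) \<longlonglongrightarrow> 0" by (rule const_over_sqrt_tendsto_0)
    show "\<forall>\<^sub>F m in sequentially. \<forall>h\<in>sampling m ` A m. (\<lambda>u. cdf_at u + 1 / sqrt (real m) * h u) \<in> D"
      using eventually_gt_at_top[of 0] ws
    proof eventually_elim
      case (elim m)
      show ?case
      proof safe
        fix w assume "w \<in> A m"
        with elim(2) have "ncdf m w \<in> D" by (intro ncdf_in_D) auto
        then show "(\<lambda>u. cdf_at u + 1 / sqrt (real m) * sampling m w u) \<in> D" by (simp only: F_plus[OF elim(1)])
      qed
    qed
  qed
  obtain R' where R': "\<forall>\<^sub>F m in sequentially. \<forall>h\<in>sampling m ` A m. \<forall>u. \<bar>h u\<bar> \<le> R'"
    using tb[unfolded asymp_totally_bounded_def, THEN conjunct1] ..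
  define R2 where "R2 = 2 * (op_bound * R')"
  \<comment> \<open>Boundedness is read off from \<open>L\<close> of bounded paths rather than from
    a variance: that the summands are centred is not known yet and will be deduced from this very
    bound. The 2 in \<open>R2\<close> compensates \<open>m / wsum \<ge> 1/2\<close>.\<close>
  have lin_bd: "\<forall>\<^sub>F m in sequentially. \<forall>w\<in>A m. \<bar>lin m w\<bar> \<le> R2"
    using eventually_gt_at_top[of 0] ws R' eventually_const_over_sqrt_le[of "1 / 2" R, OF half_gt_zero[OF zero_less_one]]
  proof eventually_elim
    case (elim m)
    show ?case
    proof
      fix w assume w: "w \<in> A m"
      with elim have pos: "0 < wsum m w" and q: "\<bar>real m / wsum m w - 1\<bar> \<le> R / sqrt (real m)" by auto
      have "\<bar>sampling m w u\<bar> \<le> R'" for u using elim(3) w by auto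
      from abs_le_op_bound[of "sampling m w", OF this]
      have le: "real m / wsum m w * \<bar>lin m w\<bar> \<le> op_bound * R'"
        using pos by (simp add: L_sampling[OF elim(1) pos] abs_mult)
      have "1 / 2 \<le> real m / wsum m w" using q elim(4) by linarith
      then have "1 / 2 * \<bar>lin m w\<bar> \<le> real m / wsum m w * \<bar>lin m w\<bar>" by (intro mult_right_mono) auto
      with le show "\<bar>lin m w\<bar> \<le> R2" unfolding R2_def by linarith
    qed
  qed
  have approx: "\<forall>\<^sub>F m in sequentially. \<forall>w\<in>A m.
      \<bar>sqrt (real m) * (\<Phi> (ncdf m w) - \<Phi> cdf_at) - lin m w\<bar> \<le> \<kappa>" if \<kappa>: "0 < \<kappa>" for \<kappa>
  proof -
    have \<kappa>2: "0 < \<kappa> / 2" using \<kappa> by simp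
    from eventually_gt_at_top[of 0] ws exp[OF \<kappa>2] lin_bd eventually_const_over_sqrt_le[OF \<kappa>2, of "R * R2"]
    show ?thesis
    proof eventually_elim
      case (elim m)
      show ?case
      proof
        fix w assume w: "w \<in> A m"
        with elim have pos: "0 < wsum m w" and q: "\<bar>real m / wsum m w - 1\<bar> \<le> R / sqrt (real m)" by auto
        have "\<bar>(\<Phi> (ncdf m w) - \<Phi> cdf_at) / (1 / sqrt (real m)) - L (sampling m w)\<bar> \<le> \<kappa> / 2"
          using elim(3) w by (auto simp only: F_plus[OF elim(1)] image_iff Ball_def)
        then have 1: "\<bar>sqrt (real m) * (\<Phi> (ncdf m w) - \<Phi> cdf_at) - real m / wsum m w * lin m w\<bar> \<le> \<kappa> / 2"
          by (simp add: L_sampling[OF elim(1) pos] mult.commute)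
        have "\<bar>real m / wsum m w * lin m w - lin m w\<bar> = \<bar>real m / wsum m w - 1\<bar> * \<bar>lin m w\<bar>"
          by (simp add: left_diff_distrib flip: abs_mult)
        also have "\<dots> \<le> R / sqrt (real m) * R2" using q elim(4) w by (intro mult_mono) auto
        also have "\<dots> \<le> \<kappa> / 2" using elim(5) by simp
        finally have 2: "\<bar>real m / wsum m w * lin m w - lin m w\<bar> \<le> \<kappa> / 2" .
        have "\<bar>a - c\<bar> \<le> \<kappa>" if "\<bar>a - b\<bar> \<le> \<kappa> / 2" "\<bar>b - c\<bar> \<le> \<kappa> / 2" for a b c
          using that by linarith
        from this[OF 1 2] show "\<bar>sqrt (real m) * (\<Phi> (ncdf m w) - \<Phi> cdf_at) - lin m w\<bar> \<le> \<kappa>" .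
      qed
    qed
  qed
  show "\<exists>A R. (\<forall>m. A m \<in> events) \<and>
     (\<forall>\<^sub>F m in sequentially. prob (A m) \<ge> 1 - \<delta>) \<and>
     (\<forall>\<kappa>>0. \<forall>\<^sub>F m in sequentially. \<forall>w\<in>A m.
        \<bar>sqrt (real m) * (\<Phi> (ncdf m w) - \<Phi> cdf_at) - lin m w\<bar> \<le> \<kappa>) \<and>
     (\<forall>\<^sub>F m in sequentially. \<forall>w\<in>A m. \<bar>lin m w\<bar> \<le> R)"
    using A approx lin_bd by (intro exI[of _ A] exI[of _ R2]) simp
qed

text \<open>
  The interchange of \<open>L\<close> with the expectation is not available a priori; it follows from the
  tightness of the linear statistic, which rules out a drift of order \<open>\<surd>m\<close>.
\<close>

lemma infl_mean_zero: "expectation (\<lambda>w. W 0 w * infl (Z 0 w)) = 0"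
proof (rule ccontr)
  define \<mu> where "\<mu> = expectation (\<lambda>w. W 0 w * infl (Z 0 w))"
  assume "expectation (\<lambda>w. W 0 w * infl (Z 0 w)) \<noteq> 0"
  then have \<mu>: "0 < \<bar>\<mu>\<bar>" by (simp add: \<mu>_def)
  \<comment> \<open>The summand 1 keeps the interval \<open>{- b..b}\<close> nondegenerate for
    Hoeffding's inequality even if \<open>op_bound\<close> is 0.\<close>
  define b where "b = B * op_bound + 1"
  have b: "0 < b" using B_ge_1 op_bound_nonneg by (simp add: b_def add_nonneg_pos)
  define X where "X i w = W i w * infl (Z i w)" for i w
  have mean: "expectation (X i) = \<mu>" for i
  proof -
    have "(\<lambda>p :: real \<times> 'b. fst p * infl (snd p)) \<in> borel_measurable borel"
      unfolding borel_prod[symmetric] by measurable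
    from expectation_ident[OF this, of i] show ?thesis by (simp add: \<mu>_def X_def[abs_def])
  qed
  have bd: "AE w in M. X i w \<in> {- b..b}" for i
    using W_bounds[of i]
  proof eventually_elim
    case (elim w)
    have "\<bar>X i w\<bar> \<le> B * op_bound"
      unfolding X_def abs_mult using elim infl_bound by (intro mult_mono) auto
    then show ?case by (auto simp: b_def)
  qed
  have ind: "indep_vars (\<lambda>_. borel) X {..<m}" for m
  proof -
    have "indep_vars (\<lambda>_. borel) (\<lambda>i w. (\<lambda>p. fst p * infl (snd p)) (W i w, Z i w)) {..<m}"
      by (rule indep_vars_compose2[OF indep_vars_subset[OF indep]])
        (simp_all add: borel_prod[symmetric])
    then show ?thesis by (simp add: X_def[abs_def])
  qed
  have "0 < (1 / 2 :: real)" by simp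
  from asymptotically_linear[unfolded tight_expansion_def, rule_format, OF this]
  obtain A R where A: "\<forall>m. A m \<in> events" "\<forall>\<^sub>F m in sequentially. prob (A m) \<ge> 1 - 1 / 2"
    and lin_bd: "\<forall>\<^sub>F m in sequentially. \<forall>w\<in>A m. \<bar>lin m w\<bar> \<le> R"
    by auto
  have "(\<lambda>m. 2 * exp (- (\<mu>\<^sup>2 / (8 * b\<^sup>2)) * real m)) \<longlonglongrightarrow> 2 * 0"
  proof (intro tendsto_mult_left filterlim_compose[OF exp_at_bot])
    have "- (\<mu>\<^sup>2 / (8 * b\<^sup>2)) < 0" using \<mu> b by auto
    then show "filterlim (\<lambda>m. - (\<mu>\<^sup>2 / (8 * b\<^sup>2)) * real m) at_bot sequentially"
      by (rule filterlim_tendsto_neg_mult_at_bot[OF tendsto_const _ filterlim_real_sequentially])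
  qed
  then have "\<forall>\<^sub>F m in sequentially. 2 * exp (- (\<mu>\<^sup>2 / (8 * b\<^sup>2)) * real m) < 1 / 2"
    by (rule order_tendstoD(2)) simp
  moreover have "\<forall>\<^sub>F m in sequentially. R / sqrt (real m) \<le> \<bar>\<mu>\<bar> / 2"
    by (rule eventually_const_over_sqrt_le) (use \<mu> in simp)
  ultimately have "\<forall>\<^sub>F m in sequentially. False"
    using eventually_gt_at_top[of 0] A(2) lin_bd
  proof eventually_elim
    case (elim m)
    have H: "Hoeffding_ineq M {..<m} X (\<lambda>_. - b) (\<lambda>_. b)"
      by unfold_locales (use ind bd in auto)
    have sum_mean: "(\<Sum>i\<in>{..<m}. expectation (X i)) = real m * \<mu>" by (simp add: mean)
    have "prob {w \<in> space M. \<bar>(\<Sum>i\<in>{..<m}. X i w) - real m * \<mu>\<bar> \<ge> real m * \<bar>\<mu>\<bar> / 2} \<le>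
        2 * exp (- 2 * (real m * \<bar>\<mu>\<bar> / 2)\<^sup>2 / (\<Sum>i\<in>{..<m}. (b - (- b))\<^sup>2))"
      using Hoeffding_ineq.Hoeffding_ineq_abs_ge[OF H, of "real m * \<bar>\<mu>\<bar> / 2"] elim(3) b \<mu>
      by (simp add: sum_mean)
    also have "- 2 * (real m * \<bar>\<mu>\<bar> / 2)\<^sup>2 / (\<Sum>i\<in>{..<m}. (b - (- b))\<^sup>2) = - (\<mu>\<^sup>2 / (8 * b\<^sup>2)) * real m"
      using elim(3) b by (simp add: power2_eq_square field_simps)
    also have "2 * exp \<dots> < 1 / 2" by (rule elim(1))
    finally have small: "prob {w \<in> space M. \<bar>(\<Sum>i\<in>{..<m}. X i w) - real m * \<mu>\<bar> \<ge> real m * \<bar>\<mu>\<bar> / 2} < 1 / 2" .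
    \<comment> \<open>On \<open>A m\<close> the sum is at most \<open>R * sqrt m\<close>, hence at
      most \<open>m * \<bar>\<mu>\<bar> / 2\<close>, in absolute value: it misses its mean
      \<open>m * \<mu>\<close> by a large deviation. Hoeffding gives this a probability below 1/2,
      whereas \<open>A m\<close> has at least 1/2.\<close>
    have "A m \<subseteq> {w \<in> space M. \<bar>(\<Sum>i\<in>{..<m}. X i w) - real m * \<mu>\<bar> \<ge> real m * \<bar>\<mu>\<bar> / 2}"
    proof
      fix w assume w: "w \<in> A m"
      have s: "0 < sqrt (real m)" "real m = sqrt (real m) * sqrt (real m)" using elim(3) by auto
      have "\<bar>(\<Sum>i<m. X i w)\<bar> = \<bar>lin m w\<bar> * sqrt (real m)"
        using s(1) by (simp add: lin_def X_def abs_mult)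
      also have "\<dots> \<le> R * sqrt (real m)" using elim(5) w by (intro mult_right_mono) auto
      also have "\<dots> = R / sqrt (real m) * real m" using s by (metis nonzero_eq_divide_eq mult.assoc times_divide_eq_left less_irrefl)
      also have "\<dots> \<le> \<bar>\<mu>\<bar> / 2 * real m" using elim(2) by (intro mult_right_mono) auto
      finally have "\<bar>(\<Sum>i<m. X i w)\<bar> \<le> real m * \<bar>\<mu>\<bar> / 2" by (simp add: mult.commute)
      moreover have "\<bar>real m * \<mu>\<bar> = real m * \<bar>\<mu>\<bar>" by (simp add: abs_mult)
      ultimately have "\<bar>(\<Sum>i\<in>{..<m}. X i w) - real m * \<mu>\<bar> \<ge> real m * \<bar>\<mu>\<bar> / 2" by linarith
      then show "w \<in> {w \<in> space M. \<bar>(\<Sum>i\<in>{..<m}. X i w) - real m * \<mu>\<bar> \<ge> real m * \<bar>\<mu>\<bar> / 2}"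
        using w sets.sets_into_space[OF A(1)[rule_format]] by auto
    qed
    moreover have "{w \<in> space M. \<bar>(\<Sum>i\<in>{..<m}. X i w) - real m * \<mu>\<bar> \<ge> real m * \<bar>\<mu>\<bar> / 2} \<in> events"
    proof -
      have [measurable]: "X i \<in> borel_measurable M" for i unfolding X_def[abs_def] by measurable
      show ?thesis by measurable
    qed
    ultimately have "prob (A m) < 1 / 2" using small finite_measure_mono by (meson le_less_trans)
    with elim(4) show False by simp
  qed
  then show False by simp
qed

end

section \<open>Weak convergence and inverse probability weighting\<close>

lemma point_cdf_eq: "point_cdf z u = of_bool (z \<le> u)"
  by (auto simp: point_cdf_def less_eq_prod_def split: prod.splits)

text \<open>The normalised weights are a probability on the indices, and its image under
  \<open>z\<close> is the required law.\<close>

lemma weighted_ecdf_in_cdfs: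
  fixes z :: "nat \<Rightarrow> (real ^ 'd::finite) \<times> real"
  assumes w: "\<And>i. i < m \<Longrightarrow> 0 \<le> w i" and pos: "0 < (\<Sum>i<m. w i)"
  shows "weighted_ecdf m w z \<in> cdfs"
proof -
  define s where "s = (\<Sum>i<m. w i)"
  have s: "0 < s" using pos by (simp add: s_def)
  define P where "P = point_measure {..<m} (\<lambda>i. ennreal (w i / s))"
  have "(\<Sum>i<m. ennreal (w i / s)) = 1"
    using w s by (subst sum_ennreal) (auto simp: s_def sum_divide_distrib[symmetric])
  then have P: "prob_space P"
    unfolding P_def by (intro prob_space_point_measure) auto
  have z_meas: "z \<in> measurable P borel" by (simp add: P_def measurable_point_measure_eq1)
  define \<mu> where "\<mu> = distr P borel z"
  have "weighted_ecdf m w z (x, y) = measure \<mu> {(x', y'). x' \<le> x \<and> y' \<le> y}" for x y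
  proof -
    have set_eq: "{(x', y'). x' \<le> x \<and> y' \<le> y} = {..(x, y)}" by (auto simp: less_eq_prod_def)
    have "measure \<mu> {..(x, y)} = measure P (z -` {..(x, y)} \<inter> space P)"
      unfolding \<mu>_def by (rule measure_distr[OF z_meas]) simp
    also have "z -` {..(x, y)} \<inter> space P = {i. i < m \<and> z i \<le> (x, y)}"
      by (auto simp: P_def space_point_measure)
    also have "measure P {i. i < m \<and> z i \<le> (x, y)} = (\<Sum>i | i < m \<and> z i \<le> (x, y). w i / s)"
      unfolding P_def using w s by (subst measure_point_measure_finite_if) auto
    also have "\<dots> = (\<Sum>i<m. w i * of_bool (z i \<le> (x, y)) / s)"
      by (rule sum.mono_neutral_cong_left) auto
    finally show ?thesis
      by (simp only: set_eq weighted_ecdf_def point_cdf_eq s_def sum_divide_distrib)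
  qed
  moreover have "prob_space \<mu>" "sets \<mu> = sets borel"
    using prob_space.prob_space_distr[OF P z_meas] by (simp_all add: \<mu>_def)
  ultimately show ?thesis unfolding cdfs_def by auto
qed

section \<open>Convergence in distribution through characteristic functions\<close>

lemma norm_iexp_diff_le: "norm (iexp a - iexp b) \<le> \<bar>a - b\<bar>"
proof -
  have "iexp a - iexp b = iexp b * (iexp (a - b) - 1)"
    by (simp add: right_diff_distrib flip: exp_add)
  then have "norm (iexp a - iexp b) = norm (iexp (a - b) - 1)"
    by (simp add: norm_mult)
  also have "\<dots> \<le> \<bar>a - b\<bar>" using iexp_approx1[of "a - b" 0] by simp
  finally show ?thesis .
qed

lemma (in prob_space) char_distr:
  assumes [measurable]: "X \<in> borel_measurable M"
  shows "char (distr M borel X) t = (CLINT w|M. iexp (t * X w))"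
  unfolding char_def by (rule integral_distr) measurable

text \<open>On \<open>A\<close> the integrands differ by at most
  \<open>\<bar>t\<bar> * \<kappa>\<close>, because \<open>iexp\<close> is 1-Lipschitz; off
  \<open>A\<close> they differ by at most 2.\<close>

lemma (in prob_space) char_distr_close:
  fixes S T :: "'a \<Rightarrow> real"
  assumes [measurable]: "S \<in> borel_measurable M" "T \<in> borel_measurable M" and A [measurable]: "A \<in> events"
    and close: "\<And>w. w \<in> A \<Longrightarrow> \<bar>T w - S w\<bar> \<le> \<kappa>" and \<kappa>: "0 \<le> \<kappa>"
  shows "norm (char (distr M borel T) t - char (distr M borel S) t) \<le> \<bar>t\<bar> * \<kappa> + 2 * (1 - prob A)"
proof -
  have int: "complex_integrable M (\<lambda>w. iexp (t * X w))" if [measurable]: "X \<in> borel_measurable M" for X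
    by (rule integrable_const_bound[where B = 1]) auto
  have "norm (char (distr M borel T) t - char (distr M borel S) t) =
      norm (CLINT w|M. iexp (t * T w) - iexp (t * S w))"
    using int[of T] int[of S] by (simp add: char_distr)
  also have "\<dots> \<le> (LINT w|M. norm (iexp (t * T w) - iexp (t * S w)))"
    by (rule integral_norm_bound)
  also have "\<dots> \<le> (LINT w|M. \<bar>t\<bar> * \<kappa> + 2 * indicator (space M - A) w)"
  proof (rule integral_mono)
    show "integrable M (\<lambda>w. norm (iexp (t * T w) - iexp (t * S w)))"
      using int[of T] int[of S] by auto
    show "integrable M (\<lambda>w. \<bar>t\<bar> * \<kappa> + 2 * indicator (space M - A) w)"
      by (intro Bochner_Integration.integrable_add integrable_const integrable_mult_right
          integrable_real_indicator) (auto simp: less_top[symmetric])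
    fix w assume w: "w \<in> space M"
    show "norm (iexp (t * T w) - iexp (t * S w)) \<le> \<bar>t\<bar> * \<kappa> + 2 * indicator (space M - A) w"
    proof (cases "w \<in> A")
      case True
      have "norm (iexp (t * T w) - iexp (t * S w)) \<le> \<bar>t * T w - t * S w\<bar>" by (rule norm_iexp_diff_le)
      also have "\<dots> = \<bar>t\<bar> * \<bar>T w - S w\<bar>" by (simp flip: right_diff_distrib abs_mult)
      also have "\<dots> \<le> \<bar>t\<bar> * \<kappa>" using close[OF True] by (intro mult_left_mono) auto
      finally show ?thesis using True by simp
    next
      case False
      have "norm (iexp (t * T w) - iexp (t * S w)) \<le> norm (iexp (t * T w)) + norm (iexp (t * S w))"
        by (rule norm_triangle_ineq4)
      also have "\<dots> = 2" by (simp only: norm_exp_i_times)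
      also have "2 \<le> \<bar>t\<bar> * \<kappa> + 2" using \<kappa> by simp
      finally show ?thesis using False w by simp
    qed
  qed
  also have "\<dots> = \<bar>t\<bar> * \<kappa> + 2 * prob (space M - A)" 
    by (subst Bochner_Integration.integral_add)
      (auto simp: prob_space less_top[symmetric] intro!: integrable_real_indicator integrable_mult_right)
  also have "\<dots> = \<bar>t\<bar> * \<kappa> + 2 * (1 - prob A)" by (simp add: prob_compl[OF A])
  finally show ?thesis .
qed

text \<open>A form of Slutsky's theorem for closeness on events of high probability. Levy's
  continuity theorem reduces it to a fixed argument of the characteristic functions.\<close>

lemma (in prob_space) weak_conv_m_close:
  fixes S T :: "nat \<Rightarrow> 'a \<Rightarrow> real"
  assumes S: "\<And>m. S m \<in> borel_measurable M" and T: "\<And>m. T m \<in> borel_measurable M"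
    and N: "real_distribution N" and conv: "weak_conv_m (\<lambda>m. distr M borel (S m)) N"
    and close: "\<And>\<delta> \<kappa>. 0 < \<delta> \<Longrightarrow> 0 < \<kappa> \<Longrightarrow>
      \<forall>\<^sub>F m in sequentially. \<exists>A\<in>events. prob A \<ge> 1 - \<delta> \<and> (\<forall>w\<in>A. \<bar>T m w - S m w\<bar> \<le> \<kappa>)"
  shows "weak_conv_m (\<lambda>m. distr M borel (T m)) N"
proof (rule levy_continuity[OF _ N])
  show "real_distribution (distr M borel (T m))" for m using T by simp
  fix t
  have lim: "(\<lambda>m. char (distr M borel (S m)) t) \<longlonglongrightarrow> char N t"
    using S by (intro levy_continuity1[OF _ N conv]) simp
  have "(\<lambda>m. char (distr M borel (T m)) t - char (distr M borel (S m)) t) \<longlonglongrightarrow> 0"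
  proof (rule tendstoI)
    fix e :: real assume e: "0 < e"
    \<comment> \<open>The summand 1 keeps \<open>\<kappa>\<close> positive at \<open>t = 0\<close>,
      where division by zero would return 0.\<close>
    define \<kappa> where "\<kappa> = e / (4 * (\<bar>t\<bar> + 1))"
    have \<kappa>: "0 < \<kappa>" using e by (simp add: \<kappa>_def)
    have t\<kappa>: "\<bar>t\<bar> * \<kappa> \<le> e / 4"
    proof -
      have "\<bar>t\<bar> * \<kappa> \<le> (\<bar>t\<bar> + 1) * \<kappa>" using \<kappa> by (intro mult_right_mono) auto
      also have "\<dots> = e / 4" by (simp add: \<kappa>_def field_simps)
      finally show ?thesis .
    qed
    have "\<forall>\<^sub>F m in sequentially. \<exists>A\<in>events. prob A \<ge> 1 - e / 8 \<and> (\<forall>w\<in>A. \<bar>T m w - S m w\<bar> \<le> \<kappa>)"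
      by (rule close) (use e \<kappa> in auto)
    then show "\<forall>\<^sub>F m in sequentially.
        dist (char (distr M borel (T m)) t - char (distr M borel (S m)) t) 0 < e"
    proof eventually_elim
      case (elim m)
      then obtain A where A: "A \<in> events" "prob A \<ge> 1 - e / 8" "\<And>w. w \<in> A \<Longrightarrow> \<bar>T m w - S m w\<bar> \<le> \<kappa>"
        by auto
      from char_distr_close[OF S T A(1,3), of t] \<kappa>
      have "norm (char (distr M borel (T m)) t - char (distr M borel (S m)) t) \<le> \<bar>t\<bar> * \<kappa> + 2 * (1 - prob A)"
        by simp
      also have "\<dots> \<le> e / 4 + 2 * (e / 8)" using t\<kappa> A(2) by (intro add_mono mult_left_mono) auto
      also have "\<dots> < e" using e by simp
      finally show ?case by simp
    qed
  qed
  from tendsto_add[OF this lim] show "(\<lambda>m. char (distr M borel (T m)) t) \<longlonglongrightarrow> char N t" by simp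
qed

lemma normal_law_real_distribution:
  assumes "0 \<le> v"
  shows "real_distribution (normal_law a v)"
proof (cases "v = 0")
  case True
  interpret prob_space "return borel a" by (rule prob_space_return) simp
  show ?thesis unfolding normal_law_def using True by (simp, unfold_locales) simp
next
  case False
  interpret prob_space "density lborel (normal_density a (sqrt v))"
    using False assms by (intro prob_space_normal_density) simp
  show ?thesis unfolding normal_law_def using False by (simp, unfold_locales) simp
qed

lemma char_normal_law:
  assumes "0 \<le> v"
  shows "char (normal_law 0 v) t = exp (- (v * t\<^sup>2) / 2)"
proof (cases "v = 0")
  case True
  have "char (return borel 0) t = (iexp (t * 0) :: complex)"
    unfolding char_def by (rule integral_return) auto
  with True show ?thesis by (simp add: normal_law_def)
next
  case False
  define s where "s = sqrt v"
  have s: "0 < s" "s\<^sup>2 = v" using assms False by (auto simp: s_def)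
  interpret N: prob_space std_normal_distribution by (rule prob_space_normal_density) simp
  have "distr std_normal_distribution lborel (\<lambda>x. x) = std_normal_distribution"
    by (rule distr_id2) simp
  then have "distributed std_normal_distribution lborel (\<lambda>x. x) std_normal_density"
    by (simp add: distributed_def)
  from N.normal_density_affine[OF this zero_less_one, of s 0] s(1)
  have "distributed std_normal_distribution lborel (\<lambda>x. s * x) (normal_density 0 s)" by simp
  then have "distr std_normal_distribution lborel (\<lambda>x. s * x) = density lborel (normal_density 0 s)"
    by (rule distributed_distr_eq_density)
  then have "normal_law 0 v = distr std_normal_distribution borel (\<lambda>x. s * x)"
    using False by (simp add: normal_law_def s_def cong: distr_cong)
  then have "char (normal_law 0 v) t = char std_normal_distribution (t * s)"
    by (simp add: N.char_distr) (simp add: char_def mult.assoc)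
  then show ?thesis
    by (simp add: char_std_normal_distribution power_mult_distrib s(2) mult.commute)
qed

text \<open>Extends the central limit theorem to \<open>v = 0\<close>, where all summands vanish
  almost surely; the limit variance is zero, for instance, if \<open>\<phi>\<close> vanishes. For
  \<open>v > 0\<close>, scaling by \<open>sqrt v\<close> moves into the argument of the
  characteristic function.\<close>

lemma (in prob_space) central_limit_theorem_normal_law:
  fixes X :: "nat \<Rightarrow> 'a \<Rightarrow> real"
  assumes indep: "indep_vars (\<lambda>_. borel) X UNIV"
    and mean: "\<And>n. expectation (X n) = 0" and sq: "\<And>n. integrable M (\<lambda>w. (X n w)\<^sup>2)"
    and var: "\<And>n. expectation (\<lambda>w. (X n w)\<^sup>2) = v"
    and distr: "\<And>n. distr M borel (X n) = \<mu>"
  shows "weak_conv_m (\<lambda>m. distr M borel (\<lambda>w. (\<Sum>i<m. X i w) / sqrt (real m))) (normal_law 0 v)"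
proof -
  have [measurable]: "X i \<in> borel_measurable M" for i using indep by (simp add: indep_vars_def)
  have v: "0 \<le> v" using var[of 0, symmetric] by simp
  define S where "S m w = (\<Sum>i<m. X i w) / sqrt (real m)" for m w
  have [measurable]: "S m \<in> borel_measurable M" for m unfolding S_def[abs_def] by measurable
  have "weak_conv_m (\<lambda>m. distr M borel (S m)) (normal_law 0 v)"
  proof (rule levy_continuity[OF _ normal_law_real_distribution[OF v]])
    fix t
    show "(\<lambda>m. char (distr M borel (S m)) t) \<longlonglongrightarrow> char (normal_law 0 v) t"
    proof (cases "v = 0")
      case True
      have X0: "AE w in M. X i w = 0" for i
        using integral_nonneg_eq_0_iff_AE[OF sq[of i]] var[of i] True by simp
      have "AE w in M. S m w = 0" for m
      proof -
        have "AE w in M. \<forall>i<m. X i w = 0" using X0 by (simp add: AE_all_countable)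
        then show ?thesis by eventually_elim (simp add: S_def)
      qed
      have "(CLINT w|M. iexp (t * S m w)) = (CLINT w|M. 1)" for m
      proof (rule integral_cong_AE)
        show "AE w in M. iexp (t * S m w) = 1"
          using \<open>AE w in M. S m w = 0\<close> by eventually_elim simp
      qed measurable
      then show ?thesis
        using char_normal_law[OF v, of t] True by (simp add: char_distr prob_space)
    next
      case False
      define s where "s = sqrt v"
      have s: "0 < s" "s\<^sup>2 = v" using v False by (auto simp: s_def)
      have "weak_conv_m (\<lambda>n. distr M borel (\<lambda>x. (\<Sum>i<n. X i x) / sqrt (real n * s\<^sup>2))) std_normal_distribution"
        by (rule central_limit_theorem_zero_mean[OF indep mean s(1) sq _ distr])
          (simp add: mean var s(2))
      then have "(\<lambda>m. char (distr M borel (\<lambda>w. (\<Sum>i<m. X i w) / sqrt (real m * s\<^sup>2))) (t * s)) \<longlonglongrightarrow>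
          char std_normal_distribution (t * s)"
        by (intro levy_continuity1) (auto intro: real_dist_normal_dist)
      moreover have "char (distr M borel (\<lambda>w. (\<Sum>i<m. X i w) / sqrt (real m * s\<^sup>2))) (t * s) =
          char (distr M borel (S m)) t" for m
        using s(1) by (simp add: char_distr S_def real_sqrt_mult mult_ac)
      moreover have "char std_normal_distribution (t * s) = char (normal_law 0 v) t"
        unfolding char_normal_law[OF v] char_std_normal_distribution
        by (simp add: power_mult_distrib s(2) mult.commute)
      ultimately show ?thesis by simp
    qed
  qed simp
  then show ?thesis by (simp add: S_def[abs_def])
qed

text \<open>Condition on \<open>X\<close>: the factor \<open>1 / \<pi>\<close> is a function of
  \<open>X\<close>, conditional independence splits the probability of \<open>C = 1\<close> and
  \<open>Y \<in> T\<close>, and the propensity cancels \<open>\<pi>\<close>. The full sets give mean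
  one of the weights, lower orthants give \<open>F0\<close>, and sets of \<open>x\<close> with
  \<open>T = UNIV\<close> give \<open>F0f\<close>.\<close>

lemma inverse_probability_weighting:
  fixes Q :: "((real ^ 'd::finite) \<times> real \<times> real) measure"
  assumes Q: "prob_space Q" "sets Q = sets borel"
    and C: "AE (x, c, y) in Q. c \<in> {0, 1}" and propensity: "is_propensity Q \<pi>"
    and ci: "cond_indep_vars Q (vimage_algebra (space Q) fst borel) (\<lambda>(x, c, y). c) (\<lambda>(x, c, y). y)"
    and \<epsilon>: "0 < \<epsilon>" "AE (x, c, y) in Q. \<epsilon> < \<pi> x"
    and A [measurable]: "A \<in> sets borel" and T [measurable]: "T \<in> sets borel"
  shows "(\<integral>(x, c, y). c / \<pi> x * (indicator A x * indicator T y) \<partial>Q) = measure Q {(x, c, y). x \<in> A \<and> y \<in> T}"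
proof -
  interpret Q: prob_space Q by fact
  note [measurable_cong] = Q(2)
  have [simp]: "space Q = UNIV" using sets_eq_imp_space_eq[OF Q(2)] by simp
  have \<pi> [measurable]: "\<pi> \<in> borel_measurable borel" using propensity by (simp add: is_propensity_def)
  define G where "G = vimage_algebra (space Q) (fst :: (real ^ 'd) \<times> real \<times> real \<Rightarrow> _) borel"
  have proj [measurable]: "fst \<in> Q \<rightarrow>\<^sub>M borel" "(\<lambda>z. fst (snd z)) \<in> Q \<rightarrow>\<^sub>M borel" "(\<lambda>z. snd (snd z)) \<in> Q \<rightarrow>\<^sub>M borel"
    by (auto simp: measurable_cong_sets[OF Q(2) refl] intro!: borel_measurable_continuous_onI continuous_intros)
  have "subalgebra Q G"
    unfolding subalgebra_def G_def using proj(1)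
    by (auto simp: sets_vimage_algebra2 measurable_def)
  then interpret finite_measure_subalgebra Q G by unfold_locales
  have fst_G [measurable]: "fst \<in> G \<rightarrow>\<^sub>M borel"
    unfolding G_def by (rule measurable_vimage_algebra1) simp
  define h where "h z = indicator A (fst z) / \<pi> (fst z)" for z :: "(real ^ 'd) \<times> real \<times> real"
  have h_G [measurable]: "h \<in> borel_measurable G" unfolding h_def by measurable
  have h_Q [measurable]: "h \<in> borel_measurable Q" unfolding h_def by measurable
  define E1 where "E1 = {z :: (real ^ 'd) \<times> real \<times> real. fst (snd z) = 1}"
  define E2 where "E2 = {z :: (real ^ 'd) \<times> real \<times> real. snd (snd z) \<in> T}"
  have E_meas [measurable]: "E1 \<in> sets Q" "E2 \<in> sets Q"
  proof -
    have "{z \<in> space Q. fst (snd z) = 1} \<in> sets Q" by measurable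
    then show "E1 \<in> sets Q" by (simp add: E1_def)
    have "{z \<in> space Q. snd (snd z) \<in> T} \<in> sets Q" by measurable
    then show "E2 \<in> sets Q" by (simp add: E2_def)
  qed
  have \<pi>_pos: "AE z in Q. \<epsilon> < \<pi> (fst z)" using \<epsilon>(2) by (simp add: case_prod_beta')
  have h_bd: "AE z in Q. \<bar>h z\<bar> \<le> 1 / \<epsilon>"
    using \<pi>_pos
  proof eventually_elim
    case (elim z)
    then show ?case using \<epsilon>(1) by (auto simp: h_def indicator_def field_simps)
  qed
  have h_int: "integrable Q (\<lambda>z. h z * indicator E z)" if [measurable]: "E \<in> sets Q" for E
  proof (rule Q.integrable_const_bound[where B = "1 / \<epsilon>"])
    show "AE z in Q. norm (h z * indicator E z) \<le> 1 / \<epsilon>"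
      using h_bd by eventually_elim (use \<epsilon>(1) in \<open>auto simp: indicator_def\<close>)
  qed measurable
  have ce1: "AE z in Q. real_cond_exp Q G (indicator E1) z = \<pi> (fst z)"
    using propensity by (simp add: is_propensity_def G_def E1_def case_prod_beta')
  have ce12: "AE z in Q. real_cond_exp Q G (indicator (E1 \<inter> E2)) z =
      real_cond_exp Q G (indicator E1) z * real_cond_exp Q G (indicator E2) z"
  proof -
    have "{w \<in> space Q. (\<lambda>(x, c, y). c) w \<in> {1} \<and> (\<lambda>(x, c, y). y) w \<in> T} = E1 \<inter> E2"
      "{w \<in> space Q. (\<lambda>(x, c, y). c) w \<in> {1}} = E1" "{w \<in> space Q. (\<lambda>(x, c, y). y) w \<in> T} = E2"
      by (auto simp: E1_def E2_def)
    with ci[unfolded cond_indep_vars_def, rule_format, of "{1}" T] show ?thesis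
      by (simp add: G_def)
  qed
  have "(\<integral>(x, c, y). c / \<pi> x * (indicator A x * indicator T y) \<partial>Q) = (\<integral>z. h z * indicator (E1 \<inter> E2) z \<partial>Q)"
  proof (rule integral_cong_AE)
    have "(\<lambda>z. fst (snd z) / \<pi> (fst z) * (indicator A (fst z) * indicator T (snd (snd z)))) \<in> borel_measurable Q"
      by measurable
    then show "(\<lambda>(x, c, y). c / \<pi> x * (indicator A x * indicator T y)) \<in> borel_measurable Q"
      by (simp add: case_prod_beta')
    \<comment> \<open>Since \<open>c\<close> is 0 or 1, it equals the indicator of
      \<open>c = 1\<close>, which turns the integrand into \<open>h\<close> times the indicator of
      an event.\<close>
    show "AE z in Q. (case z of (x, c, y) \<Rightarrow> c / \<pi> x * (indicator A x * indicator T y)) =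
        h z * indicator (E1 \<inter> E2) z"
      using C by eventually_elim (auto simp: h_def E1_def E2_def indicator_def)
  qed measurable
  also have "\<dots> = (\<integral>z. h z * real_cond_exp Q G (indicator (E1 \<inter> E2)) z \<partial>Q)"
    by (rule real_cond_exp_intg(2)[symmetric]) (auto intro!: h_int)
  also have "\<dots> = (\<integral>z. indicator A (fst z) * real_cond_exp Q G (indicator E2) z \<partial>Q)"
  proof (rule integral_cong_AE)
    show "AE z in Q. h z * real_cond_exp Q G (indicator (E1 \<inter> E2)) z =
        indicator A (fst z) * real_cond_exp Q G (indicator E2) z"
      using ce1 ce12 \<pi>_pos by eventually_elim (use \<epsilon>(1) in \<open>auto simp: h_def\<close>)
  qed measurable
  also have "\<dots> = (\<integral>z. indicator A (fst z) * indicator E2 z \<partial>Q)"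
  proof (rule real_cond_exp_intg(2))
    show "integrable Q (\<lambda>z. indicator A (fst z) * indicator E2 z :: real)"
      by (rule Q.integrable_const_bound[where B = 1]) (auto simp: indicator_def)
  qed measurable
  also have "\<dots> = (\<integral>z. indicator {(x, c, y). x \<in> A \<and> y \<in> T} z \<partial>Q)"
    by (rule Bochner_Integration.integral_cong) (auto simp: E2_def indicator_def)
  also have "\<dots> = measure Q {(x, c, y). x \<in> A \<and> y \<in> T}" by simp
  finally show ?thesis .
qed

section \<open>Control variates\<close>

text \<open>Replacing the estimated coefficient by \<open>\<omega>\<close> costs
  \<open>(om m - \<omega>) * (S2 - S3)\<close>, a small factor times a bounded one; here the
  boundedness in \<open>tight_expansion\<close> is used. The four exceptional events get
  \<open>\<delta> / 4\<close> each.\<close>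

lemma (in prob_space) tight_expansion_control_variate:
  assumes E1: "tight_expansion M T1 S1" and E2: "tight_expansion M T2 S2" and E3: "tight_expansion M T3 S3"
    and om [measurable]: "\<And>m. om m \<in> borel_measurable M" and conv: "conv_in_prob M om \<omega>"
    and \<delta>: "0 < \<delta>" and \<kappa>: "0 < \<kappa>"
  shows "\<forall>\<^sub>F m in sequentially. \<exists>A\<in>events. prob A \<ge> 1 - \<delta> \<and>
    (\<forall>w\<in>A. \<bar>(T1 m w + om m w * (T2 m w - T3 m w)) - (S1 m w + \<omega> * (S2 m w - S3 m w))\<bar> \<le> \<kappa>)"
proof -
  have \<delta>4: "0 < \<delta> / 4" using \<delta> by simp
  obtain A1 R1 where A1: "\<forall>m. A1 m \<in> events" "\<forall>\<^sub>F m in sequentially. prob (A1 m) \<ge> 1 - \<delta> / 4"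
    "\<forall>\<kappa>>0. \<forall>\<^sub>F m in sequentially. \<forall>w\<in>A1 m. \<bar>T1 m w - S1 m w\<bar> \<le> \<kappa>"
    using E1[unfolded tight_expansion_def, rule_format, OF \<delta>4] by auto
  obtain A2 R2 where A2: "\<forall>m. A2 m \<in> events" "\<forall>\<^sub>F m in sequentially. prob (A2 m) \<ge> 1 - \<delta> / 4"
    "\<forall>\<kappa>>0. \<forall>\<^sub>F m in sequentially. \<forall>w\<in>A2 m. \<bar>T2 m w - S2 m w\<bar> \<le> \<kappa>"
    "\<forall>\<^sub>F m in sequentially. \<forall>w\<in>A2 m. \<bar>S2 m w\<bar> \<le> R2"
    using E2[unfolded tight_expansion_def, rule_format, OF \<delta>4] by auto
  obtain A3 R3 where A3: "\<forall>m. A3 m \<in> events" "\<forall>\<^sub>F m in sequentially. prob (A3 m) \<ge> 1 - \<delta> / 4"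
    "\<forall>\<kappa>>0. \<forall>\<^sub>F m in sequentially. \<forall>w\<in>A3 m. \<bar>T3 m w - S3 m w\<bar> \<le> \<kappa>"
    "\<forall>\<^sub>F m in sequentially. \<forall>w\<in>A3 m. \<bar>S3 m w\<bar> \<le> R3"
    using E3[unfolded tight_expansion_def, rule_format, OF \<delta>4] by auto
  \<comment> \<open>\<open>D\<close> adds up the coefficients of \<open>e\<close> in the final
    estimate: 1 from the first expansion, \<open>2 * (\<bar>\<omega>\<bar> + 1)\<close> from the
    other two, the rest from replacing the coefficient. The cap \<open>e \<le> 1\<close> yields
    \<open>\<bar>om m w\<bar> \<le> \<bar>\<omega>\<bar> + 1\<close>.\<close>
  define D where "D = 1 + 2 * (\<bar>\<omega>\<bar> + 1) + (\<bar>R2\<bar> + \<bar>R3\<bar>)"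
  have D: "0 < D" by (simp add: D_def add_pos_nonneg)
  define e where "e = min 1 (\<kappa> / D)"
  have e: "0 < e" "e \<le> 1" "e * D \<le> \<kappa>"
    using \<kappa> D by (auto simp: e_def min_def field_simps)
  define A4 where "A4 m = {w \<in> space M. \<bar>om m w - \<omega>\<bar> > e}" for m
  have A4 [measurable]: "A4 m \<in> events" for m unfolding A4_def by measurable
  have "(\<lambda>m. prob (A4 m)) \<longlonglongrightarrow> 0" using conv e(1) by (simp add: conv_in_prob_def A4_def)
  then have "\<forall>\<^sub>F m in sequentially. prob (A4 m) < \<delta> / 4"
    by (rule order_tendstoD(2)) (rule \<delta>4)
  with A1(2) A2(2) A3(2) A1(3)[rule_format, OF e(1)] A2(3)[rule_format, OF e(1)] A3(3)[rule_format, OF e(1)]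
    A2(4) A3(4)
  show ?thesis
  proof eventually_elim
    case (elim m)
    define A where "A = A1 m \<inter> A2 m \<inter> A3 m - A4 m"
    have ev: "A1 m \<in> events" "A2 m \<in> events" "A3 m \<in> events" using A1(1) A2(1) A3(1) by auto
    have A: "A \<in> events" using ev A4 by (auto simp: A_def)
    have "prob (space M - A) \<le> prob ((space M - A1 m) \<union> ((space M - A2 m) \<union> ((space M - A3 m) \<union> A4 m)))"
      using ev A4 by (intro finite_measure_mono) (auto simp: A_def)
    also have "\<dots> \<le> prob (space M - A1 m) + (prob (space M - A2 m) + (prob (space M - A3 m) + prob (A4 m)))"
      using ev A4 by (intro order_trans[OF measure_Un_le] add_left_mono sets.Un sets.compl_sets) auto
    also have "\<dots> \<le> \<delta>" using elim(1-3) elim(9) ev by (simp add: prob_compl)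
    finally have "1 - \<delta> \<le> prob A" using prob_compl[OF A] by simp
    moreover have "\<bar>(T1 m w + om m w * (T2 m w - T3 m w)) - (S1 m w + \<omega> * (S2 m w - S3 m w))\<bar> \<le> \<kappa>"
      if w: "w \<in> A" for w
    proof -
      have "w \<in> space M" using w sets.sets_into_space[OF A] by auto
      then have om_w: "\<bar>om m w - \<omega>\<bar> \<le> e" using w by (auto simp: A_def A4_def)
      define x where "x = T1 m w - S1 m w"
      define y where "y = (T2 m w - S2 m w) - (T3 m w - S3 m w)"
      have x: "\<bar>x\<bar> \<le> e" using elim w by (auto simp: x_def A_def)
      have "\<bar>T2 m w - S2 m w\<bar> \<le> e" "\<bar>T3 m w - S3 m w\<bar> \<le> e" using elim w by (auto simp: A_def)
      then have y: "\<bar>y\<bar> \<le> 2 * e" unfolding y_def by linarith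
      have "\<bar>S2 m w\<bar> \<le> R2" "\<bar>S3 m w\<bar> \<le> R3" using elim w by (auto simp: A_def)
      then have S: "\<bar>S2 m w - S3 m w\<bar> \<le> \<bar>R2\<bar> + \<bar>R3\<bar>" by linarith
      have om_bd: "\<bar>om m w\<bar> \<le> \<bar>\<omega>\<bar> + 1" using om_w e(2) by linarith
      have "(T1 m w + om m w * (T2 m w - T3 m w)) - (S1 m w + \<omega> * (S2 m w - S3 m w)) =
          x + om m w * y + (om m w - \<omega>) * (S2 m w - S3 m w)"
        by (simp add: x_def y_def algebra_simps)
      also have "\<bar>\<dots>\<bar> \<le> \<bar>x\<bar> + \<bar>om m w * y\<bar> + \<bar>(om m w - \<omega>) * (S2 m w - S3 m w)\<bar>" by linarith
      also have "\<dots> \<le> e + (\<bar>\<omega>\<bar> + 1) * (2 * e) + e * (\<bar>R2\<bar> + \<bar>R3\<bar>)"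
        unfolding abs_mult using x y S om_bd om_w by (intro add_mono mult_mono) auto
      also have "\<dots> = e * D" by (simp add: D_def algebra_simps)
      also have "\<dots> \<le> \<kappa>" by (rule e(3))
      finally show ?thesis .
    qed
    ultimately show ?case using A by blast
  qed
qed

text \<open>The second moment of \<open>a + \<omega> * b\<close> is a quadratic in the coefficient,
  and \<open>\<omega> = - c / v\<close> is its minimiser. The covariance is written with
  \<open>- b\<close> because the coefficient is given through \<open>C / \<pi> - 1\<close> and the
  correction through \<open>1 - C / \<pi>\<close>.\<close>

lemma (in prob_space) control_variate_variance:
  fixes a b :: "'a \<Rightarrow> real"
  assumes int: "integrable M (\<lambda>w. (a w)\<^sup>2)" "integrable M (\<lambda>w. (b w)\<^sup>2)" "integrable M (\<lambda>w. a w * b w)"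
    and mean: "expectation a = 0" "expectation b = 0"
    and V: "0 < variance b"
  defines "\<omega> \<equiv> covariance M a (\<lambda>w. - b w) / variance b"
  shows "expectation (\<lambda>w. (a w + \<omega> * b w)\<^sup>2) = variance a - (covariance M a b)\<^sup>2 / variance b"
proof -
  define c where "c = expectation (\<lambda>w. a w * b w)"
  define v where "v = expectation (\<lambda>w. (b w)\<^sup>2)"
  have var: "variance a = expectation (\<lambda>w. (a w)\<^sup>2)" "variance b = v" by (simp_all add: mean v_def)
  have cov: "covariance M a b = c" "covariance M a (\<lambda>w. - b w) = - c"
    by (simp_all add: covariance_def mean c_def)
  have \<omega>: "\<omega> = - c / v" by (simp add: \<omega>_def var cov)
  have "expectation (\<lambda>w. (a w + \<omega> * b w)\<^sup>2) =
      expectation (\<lambda>w. (a w)\<^sup>2 + 2 * \<omega> * (a w * b w) + \<omega>\<^sup>2 * (b w)\<^sup>2)"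
    by (rule Bochner_Integration.integral_cong) (auto simp: power2_eq_square algebra_simps)
  also have "\<dots> = expectation (\<lambda>w. (a w)\<^sup>2) + 2 * \<omega> * c + \<omega>\<^sup>2 * v"
    using int by (simp add: c_def v_def)
  also have "\<dots> = expectation (\<lambda>w. (a w)\<^sup>2) - c\<^sup>2 / v"
    using V by (simp add: \<omega> var power2_eq_square field_simps)
  finally show ?thesis by (simp add: var cov)
qed

lemma weighted_sample_of_iid:
  fixes V :: "nat \<Rightarrow> 'a \<Rightarrow> 'o::topological_space" and z :: "'o \<Rightarrow> 'b::ordered_euclidean_space"
  assumes M: "prob_space M" and indep: "prob_space.indep_vars M (\<lambda>_. borel) V UNIV"
    and distr: "\<And>i. distr M borel (V i) = Q"
    and k [measurable]: "k \<in> borel_measurable borel" and z [measurable]: "z \<in> borel_measurable borel"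
    and bounds: "AE x in Q. 0 \<le> k x \<and> k x \<le> B" and mean: "(\<integral>x. k x \<partial>Q) = 1"
  shows "weighted_sample M (\<lambda>i w. k (V i w)) (\<lambda>i w. z (V i w)) B"
proof -
  interpret prob_space M by fact
  have V [measurable]: "V i \<in> borel_measurable M" for i using indep by (simp add: indep_vars_def)
  have kz: "(\<lambda>x. (k x, z x)) \<in> borel_measurable borel"
    by (rule borel_measurable_Pair) measurable
  show ?thesis
  proof
    show "indep_vars (\<lambda>_. borel) (\<lambda>i w. (k (V i w), z (V i w))) UNIV"
      by (rule indep_vars_compose2[OF indep kz])
    have "distr M borel (\<lambda>w. (k (V i w), z (V i w))) = distr Q borel (\<lambda>x. (k x, z x))" for i
      using distr_distr[OF kz V[of i]] by (simp add: distr o_def)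
    then show "distr M borel (\<lambda>w. (k (V i w), z (V i w))) = distr M borel (\<lambda>w. (k (V 0 w), z (V 0 w)))" for i
      by simp
    have "AE x in distr M borel (V 0). 0 \<le> k x \<and> k x \<le> B" using bounds by (simp only: distr)
    then show "AE w in M. 0 \<le> k (V 0 w) \<and> k (V 0 w) \<le> B"
      by (subst (asm) AE_distr_iff) auto
    have "(\<integral>x. k x \<partial>distr M borel (V 0)) = 1" using mean by (simp only: distr)
    then show "expectation (\<lambda>w. k (V 0 w)) = 1" by (simp add: integral_distr)
  qed
qed

text \<open>One statement for all three estimators: \<open>k\<close> is the weight and
  \<open>z\<close> the point taken from an observation. \<open>F\<close> is characterised by an
  integral, so weighted and unweighted predictions can share it.\<close>

lemma plug_in_of_iid:
  fixes obs :: "nat \<Rightarrow> 'a \<Rightarrow> 'o::topological_space" and z :: "'o \<Rightarrow> (real ^ 'd::finite) \<times> real"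
    and F :: "(real ^ 'd) \<times> real \<Rightarrow> real"
  assumes M: "prob_space M" and indep: "prob_space.indep_vars M (\<lambda>_. borel) obs UNIV"
    and distr: "\<And>i. distr M borel (obs i) = Q"
    and k [measurable]: "k \<in> borel_measurable borel" and z [measurable]: "z \<in> borel_measurable borel"
    and bounds: "AE x in Q. 0 \<le> k x \<and> k x \<le> B" and mean: "(\<integral>x. k x \<partial>Q) = 1"
    and F: "\<And>u. (\<integral>x. k x * indicator {..u} (z x) \<partial>Q) = F u"
    and had: "has_hadamard_derivative_on \<Phi> (d\<Phi> F) F cdfs"
  shows "tight_expansion M
      (\<lambda>m w. sqrt (real m) * (\<Phi> (weighted_ecdf m (\<lambda>i. k (obs i w)) (\<lambda>i. z (obs i w))) - \<Phi> F))
      (\<lambda>m w. (\<Sum>i<m. k (obs i w) * influence d\<Phi> F (z (obs i w))) / sqrt (real m))"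
    and "influence d\<Phi> F \<in> borel_measurable borel"
    and "\<exists>K. \<forall>z. \<bar>influence d\<Phi> F z\<bar> \<le> K"
    and "(\<integral>x. k x * influence d\<Phi> F (z x) \<partial>Q) = 0"
proof -
  interpret M: prob_space M by fact
  have obs [measurable]: "obs i \<in> borel_measurable M" for i using indep by (simp add: M.indep_vars_def)
  have E: "(\<integral>w. g (obs 0 w) \<partial>M) = (\<integral>x. g x \<partial>Q)" if [measurable]: "g \<in> borel_measurable borel" for g :: "'o \<Rightarrow> real"
    unfolding distr[of 0, symmetric] by (simp add: integral_distr)
  interpret S: weighted_sample M "\<lambda>i w. k (obs i w)" "\<lambda>i w. z (obs i w)" B
    by (rule weighted_sample_of_iid[OF M indep distr k z bounds mean])
  have "S.mass {..u} = F u" for u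
    unfolding S.mass_def F[symmetric] by (rule E) measurable
  then have mass: "(\<lambda>u. S.mass {..u}) = F" by (rule ext)
  have ncdf: "S.ncdf m w = weighted_ecdf m (\<lambda>i. k (obs i w)) (\<lambda>i. z (obs i w))" for m w
    by (simp add: fun_eq_iff S.ncdf_def S.wsum_def weighted_ecdf_def point_cdf_eq)
  interpret P: plug_in M "\<lambda>i w. k (obs i w)" "\<lambda>i w. z (obs i w)" B \<Phi> "d\<Phi> F" cdfs
  proof
    show "has_hadamard_derivative_on \<Phi> (d\<Phi> F) (\<lambda>u. S.mass {..u}) cdfs"
      unfolding mass by (rule had)
    show "S.ncdf m w \<in> cdfs" if "\<And>i. i < m \<Longrightarrow> 0 \<le> k (obs i w)" "0 < S.wsum m w" for m w
      unfolding ncdf using that by (intro weighted_ecdf_in_cdfs) (auto simp: S.wsum_def)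
  qed
  have infl: "P.infl = influence d\<Phi> F"
    by (simp add: fun_eq_iff P.infl_def influence_def point_cdf_eq fun_cong[OF mass])
  show "tight_expansion M
      (\<lambda>m w. sqrt (real m) * (\<Phi> (weighted_ecdf m (\<lambda>i. k (obs i w)) (\<lambda>i. z (obs i w))) - \<Phi> F))
      (\<lambda>m w. (\<Sum>i<m. k (obs i w) * influence d\<Phi> F (z (obs i w))) / sqrt (real m))"
    using P.asymptotically_linear by (simp only: ncdf mass P.lin_def[abs_def] infl)
  show [measurable]: "influence d\<Phi> F \<in> borel_measurable borel"
    using P.infl_measurable by (simp only: infl)
  show "\<exists>K. \<forall>z. \<bar>influence d\<Phi> F z\<bar> \<le> K"
    using P.infl_bound unfolding infl by (intro exI allI)
  have "(\<integral>x. k x * influence d\<Phi> F (z x) \<partial>Q) = (\<integral>w. k (obs 0 w) * influence d\<Phi> F (z (obs 0 w)) \<partial>M)"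
    by (rule E[symmetric]) measurable
  also have "\<dots> = 0" using P.infl_mean_zero by (simp only: infl)
  finally show "(\<integral>x. k x * influence d\<Phi> F (z x) \<partial>Q) = 0" .
qed

section \<open>Asymptotic normality of the estimator with control variate\<close>

theorem theorem3p1:
  fixes M :: "'a measure"
    and Q :: "((real ^ 'd::finite) \<times> real \<times> real) measure"
    and X :: "nat \<Rightarrow> 'a \<Rightarrow> real ^ 'd"
    and C Y :: "nat \<Rightarrow> 'a \<Rightarrow> real"
    and \<pi> f :: "real ^ 'd \<Rightarrow> real"
    and \<epsilon> :: real
    and \<Phi> :: "((real ^ 'd) \<times> real \<Rightarrow> real) \<Rightarrow> real"
    and d\<Phi> :: "((real ^ 'd) \<times> real \<Rightarrow> real) \<Rightarrow> ((real ^ 'd) \<times> real \<Rightarrow> real) \<Rightarrow> real"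
    and omega_hat :: "nat \<Rightarrow> 'a \<Rightarrow> real"
  defines "F0 \<equiv> full_cdf Q"
    and "F0f \<equiv> pred_cdf Q f"
  defines "\<phi> \<equiv> (\<lambda>x y. influence d\<Phi> F0 (x, y))"
    and "\<phi>f \<equiv> (\<lambda>x. influence d\<Phi> F0f (x, f x))"
    and "theta0 \<equiv> \<Phi> F0"
    and "theta_ipw \<equiv>
      (\<lambda>m w. \<Phi> (weighted_ecdf m (\<lambda>i. C i w / \<pi> (X i w)) (\<lambda>i. (X i w, Y i w))))"
    and "thetaf_ipw \<equiv>
      (\<lambda>m w. \<Phi> (weighted_ecdf m (\<lambda>i. C i w / \<pi> (X i w)) (\<lambda>i. (X i w, f (X i w)))))"
    and "thetaf \<equiv> (\<lambda>m w. \<Phi> (ecdf m (\<lambda>i. (X i w, f (X i w)))))"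
  defines "theta_hat \<equiv>
      (\<lambda>m w. theta_ipw m w + omega_hat m w * (thetaf m w - thetaf_ipw m w))"
    and "V \<equiv> prob_space.variance Q (\<lambda>(x, c, y). (1 - c / \<pi> x) * \<phi>f x)"
  defines "\<omega> \<equiv> covariance Q (\<lambda>(x, c, y). c / \<pi> x * \<phi> x y)
                         (\<lambda>(x, c, y). (c / \<pi> x - 1) * \<phi>f x) / V"
    and "\<sigma>2 \<equiv> prob_space.variance Q (\<lambda>(x, c, y). c / \<pi> x * \<phi> x y) -
                 (covariance Q (\<lambda>(x, c, y). c / \<pi> x * \<phi> x y)
                               (\<lambda>(x, c, y). (1 - c / \<pi> x) * \<phi>f x))\<^sup>2 / V"
  assumes "prob_space M"
    and "prob_space.indep_vars M (\<lambda>_. borel) (\<lambda>i w. (X i w, C i w, Y i w)) UNIV"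
    and "\<And>i. distr M borel (\<lambda>w. (X i w, C i w, Y i w)) = Q"
    and "AE (x, c, y) in Q. c \<in> {0, 1}"
    and "f \<in> borel_measurable borel"
    and "is_propensity Q \<pi>"
    and "cond_indep_vars Q (vimage_algebra (space Q) fst borel)
           (\<lambda>(x, c, y). c) (\<lambda>(x, c, y). y)"
    and "0 < \<epsilon>" and "AE (x, c, y) in Q. \<epsilon> < \<pi> x \<and> \<pi> x < 1 - \<epsilon>"
    and "has_hadamard_derivative_on \<Phi> (d\<Phi> F0) F0 cdfs"
    and "has_hadamard_derivative_on \<Phi> (d\<Phi> F0f) F0f cdfs"
    and "0 < V"
    and "\<And>m. omega_hat m \<in> borel_measurable M"
    and "\<And>m. theta_hat m \<in> borel_measurable M"
    and "conv_in_prob M omega_hat \<omega>"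
  shows "weak_conv_m
           (\<lambda>m. distr M borel (\<lambda>w. sqrt (real m) * (theta_hat m w - theta0)))
           (normal_law 0 \<sigma>2)"
proof -
  note indep = assms(14) and distr = assms(15) and C01 = assms(16) and f_meas [measurable] = assms(17)
    and propensity = assms(18) and cond_indep = assms(19) and \<epsilon> = assms(20) and \<pi>_bounds = assms(21)
    and had = assms(22) and hadf = assms(23) and V_pos = assms(24) and omega_meas = assms(25)
    and theta_meas = assms(26) and omega_conv = assms(27)
  interpret M: prob_space M by (rule assms(13))
  define obs where "obs i w = (X i w, C i w, Y i w)" for i w
  have indep_obs: "M.indep_vars (\<lambda>_. borel) obs UNIV"
    using indep by (simp add: obs_def[abs_def])
  have distr_obs: "distr M borel (obs i) = Q" for i
    using distr[of i] by (simp add: obs_def[abs_def])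
  have obs [measurable]: "obs i \<in> borel_measurable M" for i
    using indep_obs by (simp add: M.indep_vars_def)
  have sets_Q: "sets Q = sets borel" by (simp flip: distr_obs[of 0])
  note [measurable_cong] = sets_Q
  have prob_Q: "prob_space Q"
    unfolding distr_obs[of 0, symmetric] by (rule M.prob_space_distr) measurable
  interpret Q: prob_space Q by (rule prob_Q)
  have [measurable]: "\<pi> \<in> borel_measurable borel" using propensity by (simp add: is_propensity_def)
  define k where "k p = fst (snd p) / \<pi> (fst p)" for p :: "(real ^ 'd) \<times> real \<times> real"
  define z1 where "z1 p = (fst p, snd (snd p))" for p :: "(real ^ 'd) \<times> real \<times> real"
  define z2 where "z2 p = (fst p, f (fst p))" for p :: "(real ^ 'd) \<times> real \<times> real"
  have proj [measurable]: "(\<lambda>p :: (real ^ 'd) \<times> real \<times> real. fst p) \<in> borel \<rightarrow>\<^sub>M borel"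
    "(\<lambda>p :: (real ^ 'd) \<times> real \<times> real. fst (snd p)) \<in> borel \<rightarrow>\<^sub>M borel"
    "(\<lambda>p :: (real ^ 'd) \<times> real \<times> real. snd (snd p)) \<in> borel \<rightarrow>\<^sub>M borel"
    by (auto intro!: borel_measurable_continuous_onI continuous_intros)
  have k_meas [measurable]: "k \<in> borel_measurable borel" unfolding k_def by measurable
  have z1_meas [measurable]: "z1 \<in> borel_measurable borel" unfolding z1_def by (rule borel_measurable_Pair) measurable
  have z2_meas [measurable]: "z2 \<in> borel_measurable borel" unfolding z2_def by (rule borel_measurable_Pair) measurable
  have k_bounds: "AE p in Q. 0 \<le> k p \<and> k p \<le> 1 / \<epsilon>"
    using C01 \<pi>_bounds
  proof eventually_elim
    case (elim p)
    then show ?case using \<epsilon> by (auto simp: k_def case_prod_beta' frac_le)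
  qed
  have "AE (x, c, y) in Q. \<epsilon> < \<pi> x" using \<pi>_bounds by eventually_elim auto
  note ipw_raw = inverse_probability_weighting[OF prob_Q sets_Q C01 propensity cond_indep \<epsilon> this]
  have ipw: "(\<integral>p. k p * (indicator A (fst p) * indicator T (snd (snd p))) \<partial>Q) =
      measure Q {(x, c, y). x \<in> A \<and> y \<in> T}" if "A \<in> sets borel" "T \<in> sets borel" for A T
    using ipw_raw[OF that] by (simp add: k_def case_prod_beta')
  have k_mean: "(\<integral>p. k p \<partial>Q) = 1"
  proof -
    have "space Q = UNIV" using sets_eq_imp_space_eq[OF sets_Q] by simp
    moreover have "{(x, c, y). x \<in> UNIV \<and> y \<in> UNIV} = (UNIV :: ((real ^ 'd) \<times> real \<times> real) set)" by auto
    ultimately show ?thesis using ipw[of UNIV UNIV] Q.prob_space by (simp del: UNIV_I)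
  qed
  have F0_ipw: "(\<integral>p. k p * indicator {..u} (z1 p) \<partial>Q) = F0 u" for u
  proof (cases u)
    case (Pair x y)
    have "indicator {..u} (z1 p) = (indicator {..x} (fst p) * indicator {..y} (snd (snd p)) :: real)" for p
      by (auto simp: Pair z1_def indicator_def less_eq_prod_def)
    then show ?thesis using ipw[of "{..x}" "{..y}"] by (simp add: F0_def full_cdf_def Pair)
  qed
  have F_meas: "{x'. x' \<le> x \<and> f x' \<le> y} \<in> sets borel" for x y
  proof -
    have "{x' \<in> space borel. x' \<in> {..x} \<and> f x' \<le> y} \<in> sets borel" by measurable
    then show ?thesis by simp
  qed
  have z2_ind: "indicator {..(x, y)} (z2 p) = (indicator {x'. x' \<le> x \<and> f x' \<le> y} (fst p) :: real)" for x y p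
    by (auto simp: z2_def indicator_def less_eq_prod_def)
  have F0f_ipw: "(\<integral>p. k p * indicator {..u} (z2 p) \<partial>Q) = F0f u" for u
  proof (cases u)
    case (Pair x y)
    show ?thesis using ipw[OF F_meas[of x y], of UNIV] by (simp add: Pair z2_ind F0f_def pred_cdf_def)
  qed
  have F0f_one: "(\<integral>p. 1 * indicator {..u} (z2 p) \<partial>Q) = F0f u" for u
  proof (cases u)
    case (Pair x y)
    have "(\<integral>p. (1 :: real) * indicator {..u} (z2 p) \<partial>Q) =
        (\<integral>p. indicator {(x', c', y'). x' \<le> x \<and> f x' \<le> y} p \<partial>Q)"
      by (rule Bochner_Integration.integral_cong) (auto simp: Pair z2_def indicator_def less_eq_prod_def)
    then show ?thesis
      using sets_eq_imp_space_eq[OF sets_Q] by (simp add: F0f_def pred_cdf_def Pair)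
  qed
  \<comment> \<open>Three instances: weighted outcomes, weighted predictions and, with
    \<open>k = 1\<close> and \<open>B = 1\<close>, unweighted predictions. The last two have the
    same limit \<open>F0f\<close> and hence the same influence function.\<close>
  note ipw1 = plug_in_of_iid[where d\<Phi> = d\<Phi> and F = F0, OF assms(13) indep_obs distr_obs k_meas z1_meas k_bounds k_mean F0_ipw had]
  note ipw2 = plug_in_of_iid[where d\<Phi> = d\<Phi> and F = F0f, OF assms(13) indep_obs distr_obs k_meas z2_meas k_bounds k_mean F0f_ipw hadf]
  have one_bounds: "AE p in Q. 0 \<le> (1 :: real) \<and> (1 :: real) \<le> 1" by simp
  have one_mean: "(\<integral>p. (1 :: real) \<partial>Q) = 1" by (simp add: Q.prob_space)
  note full = plug_in_of_iid[where d\<Phi> = d\<Phi> and F = F0f and k = "\<lambda>_. 1", OF assms(13) indep_obs distr_obs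
      borel_measurable_const z2_meas one_bounds one_mean F0f_one hadf]
  define \<phi>1 where "\<phi>1 = influence d\<Phi> F0"
  define \<phi>2 where "\<phi>2 = influence d\<Phi> F0f"
  have [measurable]: "\<phi>1 \<in> borel_measurable borel" "\<phi>2 \<in> borel_measurable borel"
    using ipw1(2) ipw2(2) by (simp_all add: \<phi>1_def \<phi>2_def)
  obtain K1 where K1: "\<And>z. \<bar>\<phi>1 z\<bar> \<le> K1" using ipw1(3) unfolding \<phi>1_def by auto
  obtain K2 where K2: "\<And>z. \<bar>\<phi>2 z\<bar> \<le> K2" using ipw2(3) unfolding \<phi>2_def by auto
  \<comment> \<open>\<open>a\<close> and \<open>b\<close> are the summands that represent
    \<open>theta_ipw\<close> and \<open>thetaf - thetaf_ipw\<close>; in \<open>b\<close> the weights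
    1 and \<open>k\<close> meet the same function \<open>\<phi>2\<close>.\<close>
  define a where "a p = k p * \<phi>1 (z1 p)" for p
  define b where "b p = (1 - k p) * \<phi>2 (z2 p)" for p
  have [measurable]: "a \<in> borel_measurable borel" "b \<in> borel_measurable borel"
    unfolding a_def[abs_def] b_def[abs_def] by measurable
  have a_eq: "(\<lambda>(x, c, y). c / \<pi> x * \<phi> x y) = a"
    by (auto simp: fun_eq_iff a_def k_def z1_def \<phi>1_def \<phi>_def)
  have b_eq: "(\<lambda>(x, c, y). (1 - c / \<pi> x) * \<phi>f x) = b"
    by (auto simp: fun_eq_iff b_def k_def z2_def \<phi>2_def \<phi>f_def)
  have minus_b_eq: "(\<lambda>(x, c, y). (c / \<pi> x - 1) * \<phi>f x) = (\<lambda>p. - b p)"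
    by (auto simp: fun_eq_iff b_def k_def z2_def \<phi>2_def \<phi>f_def algebra_simps)
  define K where "K = K1 / \<epsilon> + (1 + 1 / \<epsilon>) * K2"
  have K_nonneg: "0 \<le> K1" "0 \<le> K2" using order_trans[OF abs_ge_zero K1] order_trans[OF abs_ge_zero K2] by auto
  have ab_bd: "AE p in Q. \<bar>a p\<bar> \<le> K \<and> \<bar>b p\<bar> \<le> K"
    using k_bounds
  proof eventually_elim
    case (elim p)
    have "\<bar>a p\<bar> \<le> 1 / \<epsilon> * K1" unfolding a_def abs_mult using elim K1 \<epsilon> by (intro mult_mono) auto
    moreover have "\<bar>b p\<bar> \<le> (1 + 1 / \<epsilon>) * K2"
      unfolding b_def abs_mult using elim K2 \<epsilon> by (intro mult_mono) auto
    moreover have "0 \<le> 1 / \<epsilon> * K1" "0 \<le> (1 + 1 / \<epsilon>) * K2" using K_nonneg \<epsilon> by auto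
    moreover have "K = 1 / \<epsilon> * K1 + (1 + 1 / \<epsilon>) * K2" by (simp add: K_def)
    ultimately show ?case by linarith
  qed
  have int_prod: "integrable Q (\<lambda>p. g p * h p)"
    if [measurable]: "g \<in> borel_measurable borel" "h \<in> borel_measurable borel"
      and gh: "AE p in Q. \<bar>g p\<bar> \<le> K' \<and> \<bar>h p\<bar> \<le> K'" for g h :: "_ \<Rightarrow> real" and K'
  proof (rule Q.integrable_const_bound[where B = "K' * K'"])
    show "AE p in Q. norm (g p * h p) \<le> K' * K'"
      using gh
    proof eventually_elim
      case (elim p)
      then show ?case unfolding real_norm_def abs_mult by (intro mult_mono) auto
    qed
  qed measurable
  have int_a2: "integrable Q (\<lambda>p. (a p)\<^sup>2)" and int_b2: "integrable Q (\<lambda>p. (b p)\<^sup>2)"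
    and int_ab: "integrable Q (\<lambda>p. a p * b p)"
    using int_prod[of a a K] int_prod[of b b K] int_prod[of a b K] ab_bd by (simp_all add: power2_eq_square)
  have int_a: "integrable Q a" and int_b: "integrable Q b"
    using ab_bd by (auto intro!: Q.integrable_const_bound[where B = K])
  have mean_a: "Q.expectation a = 0" using ipw1(4) by (simp add: a_def[abs_def] \<phi>1_def)
  \<comment> \<open>\<open>\<phi>2\<close> has mean zero under the unit weights as well as under the
    weights \<open>k\<close>.\<close>
  have mean_b: "Q.expectation b = 0"
  proof -
    have 1: "integrable Q (\<lambda>p. \<phi>2 (z2 p))"
      by (rule Q.integrable_const_bound[where B = K2]) (use K2 in auto)
    have 2: "integrable Q (\<lambda>p. k p * \<phi>2 (z2 p))"
      using Bochner_Integration.integrable_diff[OF 1 int_b] by (simp add: b_def algebra_simps)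
    have "b = (\<lambda>p. \<phi>2 (z2 p) - k p * \<phi>2 (z2 p))" by (auto simp: b_def algebra_simps)
    then have "Q.expectation b = (\<integral>p. \<phi>2 (z2 p) \<partial>Q) - (\<integral>p. k p * \<phi>2 (z2 p) \<partial>Q)"
      using 1 2 by simp
    then show ?thesis using ipw2(4) full(4) by (simp add: \<phi>2_def)
  qed
  have V_eq: "V = Q.variance b" by (simp only: V_def b_eq)
  have \<omega>_eq: "\<omega> = covariance Q a (\<lambda>p. - b p) / Q.variance b" by (simp only: \<omega>_def a_eq minus_b_eq V_eq)
  have \<sigma>2_eq: "\<sigma>2 = Q.variance a - (covariance Q a b)\<^sup>2 / Q.variance b"
    by (simp only: \<sigma>2_def a_eq b_eq V_eq)
  define \<psi> where "\<psi> p = a p + \<omega> * b p" for p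
  have \<psi>_meas [measurable]: "\<psi> \<in> borel_measurable borel" unfolding \<psi>_def[abs_def] by measurable
  have \<psi>_sq: "(\<integral>p. (\<psi> p)\<^sup>2 \<partial>Q) = \<sigma>2"
    using Q.control_variate_variance[OF int_a2 int_b2 int_ab mean_a mean_b V_pos[unfolded V_eq]]
    by (simp only: \<psi>_def \<omega>_eq \<sigma>2_eq)
  have \<psi>_mean: "(\<integral>p. \<psi> p \<partial>Q) = 0"
    unfolding \<psi>_def[abs_def] using int_a int_b mean_a mean_b by simp
  have \<psi>_int: "integrable Q (\<lambda>p. (\<psi> p)\<^sup>2)"
  proof -
    have "(\<lambda>p. (\<psi> p)\<^sup>2) = (\<lambda>p. (a p)\<^sup>2 + 2 * \<omega> * (a p * b p) + \<omega>\<^sup>2 * (b p)\<^sup>2)"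
      by (auto simp: fun_eq_iff \<psi>_def power2_eq_square algebra_simps)
    then show ?thesis using int_a2 int_b2 int_ab by simp
  qed
  have E: "(\<integral>w. g (obs i w) \<partial>M) = (\<integral>p. g p \<partial>Q)" if [measurable]: "g \<in> borel_measurable borel"
    for g :: "_ \<Rightarrow> real" and i
    unfolding distr_obs[of i, symmetric] by (simp add: integral_distr)
  define S where "S m w = (\<Sum>i<m. \<psi> (obs i w)) / sqrt (real m)" for m w
  have S_meas: "S m \<in> borel_measurable M" for m unfolding S_def[abs_def] by measurable
  have clt: "weak_conv_m (\<lambda>m. distr M borel (S m)) (normal_law 0 \<sigma>2)"
    unfolding S_def[abs_def]
  proof (rule M.central_limit_theorem_normal_law)
    show "M.indep_vars (\<lambda>_. borel) (\<lambda>i w. \<psi> (obs i w)) UNIV"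
      by (rule M.indep_vars_compose2[OF indep_obs \<psi>_meas])
    show "M.expectation (\<lambda>w. \<psi> (obs n w)) = 0" for n by (simp add: E \<psi>_mean)
    show "M.expectation (\<lambda>w. (\<psi> (obs n w))\<^sup>2) = \<sigma>2" for n
      using E[of "\<lambda>p. (\<psi> p)\<^sup>2" n] by (simp add: \<psi>_sq)
    show "integrable M (\<lambda>w. (\<psi> (obs n w))\<^sup>2)" for n
      using \<psi>_int integrable_distr_eq[OF obs[of n], of "\<lambda>p. (\<psi> p)\<^sup>2"] by (simp add: distr_obs)
    show "distr M borel (\<lambda>w. \<psi> (obs n w)) = distr Q borel \<psi>" for n
      using distr_distr[OF \<psi>_meas obs[of n]] by (simp add: distr_obs o_def)
  qed
  have \<sigma>2_nonneg: "0 \<le> \<sigma>2" unfolding \<psi>_sq[symmetric] by simp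
  define T1 where "T1 m w = sqrt (real m) * (theta_ipw m w - theta0)" for m w
  \<comment> \<open>Centring both prediction estimators at \<open>\<Phi> F0f\<close> cancels in
    their difference and gives each of them an expansion of its own.\<close>
  define T2 where "T2 m w = sqrt (real m) * (thetaf m w - \<Phi> F0f)" for m w
  define T3 where "T3 m w = sqrt (real m) * (thetaf_ipw m w - \<Phi> F0f)" for m w
  define S1 where "S1 m w = (\<Sum>i<m. k (obs i w) * \<phi>1 (z1 (obs i w))) / sqrt (real m)" for m w
  define S2 where "S2 m w = (\<Sum>i<m. 1 * \<phi>2 (z2 (obs i w))) / sqrt (real m)" for m w
  define S3 where "S3 m w = (\<Sum>i<m. k (obs i w) * \<phi>2 (z2 (obs i w))) / sqrt (real m)" for m w
  have k_obs: "k (obs i w) = C i w / \<pi> (X i w)" for i w by (simp add: k_def obs_def)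
  have z_obs: "z1 (obs i w) = (X i w, Y i w)" "z2 (obs i w) = (X i w, f (X i w))" for i w
    by (simp_all add: z1_def z2_def obs_def)
  have ecdf: "ecdf m z = weighted_ecdf m (\<lambda>i. 1) z" for m and z :: "nat \<Rightarrow> (real ^ 'd) \<times> real"
    by (simp add: fun_eq_iff ecdf_def weighted_ecdf_def)
  have T1: "tight_expansion M T1 S1"
    using ipw1(1) by (simp only: T1_def[abs_def] S1_def[abs_def] theta_ipw_def theta0_def k_obs z_obs \<phi>1_def)
  have T2: "tight_expansion M T2 S2"
    using full(1) by (simp only: T2_def[abs_def] S2_def[abs_def] thetaf_def ecdf z_obs \<phi>2_def)
  have T3: "tight_expansion M T3 S3"
    using ipw2(1) by (simp only: T3_def[abs_def] S3_def[abs_def] thetaf_ipw_def k_obs z_obs \<phi>2_def)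
  have target: "sqrt (real m) * (theta_hat m w - theta0) = T1 m w + omega_hat m w * (T2 m w - T3 m w)" for m w
    by (simp add: T1_def T2_def T3_def theta_hat_def algebra_simps)
  have S_eq: "S m w = S1 m w + \<omega> * (S2 m w - S3 m w)" for m w
  proof -
    have "(\<Sum>i<m. \<psi> (obs i w)) = (\<Sum>i<m. k (obs i w) * \<phi>1 (z1 (obs i w))) +
        \<omega> * ((\<Sum>i<m. 1 * \<phi>2 (z2 (obs i w))) - (\<Sum>i<m. k (obs i w) * \<phi>2 (z2 (obs i w))))"
      unfolding sum_subtractf[symmetric] sum_distrib_left sum.distrib[symmetric]
      by (rule sum.cong) (auto simp: \<psi>_def a_def b_def algebra_simps)
    then show ?thesis
      by (simp only: S_def S1_def S2_def S3_def add_divide_distrib diff_divide_distrib[symmetric] times_divide_eq_right)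
  qed
  show ?thesis
  proof (rule M.weak_conv_m_close[OF S_meas _ normal_law_real_distribution[OF \<sigma>2_nonneg] clt])
    show "(\<lambda>w. sqrt (real m) * (theta_hat m w - theta0)) \<in> borel_measurable M" for m
      using theta_meas[of m] by measurable
    show "\<forall>\<^sub>F m in sequentially. \<exists>A\<in>M.events. 1 - \<delta> \<le> M.prob A \<and>
        (\<forall>w\<in>A. \<bar>sqrt (real m) * (theta_hat m w - theta0) - S m w\<bar> \<le> \<kappa>)" if "0 < \<delta>" "0 < \<kappa>" for \<delta> \<kappa>
      unfolding target S_eq by (rule M.tight_expansion_control_variate[OF T1 T2 T3 omega_meas omega_conv that])
  qed
qed

end
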